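(* Let $X$ be a compact $n$-dimensional Kähler manifold with Kähler form $\omega$, $L\to X$ a line bundle with Hermitian metric $h$, and consider the Kähler forms $\omega_t=t\omega$, $t>0$. Let $A$ be a unitary connection with curvature $\sqrt{-1}F$ ($F$ a real closed $2$-form), and set $c=\frac{n[\omega]^{n-1}\cup[F]}{[\omega]^n}$. As $t\to\infty$ the moment map $\mu_{\widetilde{\mathcal{G}}}$, computed with respect to $\omega_t$, has an expansion $$\langle\mu_{\widetilde{\mathcal{G}}}(A),\zeta\rangle=\frac{\sqrt{-1}}{n}\int_X\theta_A(\zeta)\left(\left(-n\omega^{n-1}\wedge F+c\,\omega^n\right)t^{n-1}+O(t^{n-3})\right)$$ $$+\frac1n\int_Xp_*(\zeta)\left(\omega^nt^n-\left(\frac{n(n-1)}{2}\omega^{n-2}\wedge F\wedge F-cn\,\omega^{n-1}\wedge F+\frac12c^2\omega^n\right)t^{n-2}+O(t^{n-4})\right).$$ As a consequence, the Kähler–Yang–Mills coupled equations, in the case of line bundles, arise as the large radius limit of the coupled equations $$\operatorname{Im}\left(e^{-\sqrt{-1}\hat\theta}(\omega-F(h))^n\right)=0,\qquad s(\omega)-\alpha\frac{\operatorname{Re}\left(e^{-\sqrt{-1}\hat\theta}(\omega-F(h))^n\right)}{\omega^n}=f;$$ that is, writing these equations for $\omega_t=t\omega$ (with the corresponding phase), with $F(h)=\sqrt{-1}F$, $\alpha=\alpha't$ and $f=-\alpha't+\tilde f/t$, their leading-order part as $t\to\infty$ is equivalent to the system $$n\,\omega^{n-1}\wedge F=c\,\omega^n,\qquad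 s(\omega)+\alpha'\left(\frac{n(n-1)}{2}\frac{F\wedge F\wedge\omega^{n-2}}{\omega^n}-\frac12c^2\right)=\tilde f,$$ which for constant $\tilde f$ is the Kähler–Yang–Mills system.
   Context: For a Kähler form $\omega$ (here replaced by $\omega_t=t\omega$), the phase $e^{\sqrt{-1}\hat\theta}$ is defined by $\int_X(\omega-F(A))^n\in\mathbb{R}_{>0}e^{\sqrt{-1}\hat\theta}$, and $$\langle\mu_{\widetilde{\mathcal{G}}}(A),\zeta\rangle=\frac{\sqrt{-1}}{n}\int_X\theta_A(\zeta)\operatorname{Im}\left(e^{-\sqrt{-1}\hat\theta}(\omega-F(A))^n\right)+\frac1n\int_Xp_*(\zeta)\operatorname{Re}\left(e^{-\sqrt{-1}\hat\theta}(\omega-F(A))^n\right).$$ Here $\zeta\in\operatorname{Lie}(\widetilde{\mathcal{G}})$, where $\widetilde{\mathcal{G}}$ is the group of unitary automorphisms of $(L,h)$ covering Hamiltonian symplectomorphisms; $\theta_A(\zeta)\in C^\infty(X,\sqrt{-1}\mathbb{R})$ is its vertical part with respect to $A$, and $p_*(\zeta)$ is the zero-average Hamiltonian function of the vector field covered by $\zeta$. The terms $O(t^k)$ denote families of smooth top-degree forms independent of $\zeta$ with the stated growth. Products of cohomology classes of top degree are identified with their integrals. $s$ is the scalar curvature, which satisfies $s(t\omega)=t^{-1}s(\omega)$. The Kähler–Yang–Mills equations (Álvarez-Cónsul, Garcia-Fernandez, García-Prada) for a line bundle are: $\Lambda_\omega F$ is constant, and $s(\omega)$ plus a positive constant times $F\wedge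 F\wedge\omega^{n-2}/\omega^n$ is constant. *)

theory Defs
  imports "HOL-Analysis.Analysis" "HOL-Combinatorics.Permutations"
begin

section \<open>Smooth functions on Euclidean spaces\<close>

abbreviation pd :: "('a::real_normed_vector \<Rightarrow> 'b::real_normed_vector) \<Rightarrow> 'a \<Rightarrow> 'a \<Rightarrow> 'b" where
  "pd f z v \<equiv> frechet_derivative f (at z) v"

primrec C_diff_on :: "nat \<Rightarrow> 'a::real_normed_vector set \<Rightarrow> ('a \<Rightarrow> 'b::real_normed_vector) \<Rightarrow> bool" where
  "C_diff_on 0 S f \<longleftrightarrow> continuous_on S f"
| "C_diff_on (Suc k) S f \<longleftrightarrow>
     (\<forall>z\<in>S. f differentiable (at z)) \<and> (\<forall>v. C_diff_on k S (\<lambda>z. pd f z v))"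

text \<open>Only used for open sets \<^term>\<open>S\<close>.\<close>

definition smooth_on :: "'a::real_normed_vector set \<Rightarrow> ('a \<Rightarrow> 'b::real_normed_vector) \<Rightarrow> bool" where
  "smooth_on S f \<longleftrightarrow> (\<forall>k. C_diff_on k S f)"

primrec iter_pd :: "'a::real_normed_vector list \<Rightarrow> ('a \<Rightarrow> 'b::real_normed_vector) \<Rightarrow> 'a \<Rightarrow> 'b" where
  "iter_pd [] f = f"
| "iter_pd (w # ws) f = iter_pd ws (\<lambda>z. pd f z w)"


section \<open>Complex manifolds\<close>

text \<open>
  The manifold is the whole type \<^typ>\<open>'x\<close>, of complex dimension \<^term>\<open>CARD('n)\<close>. A chart is an open
  set together with a coordinate map, which is relevant on that set only.
\<close>

type_synonym ('x, 'n) chart = "'x set \<times> ('x \<Rightarrow> complex ^ 'n)"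

abbreviation cdom :: "('x, 'n) chart \<Rightarrow> 'x set" where
  "cdom c \<equiv> fst c"

abbreviation coord :: "('x, 'n) chart \<Rightarrow> 'x \<Rightarrow> complex ^ 'n" where
  "coord c \<equiv> snd c"

definition param :: "('x, 'n) chart \<Rightarrow> complex ^ 'n \<Rightarrow> 'x" where
  "param c = inv_into (cdom c) (coord c)"

definition trans_diff :: "('x, 'n::finite) chart \<Rightarrow> ('x, 'n) chart \<Rightarrow> 'x \<Rightarrow> complex ^ 'n \<Rightarrow> complex ^ 'n" where
  "trans_diff c c' p v = pd (coord c' \<circ> param c) (coord c p) v"

definition complex_atlas :: "('x::topological_space, 'n::finite) chart set \<Rightarrow> bool" where
  "complex_atlas \<A> \<longleftrightarrow>
     (\<forall>c\<in>\<A>. open (cdom c) \<and> open (coord c ` cdom c) \<and>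
        homeomorphism (cdom c) (coord c ` cdom c) (coord c) (param c)) \<and>
     (\<Union>c\<in>\<A>. cdom c) = UNIV \<and>
     (\<forall>c\<in>\<A>. \<forall>c'\<in>\<A>. smooth_on (coord c ` (cdom c \<inter> cdom c')) (coord c' \<circ> param c) \<and>
        (\<forall>p\<in>cdom c \<inter> cdom c'. \<forall>v. trans_diff c c' p (\<i> *s v) = \<i> *s trans_diff c c' p v))"

definition chart_at :: "('x, 'n) chart set \<Rightarrow> 'x \<Rightarrow> ('x, 'n) chart" where
  "chart_at \<A> p = (SOME c. c \<in> \<A> \<and> p \<in> cdom c)"

definition vector_field ::
    "('x::topological_space, 'n::finite) chart set \<Rightarrow> (('x, 'n) chart \<Rightarrow> 'x \<Rightarrow> complex ^ 'n) \<Rightarrow> bool" where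
  "vector_field \<A> \<eta> \<longleftrightarrow>
     (\<forall>c\<in>\<A>. smooth_on (coord c ` cdom c) (\<lambda>z. \<eta> c (param c z))) \<and>
     (\<forall>c\<in>\<A>. \<forall>c'\<in>\<A>. \<forall>p\<in>cdom c \<inter> cdom c'. \<eta> c' p = trans_diff c c' p (\<eta> c p))"


section \<open>Differential forms\<close>

text \<open>
  \<^term>\<open>\<alpha> c p vs\<close> is the value at \<^term>\<open>p\<close> of the form \<^term>\<open>\<alpha>\<close> on the tangent vectors whose
  coordinates in the chart \<^term>\<open>c\<close> are \<^term>\<open>vs\<close>; a form of degree \<^term>\<open>d\<close> is relevant only on
  lists of length \<^term>\<open>d\<close>, and only for \<^term>\<open>p\<close> in the domain of \<^term>\<open>c\<close>.
\<close>

type_synonym ('x, 'n, 'k) form = "('x, 'n) chart \<Rightarrow> 'x \<Rightarrow> (complex ^ 'n) list \<Rightarrow> 'k"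

definition alternating :: "nat \<Rightarrow> ('v::real_vector list \<Rightarrow> 'k::real_vector) \<Rightarrow> bool" where
  "alternating d a \<longleftrightarrow>
     (\<forall>xs ys. length xs + length ys + 1 = d \<longrightarrow> linear (\<lambda>u. a (xs @ u # ys))) \<and>
     (\<forall>xs ys zs u. length xs + length ys + length zs + 2 = d \<longrightarrow> a (xs @ u # ys @ u # zs) = 0)"

definition form_on ::
    "('x::topological_space, 'n::finite) chart set \<Rightarrow> 'x set \<Rightarrow> nat \<Rightarrow> ('x, 'n, 'k::real_normed_vector) form \<Rightarrow> bool" where
  "form_on \<A> S d \<alpha> \<longleftrightarrow>
     (\<forall>c\<in>\<A>. (\<forall>p\<in>cdom c \<inter> S. alternating d (\<alpha> c p)) \<and>
        (\<forall>vs. length vs = d \<longrightarrow> smooth_on (coord c ` (cdom c \<inter> S)) (\<lambda>z. \<alpha> c (param c z) vs))) \<and>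
     (\<forall>c\<in>\<A>. \<forall>c'\<in>\<A>. \<forall>p\<in>cdom c \<inter> cdom c' \<inter> S. \<forall>vs. length vs = d \<longrightarrow>
        \<alpha> c p vs = \<alpha> c' p (map (trans_diff c c' p) vs))"

definition form_eq ::
    "('x, 'n) chart set \<Rightarrow> nat \<Rightarrow> ('x, 'n, 'k) form \<Rightarrow> ('x, 'n, 'k) form \<Rightarrow> bool" where
  "form_eq \<A> d \<alpha> \<beta> \<longleftrightarrow> (\<forall>c\<in>\<A>. \<forall>p\<in>cdom c. \<forall>vs. length vs = d \<longrightarrow> \<alpha> c p vs = \<beta> c p vs)"

text \<open>Functions as forms of degree zero.\<close>

definition fn :: "('x \<Rightarrow> 'k) \<Rightarrow> ('x, 'n, 'k) form" where
  "fn f c p vs = f p"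

abbreviation smooth_fun_on ::
    "('x::topological_space, 'n::finite) chart set \<Rightarrow> 'x set \<Rightarrow> ('x \<Rightarrow> 'k::real_normed_vector) \<Rightarrow> bool" where
  "smooth_fun_on \<A> S f \<equiv> form_on \<A> S 0 (fn f)"

text \<open>
  The coordinate formula for the exterior derivative. The vectors \<^term>\<open>vs\<close> are constant in the
  coordinates, so that no bracket terms occur.
\<close>

definition ext_d :: "('x, 'n::finite, 'k::real_normed_vector) form \<Rightarrow> ('x, 'n, 'k) form" where
  "ext_d \<alpha> c p vs =
     (\<Sum>i<length vs. (-1) ^ i *\<^sub>R
        pd (\<lambda>z. \<alpha> c (param c z) (take i vs @ drop (Suc i) vs)) (coord c p) (vs ! i))"

definition fscale :: "real \<Rightarrow> ('x, 'n, real) form \<Rightarrow> ('x, 'n, real) form" where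
  "fscale t \<alpha> c p vs = t * \<alpha> c p vs"

text \<open>
  The wedge product of a list of 2-forms, normalised by
  \<open>(\<alpha> \<and> \<beta>)(v\<^sub>1, \<dots>) = 1 / (k! l!) \<Sum>\<^sub>\<sigma> sign \<sigma> \<alpha>(v\<^sub>\<sigma>\<^sub>1, \<dots>) \<beta>(\<dots>)\<close>. On argument
  lists of the wrong length it is zero; so in complex dimension one, where the subtraction below
  truncates, \<open>F \<and> F \<and> \<omega> ^ (n - 2)\<close> vanishes as a form of degree \<open>2n\<close>.
\<close>

definition wedge2 :: "('v list \<Rightarrow> 'k::field) list \<Rightarrow> 'v list \<Rightarrow> 'k" where
  "wedge2 bs vs = (if length vs = 2 * length bs then
      (\<Sum>\<sigma> | \<sigma> permutes {..<2 * length bs}. of_int (sign \<sigma>) *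
         (\<Prod>i<length bs. (bs ! i) [vs ! \<sigma> (2 * i), vs ! \<sigma> (2 * i + 1)])) / 2 ^ length bs
    else 0)"

definition wedge_forms :: "('x, 'n, 'k::field) form list \<Rightarrow> ('x, 'n, 'k) form" where
  "wedge_forms \<beta>s c p = wedge2 (map (\<lambda>\<beta>. \<beta> c p) \<beta>s)"

definition form_power :: "('x, 'n::finite, 'k::field) form \<Rightarrow> ('x, 'n, 'k) form" where
  "form_power \<beta> = wedge_forms (replicate CARD('n) \<beta>)"

definition wedge_F :: "('x, 'n::finite, real) form \<Rightarrow> ('x, 'n, real) form \<Rightarrow> ('x, 'n, real) form" where
  "wedge_F \<omega> F = wedge_forms (replicate (CARD('n) - 1) \<omega> @ [F])"

definition wedge_FF :: "('x, 'n::finite, real) form \<Rightarrow> ('x, 'n, real) form \<Rightarrow> ('x, 'n, real) form" where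
  "wedge_FF \<omega> F = wedge_forms (replicate (CARD('n) - 2) \<omega> @ [F, F])"

text \<open>
  The frame \<open>e\<^sub>1, \<i> e\<^sub>1, \<dots>, e\<^sub>n, \<i> e\<^sub>n\<close>, which is positively oriented and on which
  \<open>dx\<^sub>1 \<and> dy\<^sub>1 \<and> \<dots> \<and> dx\<^sub>n \<and> dy\<^sub>n\<close> is one. The order of the index type does not matter, since forms of
  degree two commute.
\<close>

definition std_frame :: "(complex ^ 'n::finite) list" where
  "std_frame = concat (map (\<lambda>j. [axis j 1, axis j \<i>]) (SOME js. distinct js \<and> set js = UNIV))"

text \<open>
  Integration of top-degree forms: the manifold is cut into finitely many Borel pieces, each
  relatively compact in a chart, and over each piece one integrates the coefficient of the form
  in the coordinates. By the change of variables formula the sum does not depend on the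
  decomposition (holomorphic coordinate changes preserve the orientation).
\<close>

definition chart_decomposition ::
    "('x::topological_space, 'n::finite) chart set \<Rightarrow> (('x, 'n) chart \<times> 'x set) set \<Rightarrow> bool" where
  "chart_decomposition \<A> P \<longleftrightarrow> finite P \<and>
     (\<forall>(c, B)\<in>P. c \<in> \<A> \<and> B \<in> sets borel \<and> (\<exists>K. compact K \<and> B \<subseteq> K \<and> K \<subseteq> cdom c)) \<and>
     (\<forall>x\<in>P. \<forall>y\<in>P. x \<noteq> y \<longrightarrow> snd x \<inter> snd y = {}) \<and>
     (\<Union>x\<in>P. snd x) = UNIV"

definition form_integral ::
    "('x::topological_space, 'n::finite) chart set \<Rightarrow>
     ('x, 'n, 'k::{banach, second_countable_topology}) form \<Rightarrow> 'k" where
  "form_integral \<A> \<alpha> = (\<Sum>(c, B)\<in>(SOME P. chart_decomposition \<A> P).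
     set_lebesgue_integral lborel (coord c ` B) (\<lambda>z. \<alpha> c (param c z) std_frame))"

text \<open>
  The function \<open>\<beta> / \<gamma>\<close> for top-degree forms, \<^term>\<open>\<gamma>\<close> nowhere zero. As these forms are sections
  of a line bundle, the choice of chart and frame is immaterial.
\<close>

definition form_ratio ::
    "('x, 'n::finite) chart set \<Rightarrow> ('x, 'n, real) form \<Rightarrow> ('x, 'n, real) form \<Rightarrow> 'x \<Rightarrow> real" where
  "form_ratio \<A> \<beta> \<gamma> p = \<beta> (chart_at \<A> p) p std_frame / \<gamma> (chart_at \<A> p) p std_frame"

text \<open>
  A family of smooth forms which is \<open>O(t ^ k)\<close> as \<open>t \<rightarrow> \<infinity>\<close>, in the topology of smooth convergence:
  the coefficients and all their partial derivatives are bounded by multiples of \<open>t ^ k\<close>, uniformly on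
  compact subsets of charts.
\<close>

definition form_bigo ::
    "('x::topological_space, 'n::finite) chart set \<Rightarrow> nat \<Rightarrow> int \<Rightarrow>
     (real \<Rightarrow> ('x, 'n, 'k::real_normed_vector) form) \<Rightarrow> bool" where
  "form_bigo \<A> d k R \<longleftrightarrow> (\<forall>t>0. form_on \<A> UNIV d (R t)) \<and>
     (\<forall>c\<in>\<A>. \<forall>K vs ws. compact K \<and> K \<subseteq> coord c ` cdom c \<and> length vs = d \<longrightarrow>
        (\<exists>C. \<forall>\<^sub>F t in at_top. \<forall>z\<in>K.
           norm (iter_pd ws (\<lambda>y. R t c (param c y) vs) z) \<le> C * t powi k))"

text \<open>\<^term>\<open>L\<close> is the coefficient of the leading power \<open>t ^ k\<close> of the family \<^term>\<open>E\<close>.\<close>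

definition leading_part ::
    "('x::topological_space, 'n::finite) chart set \<Rightarrow> nat \<Rightarrow> int \<Rightarrow>
     (real \<Rightarrow> ('x, 'n, real) form) \<Rightarrow> ('x, 'n, real) form \<Rightarrow> bool" where
  "leading_part \<A> d k E L \<longleftrightarrow> (\<exists>R. form_bigo \<A> d (k - 1) R \<and>
     (\<forall>\<^sub>F t in at_top. form_eq \<A> d (E t) (\<lambda>c p vs. t powi k * L c p vs + R t c p vs)))"


section \<open>Kaehler forms\<close>

definition closed_form :: "('x, 'n::finite) chart set \<Rightarrow> nat \<Rightarrow> ('x, 'n, real) form \<Rightarrow> bool" where
  "closed_form \<A> d \<alpha> \<longleftrightarrow> form_eq \<A> (Suc d) (ext_d \<alpha>) (\<lambda>c p vs. 0)"

definition kaehler_form ::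
    "('x::topological_space, 'n::finite) chart set \<Rightarrow> ('x, 'n, real) form \<Rightarrow> bool" where
  "kaehler_form \<A> \<omega> \<longleftrightarrow> form_on \<A> UNIV 2 \<omega> \<and> closed_form \<A> 2 \<omega> \<and>
     (\<forall>c\<in>\<A>. \<forall>p\<in>cdom c.
        (\<forall>u v. \<omega> c p [\<i> *s u, \<i> *s v] = \<omega> c p [u, v]) \<and>
        (\<forall>u. u \<noteq> 0 \<longrightarrow> \<omega> c p [u, \<i> *s u] > 0))"

text \<open>
  The scalar curvature of a Riemannian metric \<^term>\<open>G\<close> on a Euclidean space, with
  \<open>R(u, v) w = \<nabla>\<^sub>u \<nabla>\<^sub>v w - \<nabla>\<^sub>v \<nabla>\<^sub>u w - \<nabla>\<^sub>[\<^sub>u\<^sub>,\<^sub>v\<^sub>] w\<close> and the Ricci tensor the trace of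
  \<open>u \<mapsto> R(u, v) w\<close>; it is positive for round spheres. \<open>sharp\<close> raises an index.
\<close>

definition sharp :: "('a::real_vector \<Rightarrow> 'a \<Rightarrow> real) \<Rightarrow> ('a \<Rightarrow> real) \<Rightarrow> 'a" where
  "sharp B l = (THE w. \<forall>x. B w x = l x)"

definition christoffel ::
    "('a::euclidean_space \<Rightarrow> 'a \<Rightarrow> 'a \<Rightarrow> real) \<Rightarrow> 'a \<Rightarrow> 'a \<Rightarrow> 'a \<Rightarrow> 'a" where
  "christoffel G z u v = sharp (G z)
     (\<lambda>w. (pd (\<lambda>y. G y v w) z u + pd (\<lambda>y. G y u w) z v - pd (\<lambda>y. G y u v) z w) / 2)"

definition riemann ::
    "('a::euclidean_space \<Rightarrow> 'a \<Rightarrow> 'a \<Rightarrow> real) \<Rightarrow> 'a \<Rightarrow> 'a \<Rightarrow> 'a \<Rightarrow> 'a \<Rightarrow> 'a" where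
  "riemann G z u v w =
     pd (\<lambda>y. christoffel G y v w) z u - pd (\<lambda>y. christoffel G y u w) z v
     + christoffel G z u (christoffel G z v w) - christoffel G z v (christoffel G z u w)"

definition ricci :: "('a::euclidean_space \<Rightarrow> 'a \<Rightarrow> 'a \<Rightarrow> real) \<Rightarrow> 'a \<Rightarrow> 'a \<Rightarrow> 'a \<Rightarrow> real" where
  "ricci G z v w = (\<Sum>b\<in>Basis. riemann G z b v w \<bullet> b)"

definition metric_scalar_curvature :: "('a::euclidean_space \<Rightarrow> 'a \<Rightarrow> 'a \<Rightarrow> real) \<Rightarrow> 'a \<Rightarrow> real" where
  "metric_scalar_curvature G z = (\<Sum>b\<in>Basis. sharp (G z) (ricci G z b) \<bullet> b)"

text \<open>The scalar curvature of the Kaehler metric \<open>\<omega>(\<cdot>, J \<cdot>)\<close>.\<close>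

definition scalar_curvature ::
    "('x, 'n::finite) chart set \<Rightarrow> ('x, 'n, real) form \<Rightarrow> 'x \<Rightarrow> real" where
  "scalar_curvature \<A> \<omega> p = (let c = chart_at \<A> p in
     metric_scalar_curvature (\<lambda>z u v. \<omega> c (param c z) [u, \<i> *s v]) (coord c p))"

text \<open>
  The contraction \<open>\<Lambda>\<^sub>\<omega> F\<close> of a real 2-form, computed in a complex basis that is unitary with
  respect to \<^term>\<open>\<omega>\<close> (the result does not depend on it).
\<close>

definition unitary_frame ::
    "('x, 'n::finite, real) form \<Rightarrow> ('x, 'n) chart \<Rightarrow> 'x \<Rightarrow> ('n \<Rightarrow> complex ^ 'n) \<Rightarrow> bool" where
  "unitary_frame \<omega> c p e \<longleftrightarrow> (\<forall>j k. \<omega> c p [e j, \<i> *s e k] = (if j = k then 1 else 0) \<and>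
     \<omega> c p [e j, e k] = 0)"

definition contraction ::
    "('x, 'n::finite) chart set \<Rightarrow> ('x, 'n, real) form \<Rightarrow> ('x, 'n, real) form \<Rightarrow> 'x \<Rightarrow> real" where
  "contraction \<A> \<omega> F p = (let c = chart_at \<A> p; e = (SOME e. unitary_frame \<omega> c p e) in
     \<Sum>j\<in>UNIV. F c p [e j, \<i> *s e j])"


section \<open>Hermitian line bundles and connections\<close>

text \<open>
  A line bundle is given by an open cover \<open>W\<^sub>i\<close>, local frames \<open>e\<^sub>i\<close> over \<open>W\<^sub>i\<close> and transition
  functions with \<open>e\<^sub>j = g\<^sub>i\<^sub>j e\<^sub>i\<close>; a Hermitian metric by the functions \<open>h\<^sub>i = |e\<^sub>i|\<^sup>2\<close>; and a
  connection by the 1-forms \<open>A\<^sub>i\<close> with \<open>\<nabla> e\<^sub>i = A\<^sub>i e\<^sub>i\<close>.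
\<close>

definition line_bundle ::
    "('x::topological_space, 'n::finite) chart set \<Rightarrow> ('i \<Rightarrow> 'x set) \<Rightarrow> ('i \<Rightarrow> 'i \<Rightarrow> 'x \<Rightarrow> complex) \<Rightarrow> bool" where
  "line_bundle \<A> W g \<longleftrightarrow>
     (\<forall>i. open (W i)) \<and> (\<Union>i. W i) = UNIV \<and>
     (\<forall>i j. smooth_fun_on \<A> (W i \<inter> W j) (g i j) \<and> (\<forall>p\<in>W i \<inter> W j. g i j p \<noteq> 0)) \<and>
     (\<forall>i. \<forall>p\<in>W i. g i i p = 1) \<and>
     (\<forall>i j k. \<forall>p\<in>W i \<inter> W j \<inter> W k. g i j p * g j k p = g i k p)"

definition hermitian_metric ::
    "('x::topological_space, 'n::finite) chart set \<Rightarrow> ('i \<Rightarrow> 'x set) \<Rightarrow> ('i \<Rightarrow> 'i \<Rightarrow> 'x \<Rightarrow> complex) \<Rightarrow>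
     ('i \<Rightarrow> 'x \<Rightarrow> real) \<Rightarrow> bool" where
  "hermitian_metric \<A> W g h \<longleftrightarrow>
     (\<forall>i. smooth_fun_on \<A> (W i) (h i) \<and> (\<forall>p\<in>W i. h i p > 0)) \<and>
     (\<forall>i j. \<forall>p\<in>W i \<inter> W j. h j p = (cmod (g i j p))\<^sup>2 * h i p)"

definition unitary_connection ::
    "('x::topological_space, 'n::finite) chart set \<Rightarrow> ('i \<Rightarrow> 'x set) \<Rightarrow> ('i \<Rightarrow> 'i \<Rightarrow> 'x \<Rightarrow> complex) \<Rightarrow>
     ('i \<Rightarrow> 'x \<Rightarrow> real) \<Rightarrow> ('i \<Rightarrow> ('x, 'n, complex) form) \<Rightarrow> bool" where
  "unitary_connection \<A> W g h A \<longleftrightarrow>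
     (\<forall>i. form_on \<A> (W i) 1 (A i)) \<and>
     (\<forall>i j. \<forall>c\<in>\<A>. \<forall>p\<in>cdom c \<inter> W i \<inter> W j. \<forall>v.
        A j c p [v] = A i c p [v] + ext_d (fn (g i j)) c p [v] / g i j p) \<and>
     (\<forall>i. \<forall>c\<in>\<A>. \<forall>p\<in>cdom c \<inter> W i. \<forall>v.
        ext_d (fn (h i)) c p [v] = 2 * Re (A i c p [v]) * h i p)"

definition curvature :: "('i \<Rightarrow> 'x set) \<Rightarrow> ('i \<Rightarrow> ('x, 'n::finite, complex) form) \<Rightarrow> ('x, 'n, complex) form" where
  "curvature W A c p vs = ext_d (A (SOME i. p \<in> W i)) c p vs"


section \<open>The extended gauge group and the moment map\<close>

text \<open>The sign convention for the Hamiltonian function is \<open>df = \<sigma>(\<eta>, \<cdot>)\<close>.\<close>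

definition hamiltonian_function ::
    "('x::topological_space, 'n::finite) chart set \<Rightarrow> ('x, 'n, real) form \<Rightarrow>
     (('x, 'n) chart \<Rightarrow> 'x \<Rightarrow> complex ^ 'n) \<Rightarrow> ('x \<Rightarrow> real) \<Rightarrow> bool" where
  "hamiltonian_function \<A> \<sigma> \<eta> f \<longleftrightarrow> smooth_fun_on \<A> UNIV f \<and>
     (\<forall>c\<in>\<A>. \<forall>p\<in>cdom c. \<forall>v. ext_d (fn f) c p [v] = \<sigma> c p [\<eta> c p, v])"

text \<open>
  An infinitesimal automorphism of \<open>(L, h)\<close> is a vector field on the total space of \<open>L\<close>, which in
  the trivialisation by \<open>e\<^sub>i\<close>, with fibre coordinate \<open>\<lambda>\<close>, is \<open>\<eta> + u\<^sub>i \<lambda> \<partial>/\<partial>\<lambda>\<close>. It preserves the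
  function \<open>|\<lambda>|\<^sup>2 h\<^sub>i\<close> and covers the vector field \<open>\<eta>\<close>, which is to be Hamiltonian.
\<close>

type_synonym ('x, 'n, 'i) inf_aut = "(('x, 'n) chart \<Rightarrow> 'x \<Rightarrow> complex ^ 'n) \<times> ('i \<Rightarrow> 'x \<Rightarrow> complex)"

definition lie_ext_gauge ::
    "('x::topological_space, 'n::finite) chart set \<Rightarrow> ('i \<Rightarrow> 'x set) \<Rightarrow> ('i \<Rightarrow> 'i \<Rightarrow> 'x \<Rightarrow> complex) \<Rightarrow>
     ('i \<Rightarrow> 'x \<Rightarrow> real) \<Rightarrow> ('x, 'n, real) form \<Rightarrow> ('x, 'n, 'i) inf_aut set" where
  "lie_ext_gauge \<A> W g h \<omega> = {(\<eta>, u).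
     vector_field \<A> \<eta> \<and> (\<exists>f. hamiltonian_function \<A> \<omega> \<eta> f) \<and>
     (\<forall>i. smooth_fun_on \<A> (W i) (u i)) \<and>
     (\<forall>i j. \<forall>c\<in>\<A>. \<forall>p\<in>cdom c \<inter> W i \<inter> W j.
        u i p = u j p + ext_d (fn (g i j)) c p [\<eta> c p] / g i j p) \<and>
     (\<forall>i. \<forall>c\<in>\<A>. \<forall>p\<in>cdom c \<inter> W i.
        ext_d (fn (h i)) c p [\<eta> c p] + 2 * Re (u i p) * h i p = 0)}"

text \<open>
  The vertical part: the horizontal lift of \<open>\<eta>\<close> is \<open>\<eta> - A\<^sub>i(\<eta>) \<lambda> \<partial>/\<partial>\<lambda>\<close>.
\<close>

definition vertical_part ::
    "('x, 'n::finite) chart set \<Rightarrow> ('i \<Rightarrow> 'x set) \<Rightarrow> ('i \<Rightarrow> ('x, 'n, complex) form) \<Rightarrow>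
     ('x, 'n, 'i) inf_aut \<Rightarrow> 'x \<Rightarrow> complex" where
  "vertical_part \<A> W A \<zeta> p = (let i = (SOME i. p \<in> W i); c = chart_at \<A> p in
     snd \<zeta> i p + A i c p [fst \<zeta> c p])"

definition ham_part ::
    "('x::topological_space, 'n::finite) chart set \<Rightarrow> ('x, 'n, real) form \<Rightarrow> ('x, 'n, 'i) inf_aut \<Rightarrow> 'x \<Rightarrow> real" where
  "ham_part \<A> \<sigma> \<zeta> = (THE f. hamiltonian_function \<A> \<sigma> (fst \<zeta>) f \<and>
     form_integral \<A> (\<lambda>c p vs. f p * form_power \<sigma> c p vs) = 0)"

text \<open>The form \<open>(\<omega> - \<Phi>)\<^sup>n\<close>, for a curvature form \<^term>\<open>\<Phi>\<close>, and the phase.\<close>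

definition dhym_form ::
    "('x, 'n::finite, real) form \<Rightarrow> ('x, 'n, complex) form \<Rightarrow> ('x, 'n, complex) form" where
  "dhym_form \<omega> \<Phi> = form_power (\<lambda>c p vs. complex_of_real (\<omega> c p vs) - \<Phi> c p vs)"

definition phase_angle ::
    "('x::topological_space, 'n::finite) chart set \<Rightarrow> ('x, 'n, real) form \<Rightarrow> ('x, 'n, complex) form \<Rightarrow> real" where
  "phase_angle \<A> \<omega> \<Phi> = (SOME \<theta>. \<exists>r>0.
     form_integral \<A> (dhym_form \<omega> \<Phi>) = complex_of_real r * exp (\<i> * complex_of_real \<theta>))"

definition dhym_Im ::
    "('x::topological_space, 'n::finite) chart set \<Rightarrow> ('x, 'n, real) form \<Rightarrow> ('x, 'n, complex) form \<Rightarrow>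
     ('x, 'n, real) form" where
  "dhym_Im \<A> \<omega> \<Phi> c p vs =
     Im (exp (- \<i> * complex_of_real (phase_angle \<A> \<omega> \<Phi>)) * dhym_form \<omega> \<Phi> c p vs)"

definition dhym_Re ::
    "('x::topological_space, 'n::finite) chart set \<Rightarrow> ('x, 'n, real) form \<Rightarrow> ('x, 'n, complex) form \<Rightarrow>
     ('x, 'n, real) form" where
  "dhym_Re \<A> \<omega> \<Phi> c p vs =
     Re (exp (- \<i> * complex_of_real (phase_angle \<A> \<omega> \<Phi>)) * dhym_form \<omega> \<Phi> c p vs)"

text \<open>
  \<open>i / n \<integral> \<theta>\<^sub>A(\<zeta>) \<alpha> + 1 / n \<integral> p\<^sub>*(\<zeta>) \<beta>\<close>, with Hamiltonian functions taken with respect to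
  \<^term>\<open>\<sigma>\<close>.
\<close>

definition gauge_pairing ::
    "('x::topological_space, 'n::finite) chart set \<Rightarrow> ('i \<Rightarrow> 'x set) \<Rightarrow> ('i \<Rightarrow> ('x, 'n, complex) form) \<Rightarrow>
     ('x, 'n, real) form \<Rightarrow> ('x, 'n, real) form \<Rightarrow> ('x, 'n, real) form \<Rightarrow> ('x, 'n, 'i) inf_aut \<Rightarrow> complex" where
  "gauge_pairing \<A> W A \<sigma> \<alpha> \<beta> \<zeta> =
     \<i> / of_nat CARD('n) *
       form_integral \<A> (\<lambda>c p vs. vertical_part \<A> W A \<zeta> p * complex_of_real (\<alpha> c p vs))
     + 1 / of_nat CARD('n) *
       form_integral \<A> (\<lambda>c p vs. complex_of_real (ham_part \<A> \<sigma> \<zeta> p * \<beta> c p vs))"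

definition moment_map ::
    "('x::topological_space, 'n::finite) chart set \<Rightarrow> ('i \<Rightarrow> 'x set) \<Rightarrow> ('x, 'n, real) form \<Rightarrow>
     ('x, 'n, real) form \<Rightarrow> ('i \<Rightarrow> ('x, 'n, complex) form) \<Rightarrow> ('x, 'n, 'i) inf_aut \<Rightarrow> complex" where
  "moment_map \<A> W \<omega> \<sigma> A = gauge_pairing \<A> W A \<sigma>
     (dhym_Im \<A> \<omega> (curvature W A)) (dhym_Re \<A> \<omega> (curvature W A))"


section \<open>The coupled equations\<close>

text \<open>
  The coupled equations with constant \<^term>\<open>\<alpha>\<close> and function \<^term>\<open>f\<close> are the vanishing of
  \<^const>\<open>dhym_Im\<close> and of the following function.
\<close>

definition coupled_residual ::
    "('x::topological_space, 'n::finite) chart set \<Rightarrow> ('x, 'n, real) form \<Rightarrow> ('x, 'n, complex) form \<Rightarrow>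
     real \<Rightarrow> ('x \<Rightarrow> real) \<Rightarrow> 'x \<Rightarrow> real" where
  "coupled_residual \<A> \<omega> \<Phi> \<alpha> f p =
     scalar_curvature \<A> \<omega> p - \<alpha> * form_ratio \<A> (dhym_Re \<A> \<omega> \<Phi>) (form_power \<omega>) p - f p"

definition slope :: "('x::topological_space, 'n::finite) chart set \<Rightarrow> ('x, 'n, real) form \<Rightarrow> ('x, 'n, real) form \<Rightarrow> real" where
  "slope \<A> \<omega> F = real CARD('n) * form_integral \<A> (wedge_F \<omega> F) / form_integral \<A> (form_power \<omega>)"

definition limit_system ::
    "('x::topological_space, 'n::finite) chart set \<Rightarrow> ('x, 'n, real) form \<Rightarrow> ('x, 'n, real) form \<Rightarrow>
     real \<Rightarrow> ('x \<Rightarrow> real) \<Rightarrow> bool" where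
  "limit_system \<A> \<omega> F \<alpha>' f \<longleftrightarrow>
     form_eq \<A> (2 * CARD('n)) (\<lambda>c p vs. real CARD('n) * wedge_F \<omega> F c p vs)
       (\<lambda>c p vs. slope \<A> \<omega> F * form_power \<omega> c p vs) \<and>
     (\<forall>p. scalar_curvature \<A> \<omega> p +
        \<alpha>' * (real CARD('n) * (real CARD('n) - 1) / 2 * form_ratio \<A> (wedge_FF \<omega> F) (form_power \<omega>) p
               - (slope \<A> \<omega> F)\<^sup>2 / 2) = f p)"

definition kaehler_yang_mills ::
    "('x::topological_space, 'n::finite) chart set \<Rightarrow> ('x, 'n, real) form \<Rightarrow> ('x, 'n, real) form \<Rightarrow>
     real \<Rightarrow> bool" where
  "kaehler_yang_mills \<A> \<omega> F \<kappa> \<longleftrightarrow>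
     (\<exists>a. \<forall>p. contraction \<A> \<omega> F p = a) \<and>
     (\<exists>b. \<forall>p. scalar_curvature \<A> \<omega> p + \<kappa> * form_ratio \<A> (wedge_FF \<omega> F) (form_power \<omega>) p = b)"

end

theory Submission
  imports Defs "HOL-Library.Landau_Symbols"
begin

text \<open>
  Write \<open>W\<^sub>k = \<omega>\<^sup>n\<^sup>-\<^sup>k \<and> F\<^sup>k\<close>. Two-forms commute, so the binomial theorem gives
  \<open>(t \<omega> - \<i> F)\<^sup>n = \<Sum>\<^sub>k (n choose k) (- \<i>)\<^sup>k t\<^sup>n\<^sup>-\<^sup>k W\<^sub>k\<close>, a combination of finitely many forms that do not depend
  on \<open>t\<close>. All of the \<open>t\<close>-dependence sits in scalar factors, which involve the phase \<open>\<theta>\<close> of the integral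
  of this form. With \<open>c = n \<integral>W\<^sub>1 / \<integral>W\<^sub>0\<close> the integral is
  \<open>t\<^sup>n \<integral>W\<^sub>0 (1 - \<i> c / t + O(t\<^sup>-\<^sup>2))\<close>, and since the coefficients are alternately real and imaginary,
  \<open>cos \<theta> = 1 - c\<^sup>2 / (2 t\<^sup>2) + O(t\<^sup>-\<^sup>4)\<close> and \<open>sin \<theta> = - c / t + O(t\<^sup>-\<^sup>3)\<close> (\<open>phase_asymptotics\<close>). Inserting
  this into the imaginary and real part of \<open>e\<^sup>-\<^sup>\<i>\<^sup>\<theta> (t \<omega> - \<i> F)\<^sup>n\<close> yields the expansion
  (\<open>coefficient_asymptotics\<close>, \<open>dhym_expansion\<close>). The remainders are combinations of the \<open>W\<^sub>k\<close> with small
  factors, hence small with all derivatives, and the moment map only pairs these forms with \<open>\<zeta>\<close>.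

  For the coupled equations one divides the real part by \<open>(t \<omega>)\<^sup>n = t\<^sup>n \<omega>\<^sup>n\<close>. The scalar curvature satisfies
  \<open>s(t \<omega>) = s(\<omega>) / t\<close>, as the Levi-Civita connection does not see the factor \<open>t\<close>; so in the second equation
  the constants of order \<open>t\<close> cancel and all remaining leading terms are of order \<open>1 / t\<close>.

  Finally \<open>n \<omega>\<^sup>n\<^sup>-\<^sup>1 \<and> F = (\<Lambda>\<^sub>\<omega> F) \<omega>\<^sup>n\<close> (\<open>wedge2_contraction\<close>). It is checked on a unitary frame, where only
  permutations of blocks \<open>{e\<^sub>j, \<i> e\<^sub>j}\<close> contribute to the wedge products, and carried over to other vectors
  because top-degree forms at a point are proportional. The same computation shows that \<open>\<omega>\<^sup>n\<close> is a volume
  form, so \<open>\<integral>W\<^sub>0 > 0\<close>; and integrating the identity shows that a constant \<open>\<Lambda>\<^sub>\<omega> F\<close> must be equal to \<open>c\<close>.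
  Hence the leading-order system for a constant right-hand side is the Kaehler-Yang-Mills system.
\<close>

section \<open>Smooth functions\<close>

lemma has_derivative_cong_open:
  assumes "open S" "z \<in> S" "\<And>y. y \<in> S \<Longrightarrow> f y = g y"
  shows "(f has_derivative D) (at z) \<longleftrightarrow> (g has_derivative D) (at z)"
  using assms by (metis has_derivative_transform_within_open)

lemma pd_cong_open:
  assumes "open S" "z \<in> S" "\<And>y. y \<in> S \<Longrightarrow> f y = g y"
  shows "frechet_derivative f (at z) = frechet_derivative g (at z)"
  unfolding frechet_derivative_def using has_derivative_cong_open[OF assms] by simp

lemma differentiable_cong_open:
  assumes "open S" "z \<in> S" "\<And>y. y \<in> S \<Longrightarrow> f y = g y"
  shows "f differentiable (at z) \<longleftrightarrow> g differentiable (at z)"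
  unfolding differentiable_def using has_derivative_cong_open[OF assms] by simp

lemma pd_eqI: "(f has_derivative D) (at z) \<Longrightarrow> pd f z v = D v"
  using frechet_derivative_at by metis

lemma pd_has_derivative: "f differentiable (at z) \<Longrightarrow> (f has_derivative pd f z) (at z)"
  by (simp add: frechet_derivative_works)

lemma C_diff_on_cong:
  assumes "open S" "\<And>y. y \<in> S \<Longrightarrow> f y = g y"
  shows "C_diff_on k S f \<longleftrightarrow> C_diff_on k S g"
  using assms(2)
proof (induction k arbitrary: f g)
  case 0
  then show ?case by (simp cong: continuous_on_cong)
next
  case (Suc k)
  have "\<And>v. C_diff_on k S (\<lambda>z. pd f z v) \<longleftrightarrow> C_diff_on k S (\<lambda>z. pd g z v)"
    by (rule Suc.IH) (use pd_cong_open[OF assms(1)] Suc.prems in metis)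
  then show ?case
    using differentiable_cong_open[OF assms(1) _ Suc.prems] by auto
qed

lemma C_diff_on_Suc_imp: "C_diff_on (Suc k) S f \<Longrightarrow> C_diff_on k S f"
proof (induction k arbitrary: f)
  case 0
  then show ?case
    by (auto intro!: continuous_at_imp_continuous_on differentiable_imp_continuous_within)
next
  case (Suc k)
  then show ?case by simp
qed

lemma C_diff_on_const [simp]: "C_diff_on k S (\<lambda>z. a)"
  by (induction k arbitrary: a) auto

lemma C_diff_on_add:
  assumes "open S" "C_diff_on k S f" "C_diff_on k S g"
  shows "C_diff_on k S (\<lambda>z. f z + g z)"
  using assms(2,3)
proof (induction k arbitrary: f g)
  case 0
  then show ?case by (simp add: continuous_on_add)
next
  case (Suc k)
  have "C_diff_on k S (\<lambda>z. pd (\<lambda>z. f z + g z) z v)" for v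
  proof -
    have "C_diff_on k S (\<lambda>z. pd f z v + pd g z v)"
      using Suc by auto
    moreover have "pd (\<lambda>z. f z + g z) z v = pd f z v + pd g z v" if "z \<in> S" for z
      using Suc.prems that by (intro pd_eqI has_derivative_add pd_has_derivative) auto
    ultimately show ?thesis using C_diff_on_cong[OF assms(1)] by (smt (verit, best))
  qed
  then show ?case using Suc.prems by auto
qed

lemma C_diff_on_mult:
  fixes f g :: "'a::real_normed_vector \<Rightarrow> real"
  assumes "open S" "C_diff_on k S f" "C_diff_on k S g"
  shows "C_diff_on k S (\<lambda>z. f z * g z)"
  using assms(2,3)
proof (induction k arbitrary: f g)
  case 0
  then show ?case by (simp add: continuous_on_mult)
next
  case (Suc k)
  have "C_diff_on k S (\<lambda>z. pd (\<lambda>z. f z * g z) z v)" for v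
  proof -
    have "C_diff_on k S (\<lambda>z. f z * pd g z v + pd f z v * g z)"
      using Suc.prems Suc.prems[THEN C_diff_on_Suc_imp]
      by (intro C_diff_on_add[OF assms(1)] Suc.IH) auto
    moreover have "pd (\<lambda>z. f z * g z) z v = f z * pd g z v + pd f z v * g z" if "z \<in> S" for z
      using Suc.prems that by (intro pd_eqI has_derivative_mult pd_has_derivative) auto
    ultimately show ?thesis using C_diff_on_cong[OF assms(1)] by (smt (verit, best))
  qed
  then show ?case using Suc.prems by auto
qed

text \<open>The derivative of \<open>1 / f\<close> is \<open>- f' (1 / f)\<^sup>2\<close>, so that each further order of differentiability
  follows from the previous one by the product rule.\<close>

lemma C_diff_on_inverse:
  fixes f :: "'a::real_normed_vector \<Rightarrow> real"
  assumes "open S" "C_diff_on k S f" "\<And>z. z \<in> S \<Longrightarrow> f z \<noteq> 0"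
  shows "C_diff_on k S (\<lambda>z. inverse (f z))"
  using assms(2)
proof (induction k)
  case 0
  then show ?case by (simp add: continuous_on_inverse assms(3))
next
  case (Suc k)
  have diff: "(\<lambda>z. inverse (f z)) differentiable (at z)" if "z \<in> S" for z
    using Suc.prems that assms(3) by (intro differentiable_inverse) auto
  have "C_diff_on k S (\<lambda>z. pd (\<lambda>z. inverse (f z)) z v)" for v
  proof -
    have I: "C_diff_on k S (\<lambda>z. inverse (f z))"
      using Suc C_diff_on_Suc_imp by blast
    have "C_diff_on k S (\<lambda>z. (-1) * ((inverse (f z) * pd f z v) * inverse (f z)))"
      using Suc.prems I by (intro C_diff_on_mult[OF assms(1)]) auto
    moreover have "pd (\<lambda>z. inverse (f z)) z v = (-1) * ((inverse (f z) * pd f z v) * inverse (f z))"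
      if "z \<in> S" for z
      using Suc.prems that assms(3)
      by (subst pd_eqI[OF Deriv.has_derivative_inverse[OF _ pd_has_derivative]]) auto
    ultimately show ?thesis using C_diff_on_cong[OF assms(1)] by (smt (verit, best))
  qed
  then show ?case using diff by auto
qed

lemma smooth_on_cong:
  "open S \<Longrightarrow> (\<And>y. y \<in> S \<Longrightarrow> f y = g y) \<Longrightarrow> smooth_on S f \<longleftrightarrow> smooth_on S g"
  unfolding smooth_on_def using C_diff_on_cong by metis

lemma smooth_on_const [simp]: "smooth_on S (\<lambda>z. a)"
  by (simp add: smooth_on_def)

lemma smooth_on_add:
  "open S \<Longrightarrow> smooth_on S f \<Longrightarrow> smooth_on S g \<Longrightarrow> smooth_on S (\<lambda>z. f z + g z)"
  by (simp add: smooth_on_def C_diff_on_add)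

lemma smooth_on_mult:
  fixes f g :: "'a::real_normed_vector \<Rightarrow> real"
  shows "open S \<Longrightarrow> smooth_on S f \<Longrightarrow> smooth_on S g \<Longrightarrow> smooth_on S (\<lambda>z. f z * g z)"
  by (simp add: smooth_on_def C_diff_on_mult)

lemma smooth_on_divide:
  fixes f g :: "'a::real_normed_vector \<Rightarrow> real"
  assumes "open S" "smooth_on S f" "smooth_on S g" "\<And>z. z \<in> S \<Longrightarrow> g z \<noteq> 0"
  shows "smooth_on S (\<lambda>z. f z / g z)"
  unfolding divide_inverse using assms
  by (intro smooth_on_mult) (auto simp: smooth_on_def C_diff_on_inverse)

lemma smooth_on_sum:
  "open S \<Longrightarrow> (\<And>i. i \<in> I \<Longrightarrow> smooth_on S (f i)) \<Longrightarrow> smooth_on S (\<lambda>z. \<Sum>i\<in>I. f i z)"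
  by (induction I rule: infinite_finite_induct) (auto intro: smooth_on_add)

lemma smooth_on_prod:
  fixes f :: "'i \<Rightarrow> 'a::real_normed_vector \<Rightarrow> real"
  shows "open S \<Longrightarrow> (\<And>i. i \<in> I \<Longrightarrow> smooth_on S (f i)) \<Longrightarrow> smooth_on S (\<lambda>z. \<Prod>i\<in>I. f i z)"
  by (induction I rule: infinite_finite_induct) (auto intro: smooth_on_mult)

lemma smooth_on_differentiable: "smooth_on S f \<Longrightarrow> z \<in> S \<Longrightarrow> f differentiable (at z)"
  unfolding smooth_on_def using C_diff_on.simps(2) by blast

lemma smooth_on_continuous: "smooth_on S f \<Longrightarrow> continuous_on S f"
  unfolding smooth_on_def using C_diff_on.simps(1) by blast

lemma smooth_on_pd: "smooth_on S f \<Longrightarrow> smooth_on S (\<lambda>z. pd f z v)"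
  unfolding smooth_on_def using C_diff_on.simps(2) by blast

lemma iter_pd_cong:
  assumes "open S" "\<And>y. y \<in> S \<Longrightarrow> f y = g y" "z \<in> S"
  shows "iter_pd ws f z = iter_pd ws g z"
  using assms(2)
proof (induction ws arbitrary: f g)
  case Nil
  then show ?case using assms(3) by simp
next
  case (Cons w ws)
  have "iter_pd ws (\<lambda>z. pd f z w) z = iter_pd ws (\<lambda>z. pd g z w) z"
    by (rule Cons.IH) (use pd_cong_open[OF assms(1)] Cons.prems in metis)
  then show ?case by simp
qed

lemma smooth_on_iter_pd: "smooth_on S f \<Longrightarrow> smooth_on S (iter_pd ws f)"
  by (induction ws arbitrary: f) (auto intro: smooth_on_pd)

text \<open>The remainder terms below are combinations of finitely many fixed forms whose coefficients
  depend on \<open>t\<close> only; their partial derivatives are then estimated through this lemma.\<close>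

lemma iter_pd_linear_combination:
  fixes f :: "'i \<Rightarrow> 'a::real_normed_vector \<Rightarrow> real"
  assumes "open S" "finite I" "\<And>i. i \<in> I \<Longrightarrow> smooth_on S (f i)" "z \<in> S"
  shows "iter_pd ws (\<lambda>y. \<Sum>i\<in>I. r i * f i y) z = (\<Sum>i\<in>I. r i * iter_pd ws (f i) z)"
  using assms(3)
proof (induction ws arbitrary: f)
  case Nil
  then show ?case by simp
next
  case (Cons w ws)
  have "pd (\<lambda>y. \<Sum>i\<in>I. r i * f i y) y w = (\<Sum>i\<in>I. r i * pd (f i) y w)" if "y \<in> S" for y
    by (intro pd_eqI has_derivative_sum has_derivative_mult_right pd_has_derivative)
       (use that Cons.prems smooth_on_differentiable in blast)
  then have "iter_pd ws (\<lambda>z. pd (\<lambda>y. \<Sum>i\<in>I. r i * f i y) z w) z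
      = iter_pd ws (\<lambda>y. \<Sum>i\<in>I. r i * pd (f i) y w) z"
    by (intro iter_pd_cong[OF assms(1) _ assms(4)])
  also have "\<dots> = (\<Sum>i\<in>I. r i * iter_pd ws (\<lambda>z. pd (f i) z w) z)"
    by (rule Cons.IH) (use Cons.prems smooth_on_pd in blast)
  finally show ?case by simp
qed

lemma linear_eq_inner_sum:
  fixes l :: "'a::euclidean_space \<Rightarrow> real"
  assumes "linear l"
  shows "(\<Sum>b\<in>Basis. l b *\<^sub>R b) \<bullet> x = l x"
proof -
  have "l x = l (\<Sum>b\<in>Basis. (x \<bullet> b) *\<^sub>R b)" by (simp add: euclidean_representation)
  also have "\<dots> = (\<Sum>b\<in>Basis. (x \<bullet> b) * l b)"
    using assms by (simp add: linear_sum linear_scale)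
  finally show ?thesis by (simp add: inner_sum_left inner_commute[of x] mult.commute)
qed

section \<open>Alternating forms\<close>

lemma map_upd_upt_split:
  assumes "k < d"
  shows "map (f(k := u)) [0..<d] = map f [0..<k] @ u # map f [Suc k..<d]"
proof -
  have "[0..<d] = [0..<k] @ k # [Suc k..<d]"
    using assms by (metis upt_add_eq_append upt_conv_Cons le0 less_imp_le add_0 le_add_diff_inverse)
  then show ?thesis by simp
qed

lemma alternating_linear_slot:
  assumes "alternating d a" "k < d"
  shows "linear (\<lambda>u. a (map (f(k := u)) [0..<d]))"
  using assms unfolding map_upd_upt_split[OF assms(2)] alternating_def by simp

lemma alternating_repeated:
  assumes "alternating d a" "i < j" "j < d" "f i = f j"
  shows "a (map f [0..<d]) = 0"
proof -
  have "map f [0..<d] = map f [0..<i] @ f i # map f [Suc i..<d]"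
    using map_upd_upt_split[of i d f "f i"] assms(2,3) by (simp only: fun_upd_triv)
  moreover have "[Suc i..<d] = [Suc i..<j] @ j # [Suc j..<d]"
    using assms by (metis upt_add_eq_append upt_conv_Cons Suc_leI less_imp_le le_add_diff_inverse)
  ultimately have "map f [0..<d] = map f [0..<i] @ f i # map f [Suc i..<j] @ f i # map f [Suc j..<d]"
    using assms by simp
  then show ?thesis using assms unfolding alternating_def by simp
qed

lemma alternating_transpose:
  assumes "alternating d a" "i < d" "j < d" "i \<noteq> j"
  shows "a (map (f \<circ> Transposition.transpose i j) [0..<d]) = - a (map f [0..<d])"
proof -
  define H where "H u v = a (map (f(i := u, j := v)) [0..<d])" for u v
  have lin1: "linear (\<lambda>u. H u v)" for v
  proof -
    have "H u v = a (map ((f(j := v))(i := u)) [0..<d])" for u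
      unfolding H_def using assms by (simp add: fun_upd_twist)
    then show ?thesis using alternating_linear_slot[OF assms(1,2), of "f(j := v)"] by simp
  qed
  have lin2: "linear (H u)" for u
    unfolding H_def using alternating_linear_slot[OF assms(1,3), of "f(i := u)"] by simp
  have diag: "H u u = 0" for u
    unfolding H_def using assms alternating_repeated[OF assms(1), of i j "f(i := u, j := u)"]
      alternating_repeated[OF assms(1), of j i "f(i := u, j := u)"]
    by (cases "i < j") auto
  have "H (f i + f j) (f i + f j) = H (f i) (f i) + H (f i) (f j) + (H (f j) (f i) + H (f j) (f j))"
    using linear_add[OF lin1] linear_add[OF lin2] by (simp add: algebra_simps)
  then have "H (f j) (f i) = - H (f i) (f j)"
    by (simp add: diag add_eq_0_iff)
  moreover have "f \<circ> Transposition.transpose i j = f(i := f j, j := f i)"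
    using assms by (auto simp: fun_eq_iff Transposition.transpose_def)
  ultimately show ?thesis unfolding H_def using assms by simp
qed

lemma alternating_permute_zero:
  assumes "alternating d a" "a (map f [0..<d]) = 0" "p permutes {..<d}"
  shows "a (map (f \<circ> p) [0..<d]) = 0"
  using finite_lessThan[of d] assms(3)
proof (induction rule: permutes_rev_induct)
  case id
  then show ?case using assms by simp
next
  case (swap i j p)
  have "a (map ((f \<circ> p) \<circ> Transposition.transpose i j) [0..<d]) = - a (map (f \<circ> p) [0..<d])"
    using swap by (intro alternating_transpose[OF assms(1)]) auto
  then show ?case using swap.IH by (simp add: comp_assoc[symmetric] del: comp_apply)
qed

text \<open>Expand the arguments in the spanning list one at a time; there remain values on lists of vectors
  from it, which either repeat a vector or are a permutation of the whole list.\<close>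

lemma alternating_top_zero:
  assumes a: "alternating d a" and bs: "length bs = d" "span (set bs) = UNIV" "a bs = 0"
    and "length vs = d"
  shows "a vs = 0"
proof -
  have basis: "a ys = 0" if ys: "set ys \<subseteq> set bs" "length ys = d" for ys
  proof (cases "distinct ys")
    case False
    then obtain i j where "i < j" "j < d" "ys ! i = ys ! j"
      using ys(2) by (metis distinct_conv_nth linorder_neqE_nat)
    then have "a (map ((!) ys) [0..<d]) = 0"
      by (intro alternating_repeated[OF a, of i j])
    then show ?thesis using ys(2) by (metis map_nth)
  next
    case True
    have "card (set ys) = d" using True that distinct_card by blast
    moreover have "card (set bs) \<le> d" using bs card_length by blast
    ultimately have "set ys = set bs" "card (set bs) = d"
      using that(1) card_mono[OF finite_set that(1)] card_subset_eq[OF finite_set that(1)] by auto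
    then have "mset ys = mset bs"
      using True bs card_distinct[of bs] set_eq_iff_mset_eq_distinct[of ys bs] by simp
    then obtain p where p: "p permutes {..<d}" "permute_list p bs = ys"
      using mset_eq_permutation bs by blast
    have "a (map ((!) bs \<circ> p) [0..<d]) = 0"
      using bs by (intro alternating_permute_zero[OF a _ p(1)]) (metis map_nth)
    then show ?thesis using p(2) bs(1) by (simp add: permute_list_def comp_def)
  qed
  have "a (xs @ ys) = 0" if "length (xs @ ys) = d" "set ys \<subseteq> set bs" for xs ys
    using that
  proof (induction xs arbitrary: ys rule: rev_induct)
    case Nil
    then show ?case using basis by simp
  next
    case (snoc x xs)
    have "linear (\<lambda>u. a (xs @ u # ys))"
      using a snoc.prems unfolding alternating_def by simp
    moreover have "a (xs @ u # ys) = 0" if "u \<in> set bs" for u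
      using snoc.IH[of "u # ys"] snoc.prems that by simp
    moreover have "x \<in> span (set bs)" using bs by simp
    ultimately have "a (xs @ x # ys) = 0" by (rule linear_eq_0_on_span)
    then show ?case by simp
  qed
  from this[of vs "[]"] show ?thesis using assms by simp
qed

text \<open>The combination \<open>b(bs) a - a(bs) b\<close> vanishes on the spanning list. This is how identities between
  top-degree forms are transferred from one frame to another without determinants.\<close>

lemma alternating_proportional:
  fixes a b :: "'v::real_vector list \<Rightarrow> real"
  assumes a: "alternating d a" and b: "alternating d b"
    and bs: "length bs = d" "span (set bs) = UNIV" and "length vs = d"
  shows "a vs * b bs = b vs * a bs"
proof -
  have "alternating d (\<lambda>xs. b bs *\<^sub>R a xs - a bs *\<^sub>R b xs)"
    using a b unfolding alternating_def
    by (intro conjI allI impI linear_compose_sub linear_compose_scale_right) simp_all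
  then have "b bs *\<^sub>R a vs - a bs *\<^sub>R b vs = 0"
    using alternating_top_zero[OF _ bs, where vs = vs] assms(5) by fastforce
  then show ?thesis by (simp add: algebra_simps)
qed

section \<open>Wedge products of two-forms\<close>

lemma permutes_pair_less:
  assumes "\<sigma> permutes {..<2 * n}" "i < n"
  shows "\<sigma> (2 * i) < 2 * n" "\<sigma> (2 * i + 1) < 2 * n" "\<sigma> (Suc (2 * i)) < 2 * n"
  using permutes_in_image[OF assms(1)] assms(2) by (auto simp: lessThan_iff)

lemma wedge2_alternating:
  fixes bs :: "('v::real_vector list \<Rightarrow> real) list"
  assumes "\<And>b. b \<in> set bs \<Longrightarrow> alternating 2 b" and d: "d = 2 * length bs"
  shows "alternating d (wedge2 bs)"
proof -
  define n where "n = length bs"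
  define P where "P v \<sigma> = (\<Prod>i<n. (bs ! i) [v ! \<sigma> (2 * i), v ! \<sigma> (2 * i + 1)])" for v \<sigma>
  have wedge: "wedge2 bs v = (1 / 2 ^ n) *\<^sub>R (\<Sum>\<sigma> | \<sigma> permutes {..<2 * n}. of_int (sign \<sigma>) *\<^sub>R P v \<sigma>)"
    if "length v = d" for v
    using that d by (simp add: wedge2_def n_def P_def)
  show ?thesis
    unfolding alternating_def
  proof (intro conjI allI impI)
    \<comment> \<open>In the term of a permutation \<open>\<sigma>\<close>, exactly one factor contains the given slot.\<close>
    fix xs ys :: "'v list"
    assume len: "length xs + length ys + 1 = d"
    define j where "j = length xs"
    define v where "v u = xs @ u # ys" for u
    have vj: "v u ! j = u" for u by (simp add: v_def j_def)
    have vk: "v u ! k = v 0 ! k" if "k \<noteq> j" for u k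
      using that by (auto simp: v_def j_def nth_append nth_Cons split: nat.splits)
    have "linear (\<lambda>u. P (v u) \<sigma>)"
      if \<sigma>: "\<sigma> permutes {..<2 * n}" for \<sigma>
    proof -
      have inj: "\<sigma> x = \<sigma> y \<longleftrightarrow> x = y" for x y using permutes_inj[OF \<sigma>] by (auto dest: injD)
      have "j \<in> {..<2 * n}" using len d by (simp add: j_def n_def)
      then obtain m where m: "m < 2 * n" "\<sigma> m = j"
        using permutes_image[OF \<sigma>] by (metis imageE lessThan_iff)
      define i0 where "i0 = m div 2"
      have i0: "i0 < n" using m by (simp add: i0_def)
      have l2: "linear (\<lambda>u. (bs ! i0) [u, w])" "linear (\<lambda>u. (bs ! i0) [w, u])" for w
      proof -
        have "alternating 2 (bs ! i0)" using assms i0 n_def by simp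
        then have *: "length xs + length ys + 1 = 2 \<Longrightarrow> linear (\<lambda>u. (bs ! i0) (xs @ u # ys))" for xs ys
          unfolding alternating_def by blast
        show "linear (\<lambda>u. (bs ! i0) [u, w])" using *[of "[]" "[w]"] by simp
        show "linear (\<lambda>u. (bs ! i0) [w, u])" using *[of "[w]" "[]"] by simp
      qed
      have "m = 2 * i0 \<or> m = 2 * i0 + 1" by (auto simp: i0_def)
      then have lin: "linear (\<lambda>u. (bs ! i0) [v u ! \<sigma> (2 * i0), v u ! \<sigma> (2 * i0 + 1)])"
      proof
        assume m0: "m = 2 * i0"
        define w where "w = v 0 ! \<sigma> (2 * i0 + 1)"
        have ne: "\<sigma> (2 * i0 + 1) \<noteq> j" using m(2) m0 inj[of "2 * i0 + 1" m] by simp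
        then have "v u ! \<sigma> (2 * i0) = u" "v u ! \<sigma> (2 * i0 + 1) = w" for u
          using vj[of u] m(2) vk[OF ne, of u] unfolding m0 w_def by metis+
        then show ?thesis using l2(1)[of w] by (simp only:)
      next
        assume m0: "m = 2 * i0 + 1"
        define w where "w = v 0 ! \<sigma> (2 * i0)"
        have ne: "\<sigma> (2 * i0) \<noteq> j" using m(2) m0 inj[of "2 * i0" m] by simp
        then have "v u ! \<sigma> (2 * i0 + 1) = u" "v u ! \<sigma> (2 * i0) = w" for u
          using vj[of u] m(2) vk[OF ne, of u] unfolding m0 w_def by metis+
        then show ?thesis using l2(2)[of w] by (simp only:)
      qed
      have rest: "(bs ! i) [v u ! \<sigma> (2 * i), v u ! \<sigma> (2 * i + 1)] =
          (bs ! i) [v 0 ! \<sigma> (2 * i), v 0 ! \<sigma> (2 * i + 1)]" if "i \<noteq> i0" for i u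
      proof -
        have "2 * i \<noteq> m" "2 * i + 1 \<noteq> m" using that by (auto simp: i0_def)
        then have "\<sigma> (2 * i) \<noteq> j" "\<sigma> (2 * i + 1) \<noteq> j" using m(2) inj by metis+
        then show ?thesis using vk[of "\<sigma> (2 * i)" u] vk[of "\<sigma> (2 * i + 1)" u] by simp
      qed
      have "P (v u) \<sigma> = (\<Prod>i\<in>{..<n} - {i0}. (bs ! i) [v 0 ! \<sigma> (2 * i), v 0 ! \<sigma> (2 * i + 1)])
          *\<^sub>R (bs ! i0) [v u ! \<sigma> (2 * i0), v u ! \<sigma> (2 * i0 + 1)]" for u
        
        unfolding P_def using i0 by (subst prod.remove[of _ i0], simp, simp, subst mult.commute, unfold real_scaleR_def)
          (intro arg_cong2[where f = "(*)"] prod.cong refl rest, simp)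
      then show ?thesis using linear_compose_scale_right[OF lin] by simp
    qed
    then have "linear (\<lambda>u. (1 / 2 ^ n) *\<^sub>R (\<Sum>\<sigma> | \<sigma> permutes {..<2 * n}. of_int (sign \<sigma>) *\<^sub>R P (v u) \<sigma>))"
      by (intro linear_compose_scale_right linear_compose_sum ballI) auto
    moreover have "length (v u) = d" for u using len by (simp add: v_def)
    then have "wedge2 bs (v u) = (1 / 2 ^ n) *\<^sub>R (\<Sum>\<sigma> | \<sigma> permutes {..<2 * n}. of_int (sign \<sigma>) *\<^sub>R P (v u) \<sigma>)" for u
      by (rule wedge)
    ultimately show "linear (\<lambda>u. wedge2 bs (xs @ u # ys))"
      unfolding v_def by simp
  next
    \<comment> \<open>Composing \<open>\<sigma>\<close> with the transposition of the equal arguments changes only the sign of its term.\<close>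
    fix xs ys zs :: "'v list" and u
    assume len: "length xs + length ys + length zs + 2 = d"
    define v where "v = xs @ u # ys @ u # zs"
    define i where "i = length xs"
    define j where "j = length xs + length ys + 1"
    define \<tau> where "\<tau> = Transposition.transpose i j"
    have ij: "i < 2 * n" "j < 2 * n" "i \<noteq> j" using len d by (auto simp: n_def i_def j_def)
    have "v ! i = u" "v ! j = u"
      by (auto simp: v_def i_def j_def nth_append)
    then have v: "v ! (\<tau> k) = v ! k" for k
      by (simp add: \<tau>_def Transposition.transpose_def)
    have \<tau>: "\<tau> permutes {..<2 * n}" unfolding \<tau>_def using ij by (intro permutes_swap_id) auto
    define S where "S = (\<Sum>\<sigma> | \<sigma> permutes {..<2 * n}. of_int (sign \<sigma>) *\<^sub>R P v \<sigma>)"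
    have "S = (\<Sum>\<sigma> | \<sigma> permutes {..<2 * n}. of_int (sign (\<tau> \<circ> \<sigma>)) *\<^sub>R P v (\<tau> \<circ> \<sigma>))"
      unfolding S_def by (rule setum_permutations_compose_left[OF \<tau>])
    also have "\<dots> = - S"
      unfolding S_def sum_negf[symmetric]
    proof (rule sum.cong[OF refl])
      fix \<sigma> assume "\<sigma> \<in> {\<sigma>. \<sigma> permutes {..<2 * n}}"
      then have "sign (\<tau> \<circ> \<sigma>) = - sign \<sigma>"
        using sign_compose[OF permutation_permutes[THEN iffD2] permutation_permutes[THEN iffD2]] \<tau> ij
        by (metis \<tau>_def finite_lessThan mem_Collect_eq mult_minus1 sign_swap_id)
      moreover have "P v (\<tau> \<circ> \<sigma>) = P v \<sigma>" using v by (simp add: P_def)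
      ultimately show "of_int (sign (\<tau> \<circ> \<sigma>)) *\<^sub>R P v (\<tau> \<circ> \<sigma>) = - (of_int (sign \<sigma>) *\<^sub>R P v \<sigma>)"
        by simp
    qed
    finally have "S = 0" by simp
    moreover have "length v = d" using len by (simp add: v_def)
    ultimately show "wedge2 bs (xs @ u # ys @ u # zs) = 0"
      using wedge[of v] unfolding S_def v_def by simp
  qed
qed

text \<open>The permutation of the slots that moves the pairs \<open>{2 i, 2 i + 1}\<close> in the way \<open>p\<close> moves
  the indices \<open>i\<close>. It is even, as every transposition of pairs is a product of two transpositions;
  hence two-forms commute under the wedge product.\<close>

definition block_perm :: "(nat \<Rightarrow> nat) \<Rightarrow> nat \<Rightarrow> nat" where
  "block_perm p k = 2 * p (k div 2) + k mod 2"

lemma block_perm_simps [simp]: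
  "block_perm p (2 * i) = 2 * p i" "block_perm p (Suc (2 * i)) = Suc (2 * p i)"
  by (auto simp: block_perm_def)

lemma block_perm_comp: "block_perm (p \<circ> q) = block_perm p \<circ> block_perm q"
  by (auto simp: block_perm_def fun_eq_iff)

lemma block_perm_id [simp]: "block_perm id = id"
  by (auto simp: block_perm_def fun_eq_iff)

lemma block_perm_permutes:
  assumes "p permutes {..<n}"
  shows "block_perm p permutes {..<2 * n}"
proof (rule bij_imp_permutes)
  have inv: "block_perm p \<circ> block_perm (inv p) = id" "block_perm (inv p) \<circ> block_perm p = id"
    unfolding block_perm_comp[symmetric] using permutes_inv_o[OF assms] by auto
  have into: "block_perm q k < 2 * n" if "q permutes {..<n}" "k < 2 * n" for q k
  proof -
    have "q (k div 2) < n" using permutes_in_image[OF that(1), of "k div 2"] that(2) by auto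
    then show ?thesis by (auto simp: block_perm_def) 
  qed
  show "bij_betw (block_perm p) {..<2 * n} {..<2 * n}"
    using inv into[OF assms] into[OF permutes_inv[OF assms]]
    by (intro bij_betw_byWitness[where f' = "block_perm (inv p)"]) (auto simp: fun_eq_iff)
  fix k assume "k \<notin> {..<2 * n}"
  then have "p (k div 2) = k div 2" using assms by (auto simp: permutes_def)
  then show "block_perm p k = k" by (simp add: block_perm_def)
qed

lemma block_perm_transpose:
  assumes "a \<noteq> b"
  shows "block_perm (Transposition.transpose a b) =
    Transposition.transpose (2 * a) (2 * b) \<circ> Transposition.transpose (2 * a + 1) (2 * b + 1)"
proof
  fix k
  show "block_perm (Transposition.transpose a b) k =
    (Transposition.transpose (2 * a) (2 * b) \<circ> Transposition.transpose (2 * a + 1) (2 * b + 1)) k"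
  proof (cases "even k")
    case True
    then obtain q where k: "k = 2 * q" by (elim evenE)
    have "2 * q \<noteq> 2 * c + 1" for c by presburger
    then show ?thesis
      unfolding k block_perm_simps comp_def Transposition.transpose_def by simp
  next
    case False
    then obtain q where k: "k = Suc (2 * q)" by (elim oddE) simp
    have "Suc (2 * q) \<noteq> 2 * c" for c by presburger
    then show ?thesis
      unfolding k block_perm_simps comp_def Transposition.transpose_def by simp
  qed
qed

lemma sign_block_perm:
  assumes "p permutes {..<n}"
  shows "sign (block_perm p) = 1"
  using assms finite_lessThan[of n]
proof (induction rule: permutes_induct)
  case id
  show ?case by (simp only: block_perm_id sign_id)
next
  case (swap a b p)
  have "permutation (block_perm p)"
    using block_perm_permutes[OF swap.hyps(4)] permutation_permutes finite_lessThan by blast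
  moreover have "sign (block_perm (Transposition.transpose a b)) = 1"
    unfolding block_perm_transpose[OF swap.hyps(3)]
    using swap.hyps(3) by (subst sign_compose) (auto simp: permutation_swap_id sign_swap_id)
  moreover have "permutation (block_perm (Transposition.transpose a b))"
    unfolding block_perm_transpose[OF swap.hyps(3)]
    by (intro permutation_compose permutation_swap_id)
  ultimately show ?case
    using swap.IH by (simp only: block_perm_comp sign_compose mult_1)
qed

lemma wedge2_permute:
  assumes p: "p permutes {..<length bs}"
  shows "wedge2 (permute_list p bs) vs = wedge2 bs vs"
proof -
  define n where "n = length bs"
  define t where "t b \<sigma> i = b [vs ! \<sigma> (2 * i), vs ! \<sigma> (2 * i + 1)]" for b :: "'a list \<Rightarrow> 'b" and \<sigma> :: "nat \<Rightarrow> nat" and i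
  have p': "p permutes {..<n}" using p n_def by simp
  note B = block_perm_permutes[OF p']
  have "(\<Sum>\<sigma> | \<sigma> permutes {..<2 * n}. of_int (sign \<sigma>) * (\<Prod>i<n. t (permute_list p bs ! i) \<sigma> i)) =
     (\<Sum>\<sigma> | \<sigma> permutes {..<2 * n}. of_int (sign (\<sigma> \<circ> block_perm p)) *
        (\<Prod>i<n. t (permute_list p bs ! i) (\<sigma> \<circ> block_perm p) i))"
    by (rule sum_permutations_compose_right[OF B])
  also have "\<dots> = (\<Sum>\<sigma> | \<sigma> permutes {..<2 * n}. of_int (sign \<sigma>) * (\<Prod>i<n. t (bs ! i) \<sigma> i))"
  proof (rule sum.cong[OF refl])
    fix \<sigma> assume "\<sigma> \<in> {\<sigma>. \<sigma> permutes {..<2 * n}}"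
    then have "permutation \<sigma>" "permutation (block_perm p)"
      using B permutation_permutes finite_lessThan by blast+
    then have "sign (\<sigma> \<circ> block_perm p) = sign \<sigma>"
      using sign_block_perm[OF p'] by (simp add: sign_compose)
    moreover have "(\<Prod>i<n. t (permute_list p bs ! i) (\<sigma> \<circ> block_perm p) i) = (\<Prod>i<n. t (bs ! i) \<sigma> i)"
      by (subst (2) prod.permute[OF p'])
         (auto intro!: prod.cong simp: t_def permute_list_nth p n_def)
    ultimately show "of_int (sign (\<sigma> \<circ> block_perm p)) *
        (\<Prod>i<n. t (permute_list p bs ! i) (\<sigma> \<circ> block_perm p) i) =
        of_int (sign \<sigma>) * (\<Prod>i<n. t (bs ! i) \<sigma> i)" by simp
  qed
  finally show ?thesis by (simp add: wedge2_def t_def n_def)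
qed

lemma wedge2_mset_cong: "mset bs = mset cs \<Longrightarrow> wedge2 bs vs = wedge2 cs vs"
  using mset_eq_permutation wedge2_permute by metis

text \<open>Expand the product of sums over all subsets; by commutativity the term of a subset depends on
  its cardinality only.\<close>

lemma wedge2_binomial:
  fixes a b :: "'v list \<Rightarrow> 'k::field"
  shows "wedge2 (replicate n (\<lambda>xs. a xs + b xs)) vs =
    (\<Sum>k\<le>n. of_nat (n choose k) * wedge2 (replicate (n - k) a @ replicate k b) vs)"
proof -
  define C where "C S = map (\<lambda>i. if i \<in> S then b else a) [0..<n]" for S
  define W where "W k = wedge2 (replicate (n - k) a @ replicate k b) vs" for k
  have C: "wedge2 (C S) vs = W (card S)" if "S \<in> Pow {..<n}" for S
  proof -
    have fin: "finite S" using that finite_subset by blast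
    have "{#i \<in># mset_set {..<n}. i \<in> S#} = mset_set S"
      using that by (subst filter_mset_mset_set) (auto intro!: arg_cong[where f = mset_set])
    moreover have "{#i \<in># mset_set {..<n}. i \<notin> S#} = mset_set ({..<n} - S)"
      by (subst filter_mset_mset_set) (auto intro!: arg_cong[where f = mset_set])
    moreover have "mset (C S) = image_mset (\<lambda>i. if i \<in> S then b else a) (mset_set {..<n})"
      by (simp add: C_def lessThan_atLeast0)
    moreover have "image_mset (\<lambda>i. if i \<in> S then b else a) M
        = replicate_mset (size {#i \<in># M. i \<in> S#}) b + replicate_mset (size {#i \<in># M. i \<notin> S#}) a" for M
      by (induction M) auto
    ultimately have "mset (C S) = replicate_mset (card S) b + replicate_mset (n - card S) a"
      using that fin by (simp add: card_Diff_subset)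
    then have "mset (C S) = mset (replicate (n - card S) a @ replicate (card S) b)"
      by simp
    then show ?thesis unfolding W_def by (rule wedge2_mset_cong)
  qed
  have "wedge2 (replicate n (\<lambda>xs. a xs + b xs)) vs = (\<Sum>S\<in>Pow {..<n}. wedge2 (C S) vs)"
  proof (cases "length vs = 2 * n")
    case True
    define t where "t f \<sigma> i = f [vs ! \<sigma> (2 * i), vs ! \<sigma> (2 * i + 1)]" for f :: "'v list \<Rightarrow> 'k" and \<sigma> :: "nat \<Rightarrow> nat" and i
    have "(\<Prod>i<n. t (\<lambda>xs. a xs + b xs) \<sigma> i) = (\<Sum>S\<in>Pow {..<n}. \<Prod>i<n. t (C S ! i) \<sigma> i)" for \<sigma>
    proof -
      have "(\<Prod>i<n. t (\<lambda>xs. a xs + b xs) \<sigma> i) = (\<Prod>i<n. t b \<sigma> i + t a \<sigma> i)"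
        by (simp add: t_def add.commute)
      also have "\<dots> = (\<Sum>S\<in>Pow {..<n}. prod (t b \<sigma>) S * prod (t a \<sigma>) ({..<n} - S))"
        by (rule prod_add) simp
      also have "\<dots> = (\<Sum>S\<in>Pow {..<n}. \<Prod>i<n. t (C S ! i) \<sigma> i)"
      proof (rule sum.cong[OF refl])
        fix S assume S: "S \<in> Pow {..<n}"
        have "(\<Prod>i<n. t (C S ! i) \<sigma> i) = (\<Prod>i\<in>S. t (C S ! i) \<sigma> i) * (\<Prod>i\<in>{..<n} - S. t (C S ! i) \<sigma> i)"
          using S prod.subset_diff[of S "{..<n}" "\<lambda>i. t (C S ! i) \<sigma> i"] by (simp add: mult.commute)
        also have "\<dots> = prod (t b \<sigma>) S * prod (t a \<sigma>) ({..<n} - S)"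
          using S by (intro arg_cong2[where f = "(*)"] prod.cong) (auto simp: C_def)
        finally show "prod (t b \<sigma>) S * prod (t a \<sigma>) ({..<n} - S) = (\<Prod>i<n. t (C S ! i) \<sigma> i)" by simp
      qed
      finally show ?thesis .
    qed
    then have "(\<Sum>\<sigma> | \<sigma> permutes {..<2 * n}. of_int (sign \<sigma>) * (\<Prod>i<n. t (\<lambda>xs. a xs + b xs) \<sigma> i)) / 2 ^ n =
        (\<Sum>S\<in>Pow {..<n}. (\<Sum>\<sigma> | \<sigma> permutes {..<2 * n}. of_int (sign \<sigma>) * (\<Prod>i<n. t (C S ! i) \<sigma> i)) / 2 ^ n)"
      by (simp add: sum_distrib_left sum_divide_distrib) (rule sum.swap)
    then show ?thesis using True by (simp add: wedge2_def t_def C_def)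
  next
    case False
    then show ?thesis by (simp add: wedge2_def C_def)
  qed
  also have "\<dots> = (\<Sum>S\<in>Pow {..<n}. W (card S))"
    using C by (intro sum.cong) auto
  also have "\<dots> = (\<Sum>k\<le>n. \<Sum>S\<in>{S \<in> Pow {..<n}. card S = k}. W (card S))"
    using card_mono[of "{..<n}"] by (intro sum.group[symmetric]) auto
  also have "\<dots> = (\<Sum>k\<le>n. of_nat (n choose k) * W k)"
    using n_subsets[of "{..<n}"] by (simp add: Pow_def)
  finally show ?thesis unfolding W_def .
qed

section \<open>Unitary frames of a positive (1,1)-form\<close>

text \<open>The value of a Kaehler form at a point.\<close>

definition positive_11 :: "((complex ^ 'n::finite) list \<Rightarrow> real) \<Rightarrow> bool" where
  "positive_11 b \<longleftrightarrow> alternating 2 b \<and> (\<forall>u v. b [\<i> *s u, \<i> *s v] = b [u, v]) \<and>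
     (\<forall>u. u \<noteq> 0 \<longrightarrow> b [u, \<i> *s u] > 0)"

text \<open>The enumeration of the coordinates that is chosen in \<^const>\<open>std_frame\<close>.\<close>

definition index_list :: "'n::finite list" where
  "index_list = (SOME js. distinct js \<and> set js = UNIV)"

definition complex_frame :: "('n::finite \<Rightarrow> complex ^ 'n) \<Rightarrow> nat \<Rightarrow> complex ^ 'n" where
  "complex_frame e k = (if even k then e (index_list ! (k div 2)) else \<i> *s e (index_list ! (k div 2)))"

abbreviation frame_list :: "('n::finite \<Rightarrow> complex ^ 'n) \<Rightarrow> (complex ^ 'n) list" where
  "frame_list e \<equiv> map (complex_frame e) [0..<2 * CARD('n)]"

lemma index_list: "distinct (index_list :: 'n::finite list)" "set (index_list :: 'n::finite list) = UNIV"
  "length (index_list :: 'n::finite list) = CARD('n)"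
proof -
  have *: "distinct (index_list :: 'n list) \<and> set (index_list :: 'n list) = UNIV"
    unfolding index_list_def by (rule someI_ex) (metis finite_distinct_list finite)
  then show "distinct (index_list :: 'n::finite list)" "set (index_list :: 'n::finite list) = UNIV"
    by auto
  show "length (index_list :: 'n::finite list) = CARD('n)"
    using * distinct_card by metis
qed

lemma imag_smult_axis: "\<i> *s axis j 1 = axis j \<i>"
  by (simp add: vec_eq_iff axis_def)

lemma std_frame_eq: "(std_frame :: (complex ^ 'n::finite) list) = frame_list (\<lambda>j. axis j 1)"
proof -
  have *: "concat (map (\<lambda>j. [f j, g j]) js) =
      map (\<lambda>k. if even k then f (js ! (k div 2)) else g (js ! (k div 2))) [0..<2 * length js]"
    for f g :: "'n \<Rightarrow> complex ^ 'n" and js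
  proof (induction js rule: rev_induct)
    case Nil
    then show ?case by simp
  next
    case (snoc j js)
    have "2 * length (js @ [j]) = Suc (Suc (2 * length js))" by simp
    then show ?case
      unfolding map_append concat_append snoc by (auto simp: nth_append)
  qed
  show ?thesis
    unfolding std_frame_def index_list_def[symmetric] *
    by (simp add: index_list complex_frame_def[abs_def] imag_smult_axis)
qed

lemma length_std_frame [simp]: "length (std_frame :: (complex ^ 'n::finite) list) = 2 * CARD('n)"
  by (simp add: std_frame_eq)

lemma span_std_frame: "span (set (std_frame :: (complex ^ 'n::finite) list)) = UNIV"
proof -
  have "set (std_frame :: (complex ^ 'n::finite) list) = (\<Union>j. {axis j 1, axis j \<i>})"
    unfolding std_frame_def index_list_def[symmetric] by (auto simp: index_list)
  then have mem: "axis j 1 \<in> span (set (std_frame :: (complex ^ 'n) list))"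
    "axis j \<i> \<in> span (set (std_frame :: (complex ^ 'n) list))" for j
    by (auto intro!: span_base)
  have "v \<in> span (set std_frame)" for v :: "complex ^ 'n"
  proof -
    have "v = (\<Sum>j\<in>UNIV. Re (v $ j) *\<^sub>R axis j 1 + Im (v $ j) *\<^sub>R axis j \<i>)"
      by (auto simp: vec_eq_iff axis_def complex_eq_iff if_distrib sum.delta' cong: if_cong
          simp flip: of_real_def)
    also have "\<dots> \<in> span (set std_frame)"
      by (intro span_sum span_add span_scale mem)
    finally show ?thesis .
  qed
  then show ?thesis by auto
qed

lemma alternating_combination:
  assumes "alternating d a" "alternating d b"
  shows "alternating d (\<lambda>vs. r *\<^sub>R a vs + s *\<^sub>R b vs)"
  using assms unfolding alternating_def
  by (intro conjI allI impI linear_compose_add linear_compose_scale_right) simp_all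

lemma alternating2:
  assumes "alternating 2 b"
  shows "linear (\<lambda>u. b [u, w])" "linear (\<lambda>u. b [w, u])" "b [u, u] = 0" "b [u, v] = - b [v, u]"
proof -
  have *: "length xs + length ys + 1 = 2 \<Longrightarrow> linear (\<lambda>u. b (xs @ u # ys))" for xs ys
    using assms unfolding alternating_def by blast
  show l1: "linear (\<lambda>u. b [u, w])" for w using *[of "[]" "[w]"] by simp
  show l2: "linear (\<lambda>u. b [w, u])" for w using *[of "[w]" "[]"] by simp
  have "length xs + length ys + length zs + 2 = 2 \<Longrightarrow> b (xs @ u # ys @ u # zs) = 0" for xs ys zs u
    using assms unfolding alternating_def by blast
  from this[of "[]" "[]" "[]"] show d: "b [u, u] = 0" for u by simp
  have "b [u + v, u + v] = b [u, u] + b [u, v] + (b [v, u] + b [v, v])"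
    using linear_add[OF l1] linear_add[OF l2] by (simp add: algebra_simps)
  then show "b [u, v] = - b [v, u]" by (simp add: d add_eq_0_iff2)
qed

lemma smult_scaleR: "z *s (r *\<^sub>R u) = r *\<^sub>R (z *s u)" for u :: "complex ^ 'n::finite"
  by (simp add: vec_eq_iff)

lemma imag_imag_smult: "\<i> *s (\<i> *s u) = - u" for u :: "complex ^ 'n::finite"
  by (simp add: vec_eq_iff mult.assoc[symmetric])

lemma linear_functionals_common_zero:
  fixes l :: "'i \<Rightarrow> 'a::euclidean_space \<Rightarrow> real"
  assumes "finite I" "card I < DIM('a)" "\<And>i. i \<in> I \<Longrightarrow> linear (l i)"
  shows "\<exists>u. u \<noteq> 0 \<and> (\<forall>i\<in>I. l i u = 0)"
proof -
  define w where "w i = (\<Sum>b\<in>Basis. l i b *\<^sub>R b)" for i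
  have "dim (w ` I) \<le> card (w ` I)" by (rule dim_le_card') (use assms in simp)
  also have "\<dots> \<le> card I" using assms card_image_le by blast
  finally obtain u where "u \<noteq> 0" "\<And>y. y \<in> span (w ` I) \<Longrightarrow> orthogonal u y"
    using assms(2) orthogonal_to_subspace_exists by (metis le_less_trans)
  note u = this
  have "l i u = 0" if "i \<in> I" for i
  proof -
    have "l i u = u \<bullet> w i" unfolding w_def inner_commute[of u] by (rule linear_eq_inner_sum[OF assms(3)[OF that], symmetric])
    then show ?thesis using u(2)[of "w i"] that by (simp add: orthogonal_def span_base)
  qed
  then show ?thesis using u(1) by blast
qed

definition unitary_for :: "((complex ^ 'n::finite) list \<Rightarrow> real) \<Rightarrow> ('n \<Rightarrow> complex ^ 'n) \<Rightarrow> bool" where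
  "unitary_for b e \<longleftrightarrow> (\<forall>j k. b [e j, \<i> *s e k] = (if j = k then 1 else 0) \<and> b [e j, e k] = 0)"

text \<open>Gram-Schmidt: given \<open>m < n\<close> orthonormal vectors, orthogonality to them is \<open>2 m < 2 n\<close> real
  linear conditions, so some nonzero vector satisfies them.\<close>

lemma unitary_exists:
  fixes b :: "(complex ^ 'n::finite) list \<Rightarrow> real"
  assumes "positive_11 b"
  shows "\<exists>e. unitary_for b e"
proof -
  have alt: "alternating 2 b" and J: "\<And>u v. b [\<i> *s u, \<i> *s v] = b [u, v]"
    and pos: "\<And>u. u \<noteq> 0 \<Longrightarrow> b [u, \<i> *s u] > 0"
    using assms by (auto simp: positive_11_def)
  note a2 = alternating2[OF alt]
  have "\<exists>e :: 'n \<Rightarrow> complex ^ 'n. \<forall>j\<in>S. \<forall>k\<in>S.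
      b [e j, \<i> *s e k] = (if j = k then 1 else 0) \<and> b [e j, e k] = 0" if "finite S" for S
    using that
  proof (induction S rule: finite_induct)
    case empty
    then show ?case by simp
  next
    case (insert x S)
    then obtain e :: "'n \<Rightarrow> complex ^ 'n" where e: "\<And>j k. j \<in> S \<Longrightarrow> k \<in> S \<Longrightarrow>
      b [e j, \<i> *s e k] = (if j = k then 1 else 0) \<and> b [e j, e k] = 0" by blast
    define l where "l = (\<lambda>(j, s) u. b [u, if s then e j else \<i> *s e j])"
    have "card (S \<times> (UNIV :: bool set)) < DIM(complex ^ 'n)"
    proof -
      have "S \<subset> UNIV" using insert.hyps by auto
      then have "card S < CARD('n)" by (simp add: psubset_card_mono)
      then show ?thesis by (simp add: card_cartesian_product)
    qed
    then obtain u where u: "u \<noteq> 0" "\<forall>i\<in>S \<times> UNIV. l i u = 0"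
      using linear_functionals_common_zero[of "S \<times> (UNIV :: bool set)" l] insert.hyps a2(1)
      by (auto simp: l_def)
    define r where "r = 1 / sqrt (b [u, \<i> *s u])"
    define w where "w = r *\<^sub>R u"
    have scale: "b [r *\<^sub>R v, v'] = r * b [v, v']" "b [v', r *\<^sub>R v] = r * b [v', v]" for v v'
      using linear_scale[OF a2(1)] linear_scale[OF a2(2)] by auto
    have orth: "b [w, e j] = 0" "b [w, \<i> *s e j] = 0" if "j \<in> S" for j
    proof -
      have "l (j, s) u = 0" for s using u(2) that by blast
      from this[of True] this[of False] show "b [w, e j] = 0" "b [w, \<i> *s e j] = 0"
        by (simp_all add: l_def w_def scale)
    qed
    have orth': "b [e j, w] = 0" "b [e j, \<i> *s w] = 0" if "j \<in> S" for j
    proof -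
      show "b [e j, w] = 0" using orth(1)[OF that] a2(4) by (metis neg_equal_0_iff_equal)
      have "b [e j, \<i> *s w] = b [\<i> *s e j, \<i> *s (\<i> *s w)]" by (simp only: J)
      also have "\<dots> = - b [\<i> *s e j, w]"
        unfolding imag_imag_smult using linear_neg[OF a2(2)] by simp
      also have "\<dots> = b [w, \<i> *s e j]" using a2(4)[of "\<i> *s e j" w] by simp
      finally show "b [e j, \<i> *s w] = 0" using orth(2)[OF that] by simp
    qed
    have "b [w, \<i> *s w] = r * r * b [u, \<i> *s u]"
      by (simp add: w_def smult_scaleR scale)
    then have unit: "b [w, \<i> *s w] = 1"
      using pos[OF u(1)] by (simp add: r_def)
    show ?case
      by (rule exI[of _ "e(x := w)"]) (use e orth orth' unit a2(3) insert.hyps(2) in auto)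
  qed
  from this[of UNIV] show ?thesis by (simp add: unitary_for_def)
qed

section \<open>Block-preserving permutations\<close>

text \<open>In a unitary frame \<open>e\<^sub>1, \<i> e\<^sub>1, \<dots>, e\<^sub>n, \<i> e\<^sub>n\<close> a positive form pairs the two vectors of a block
  \<open>e\<^sub>j, \<i> e\<^sub>j\<close> and no others. So only permutations that carry blocks to blocks contribute to a power
  of it, and their signs cancel the signs of the values.\<close>

definition block_preserving :: "nat \<Rightarrow> (nat \<Rightarrow> nat) \<Rightarrow> bool" where
  "block_preserving n \<sigma> \<longleftrightarrow> \<sigma> permutes {..<2 * n} \<and> (\<forall>i<n. \<sigma> (2 * i) div 2 = \<sigma> (2 * i + 1) div 2)"

lemma permutes_eq_iff: "\<sigma> permutes S \<Longrightarrow> \<sigma> x = \<sigma> y \<longleftrightarrow> x = y"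
  by (meson permutes_inj injD)

lemma same_block_cases:
  assumes "(k::nat) div 2 = l div 2" "k \<noteq> l"
  shows "even k \<and> k = 2 * (k div 2) \<and> l = 2 * (k div 2) + 1 \<or> odd k \<and> l = 2 * (k div 2) \<and> k = 2 * (k div 2) + 1"
  using assms by presburger

lemma block_preserving_pair:
  assumes "block_preserving n \<sigma>" "i < n"
  shows "even (\<sigma> (2 * i)) \<and> \<sigma> (2 * i) = 2 * (\<sigma> (2 * i) div 2) \<and> \<sigma> (2 * i + 1) = 2 * (\<sigma> (2 * i) div 2) + 1
    \<or> odd (\<sigma> (2 * i)) \<and> \<sigma> (2 * i + 1) = 2 * (\<sigma> (2 * i) div 2) \<and> \<sigma> (2 * i) = 2 * (\<sigma> (2 * i) div 2) + 1"
proof (rule same_block_cases)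
  show "\<sigma> (2 * i) div 2 = \<sigma> (2 * i + 1) div 2" using assms by (auto simp: block_preserving_def)
  have "\<sigma> permutes {..<2 * n}" using assms by (simp add: block_preserving_def)
  then show "\<sigma> (2 * i) \<noteq> \<sigma> (2 * i + 1)" by (simp add: permutes_eq_iff)
qed

lemma block_preserving_bij:
  assumes "block_preserving n \<sigma>"
  shows "bij_betw (\<lambda>i. \<sigma> (2 * i) div 2) {..<n} {..<n}"
proof -
  have \<sigma>: "\<sigma> permutes {..<2 * n}" using assms by (simp add: block_preserving_def)
  have "inj_on (\<lambda>i. \<sigma> (2 * i) div 2) {..<n}"
  proof (rule inj_onI)
    fix i j assume ij: "i \<in> {..<n}" "j \<in> {..<n}" "\<sigma> (2 * i) div 2 = \<sigma> (2 * j) div 2"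
    have "\<sigma> (2 * i) = \<sigma> (2 * j) \<or> \<sigma> (2 * i) = \<sigma> (2 * j + 1)"
      using block_preserving_pair[OF assms, of i] block_preserving_pair[OF assms, of j] ij
      by (metis lessThan_iff)
    then have "2 * i = 2 * j \<or> 2 * i = 2 * j + 1" by (simp only: permutes_eq_iff[OF \<sigma>])
    then show "i = j" by presburger
  qed
  moreover have "(\<lambda>i. \<sigma> (2 * i) div 2) ` {..<n} \<subseteq> {..<n}"
    using permutes_pair_less(1)[OF \<sigma>]
    by (auto simp: div_less_iff_less_mult mult.commute)
  ultimately show ?thesis
    by (simp add: bij_betw_def endo_inj_surj)
qed

text \<open>Undoing the flips of the two slots inside blocks one by one leads to some \<^term>\<open>block_perm p\<close>,
  which is even.\<close>

lemma sign_block_preserving: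
  assumes "block_preserving n \<sigma>"
  shows "sign \<sigma> = (\<Prod>i<n. if even (\<sigma> (2 * i)) then 1 else - 1)"
  using assms
proof (induction "card {i. i < n \<and> odd (\<sigma> (2 * i))}" arbitrary: \<sigma>)
  case 0
  have \<sigma>: "\<sigma> permutes {..<2 * n}" using 0 by (simp add: block_preserving_def)
  have ev: "even (\<sigma> (2 * i))" if "i < n" for i using 0 that by auto
  define p where "p i = \<sigma> (2 * i) div 2" for i
  have "\<sigma> k = block_perm p k" for k
  proof (cases "k div 2 < n")
    case True
    define q where "q = k div 2"
    have *: "\<sigma> (2 * q) = 2 * p q" "\<sigma> (2 * q + 1) = 2 * p q + 1"
      using block_preserving_pair[OF 0(2) True] ev[OF True] unfolding p_def q_def by auto
    have "k = 2 * q \<or> k = 2 * q + 1" unfolding q_def by presburger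
    then show ?thesis using * by auto
  next
    case False
    then have "\<sigma> k = k" "\<sigma> (2 * (k div 2)) = 2 * (k div 2)"
      using \<sigma> by (auto simp: permutes_def)
    then show ?thesis by (simp add: block_perm_def p_def)
  qed
  then have "\<sigma> = block_perm p" by auto
  moreover have "p permutes {..<n}"
  proof (rule bij_imp_permutes)
    show "bij_betw p {..<n} {..<n}" using block_preserving_bij[OF 0(2)] by (simp add: p_def[abs_def])
    show "p i = i" if "i \<notin> {..<n}" for i
    proof -
      have "\<sigma> (2 * i) = 2 * i" using \<sigma> that by (auto simp: permutes_def)
      then show ?thesis by (simp add: p_def)
    qed
  qed
  ultimately show ?case using sign_block_perm ev by simp
next
  case (Suc m)
  have \<sigma>: "\<sigma> permutes {..<2 * n}" using Suc by (simp add: block_preserving_def)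
  have "{i. i < n \<and> odd (\<sigma> (2 * i))} \<noteq> {}" using Suc(2) by force
  then obtain i where i: "i < n" "odd (\<sigma> (2 * i))" by auto
  define \<tau> where "\<tau> = Transposition.transpose (2 * i) (2 * i + 1)"
  have \<tau>: "\<tau> permutes {..<2 * n}" unfolding \<tau>_def using i by (intro permutes_swap_id) auto
  have \<tau>i: "\<tau> (2 * i) = 2 * i + 1" "\<tau> (2 * i + 1) = 2 * i" by (auto simp: \<tau>_def)
  have \<tau>j: "\<tau> (2 * j) = 2 * j" "\<tau> (2 * j + 1) = 2 * j + 1" if "j \<noteq> i" for j
  proof -
    have "2 * j \<noteq> 2 * i" "2 * j \<noteq> 2 * i + 1" "2 * j + 1 \<noteq> 2 * i" "2 * j + 1 \<noteq> 2 * i + 1"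
      using that by presburger+
    then show "\<tau> (2 * j) = 2 * j" "\<tau> (2 * j + 1) = 2 * j + 1"
      unfolding \<tau>_def by (auto intro!: transpose_apply_other)
  qed
  define \<rho> where "\<rho> = \<sigma> \<circ> \<tau>"
  have \<rho>: "\<rho> permutes {..<2 * n}" unfolding \<rho>_def using permutes_compose[OF \<tau> \<sigma>] .
  have \<rho>i: "\<rho> (2 * i) = \<sigma> (2 * i + 1)" "\<rho> (2 * i + 1) = \<sigma> (2 * i)" using \<tau>i by (auto simp: \<rho>_def)
  have \<rho>j: "\<rho> (2 * j) = \<sigma> (2 * j)" "\<rho> (2 * j + 1) = \<sigma> (2 * j + 1)" if "j \<noteq> i" for j
    using \<tau>j[OF that] by (auto simp: \<rho>_def)
  have bp: "block_preserving n \<rho>"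
    unfolding block_preserving_def
  proof (intro conjI allI impI \<rho>)
    fix j assume "j < n"
    then have "\<sigma> (2 * j) div 2 = \<sigma> (2 * j + 1) div 2" using Suc(3) by (simp add: block_preserving_def)
    then show "\<rho> (2 * j) div 2 = \<rho> (2 * j + 1) div 2"
      
      using \<rho>j[of j] \<rho>i by (cases "j = i") auto
  qed
  have ev: "even (\<rho> (2 * i))"
    using block_preserving_pair[OF Suc(3) i(1)] i(2) unfolding \<rho>i by (metis dvd_triv_left)
  have "{j. j < n \<and> odd (\<rho> (2 * j))} = {j. j < n \<and> odd (\<sigma> (2 * j))} - {i}"
  proof (rule set_eqI)
    fix j show "j \<in> {j. j < n \<and> odd (\<rho> (2 * j))} \<longleftrightarrow> j \<in> {j. j < n \<and> odd (\<sigma> (2 * j))} - {i}"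
      using ev \<rho>j(1)[of j] by (cases "j = i") auto
  qed
  then have "card {j. j < n \<and> odd (\<rho> (2 * j))} = m"
    using Suc(2) i by (simp add: card_Diff_singleton)
  then have "sign \<rho> = (\<Prod>j<n. if even (\<rho> (2 * j)) then 1 else - 1)"
    using Suc(1) bp by blast
  also have "\<dots> = (\<Prod>j\<in>{..<n} - {i}. if even (\<sigma> (2 * j)) then 1 else - 1)"
    using i(1) ev \<rho>j(1) by (subst prod.remove[of _ i]) (auto intro!: prod.cong)
  finally have "sign \<rho> = (\<Prod>j\<in>{..<n} - {i}. if even (\<sigma> (2 * j)) then 1 else - 1)" .
  moreover have "(\<Prod>j<n. if even (\<sigma> (2 * j)) then 1 else - 1) =
      - (\<Prod>j\<in>{..<n} - {i}. if even (\<sigma> (2 * j)) then 1 else - 1 :: int)"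
    using i by (subst prod.remove[of _ i]) auto
  moreover have "sign \<rho> = - sign \<sigma>"
    unfolding \<rho>_def using \<sigma> \<tau>
    by (subst sign_compose) (auto simp: \<tau>_def sign_swap_id permutation_swap_id intro: permutation_permutes[THEN iffD2])
  ultimately show ?case by simp
qed

text \<open>If all blocks but one are preserved, the two slots of the last one are sent to the only block
  that is left. Thus one arbitrary two-form may take part in the product.\<close>

lemma block_preserving_all_but_one:
  assumes \<sigma>: "\<sigma> permutes {..<2 * n}" and "i0 < n"
    and *: "\<And>i. i < n \<Longrightarrow> i \<noteq> i0 \<Longrightarrow> \<sigma> (2 * i) div 2 = \<sigma> (2 * i + 1) div 2"
  shows "block_preserving n \<sigma>"
proof -
  define k where "k = \<sigma> (2 * i0)"
  define k' where "k' = (if even k then k + 1 else k - 1)"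
  have k': "k' div 2 = k div 2" "k' \<noteq> k" by (auto simp: k'_def elim!: oddE evenE)
  have third: "x = k" if "x div 2 = k' div 2" "x \<noteq> k'" for x
    using same_block_cases[OF that] same_block_cases[OF k'] by auto
  have "k < 2 * n" using permutes_pair_less(1)[OF \<sigma> assms(2)] by (simp add: k_def)
  then have "k' < 2 * n" using k'(1) by presburger
  then obtain m where m: "m < 2 * n" "\<sigma> m = k'"
    using permutes_image[OF \<sigma>] by (metis imageE lessThan_iff)
  have "m div 2 = i0"
  proof (rule ccontr)
    assume ne: "m div 2 \<noteq> i0"
    have "m div 2 < n" using m by simp
    note eq = *[OF this ne]
    have "m = 2 * (m div 2) \<or> m = 2 * (m div 2) + 1" by presburger
    then obtain l where l: "l \<noteq> m" "l div 2 = m div 2" "\<sigma> l div 2 = k' div 2"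
    proof
      assume "m = 2 * (m div 2)"
      then show thesis using that[of "2 * (m div 2) + 1"] eq m(2) by simp
    next
      assume "m = 2 * (m div 2) + 1"
      then show thesis using that[of "2 * (m div 2)"] eq m(2) by simp
    qed
    then have "\<sigma> l = k" using third[of "\<sigma> l"] m(2) permutes_eq_iff[OF \<sigma>, of l m] by simp
    then have "l = 2 * i0" using permutes_eq_iff[OF \<sigma>, of l "2 * i0"] by (simp add: k_def)
    then show False using l(2) ne by simp
  qed
  moreover have "m \<noteq> 2 * i0" using m(2) k'(2) by (auto simp: k_def)
  ultimately have "m = 2 * i0 + 1" by presburger
  then have "\<sigma> (2 * i0) div 2 = \<sigma> (2 * i0 + 1) div 2" using m(2) k'(1) by (simp add: k_def)
  then show ?thesis using * \<sigma> by (auto simp: block_preserving_def)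
qed

section \<open>Powers of a positive form and contraction\<close>

lemma unitary_frame_values:
  fixes e :: "'n::finite \<Rightarrow> complex ^ 'n"
  assumes b: "positive_11 b" and e: "unitary_for b e" and "k < 2 * CARD('n)" "l < 2 * CARD('n)"
  shows "k div 2 \<noteq> l div 2 \<Longrightarrow> b [complex_frame e k, complex_frame e l] = 0"
    and "b [complex_frame e (2 * i), complex_frame e (2 * i + 1)] = 1"
proof -
  have alt: "alternating 2 b" and J: "\<And>u v. b [\<i> *s u, \<i> *s v] = b [u, v]"
    using b by (auto simp: positive_11_def)
  show "b [complex_frame e (2 * i), complex_frame e (2 * i + 1)] = 1"
    using e by (simp add: complex_frame_def unitary_for_def)
  assume "k div 2 \<noteq> l div 2"
  then have "index_list ! (k div 2) \<noteq> (index_list ! (l div 2) :: 'n)"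
    using assms(3,4) by (simp add: nth_eq_iff_index_eq index_list)
  then show "b [complex_frame e k, complex_frame e l] = 0"
    using e J
      alternating2(4)[OF alt, of "\<i> *s e (index_list ! (k div 2))" "e (index_list ! (l div 2))"]
    by (simp add: complex_frame_def unitary_for_def)
qed

lemma wedge2_unitary:
  fixes e :: "'n::finite \<Rightarrow> complex ^ 'n"
  assumes b: "positive_11 b" and F: "alternating 2 F" and e: "unitary_for b e" and i0: "i0 < CARD('n)"
  shows "wedge2 ((replicate CARD('n) b)[i0 := F]) (frame_list e) =
    (\<Sum>\<sigma> | block_preserving CARD('n) \<sigma>.
       F [complex_frame e (2 * (\<sigma> (2 * i0) div 2)), complex_frame e (2 * (\<sigma> (2 * i0) div 2) + 1)])
     / 2 ^ CARD('n)"
proof -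
  define n where "n = CARD('n)"
  define \<phi> where "\<phi> = complex_frame e"
  define L where "L = (replicate n b)[i0 := F]"
  define s where "s \<sigma> i = (if even (\<sigma> (2 * i)) then 1 else - 1 :: real)" for \<sigma> :: "nat \<Rightarrow> nat" and i :: nat
  have i0n: "i0 < n" using i0 by (simp add: n_def)
  have L: "L ! i0 = F" "\<And>i. i < n \<Longrightarrow> i \<noteq> i0 \<Longrightarrow> L ! i = b" using i0n by (auto simp: L_def)
  define T where "T \<sigma> = of_int (sign \<sigma>) * (\<Prod>i<n. (L ! i) [\<phi> (\<sigma> (2 * i)), \<phi> (\<sigma> (2 * i + 1))])" for \<sigma>
  define V where "V \<sigma> = F [\<phi> (2 * (\<sigma> (2 * i0) div 2)), \<phi> (2 * (\<sigma> (2 * i0) div 2) + 1)]" for \<sigma>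
  have split: "(\<Prod>i<n. (L ! i) [\<phi> (\<sigma> (2 * i)), \<phi> (\<sigma> (2 * i + 1))]) =
     F [\<phi> (\<sigma> (2 * i0)), \<phi> (\<sigma> (2 * i0 + 1))] * (\<Prod>i\<in>{..<n} - {i0}. b [\<phi> (\<sigma> (2 * i)), \<phi> (\<sigma> (2 * i + 1))])" for \<sigma>
    using i0n L by (subst prod.remove[of _ i0]) (auto intro!: prod.cong)
  have T: "T \<sigma> = (if block_preserving n \<sigma> then V \<sigma> else 0)" if \<sigma>: "\<sigma> permutes {..<2 * n}" for \<sigma>
  proof (cases "block_preserving n \<sigma>")
    case True
    have pair: "G [\<phi> (\<sigma> (2 * i)), \<phi> (\<sigma> (2 * i + 1))] =
        s \<sigma> i * G [\<phi> (2 * (\<sigma> (2 * i) div 2)), \<phi> (2 * (\<sigma> (2 * i) div 2) + 1)]"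
      if "alternating 2 G" "i < n" for G i
      using block_preserving_pair[OF True that(2)]
    proof
      assume *: "even (\<sigma> (2 * i)) \<and> \<sigma> (2 * i) = 2 * (\<sigma> (2 * i) div 2) \<and> \<sigma> (2 * i + 1) = 2 * (\<sigma> (2 * i) div 2) + 1"
      then have "s \<sigma> i = 1" by (simp add: s_def)
      then show ?thesis using * by simp
    next
      assume *: "odd (\<sigma> (2 * i)) \<and> \<sigma> (2 * i + 1) = 2 * (\<sigma> (2 * i) div 2) \<and> \<sigma> (2 * i) = 2 * (\<sigma> (2 * i) div 2) + 1"
      then have "s \<sigma> i = - 1" by (simp add: s_def)
      then show ?thesis using * alternating2(4)[OF that(1)]
        by (metis mult_minus1)
    qed
    have alt: "alternating 2 b" using b by (simp add: positive_11_def)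
    have "b [\<phi> (\<sigma> (2 * i)), \<phi> (\<sigma> (2 * i + 1))] = s \<sigma> i" if "i < n" for i
      using pair[OF alt that] unitary_frame_values(2)[OF b e, of 0 0] by (simp add: \<phi>_def)
    then have "T \<sigma> = of_int (sign \<sigma>) * (s \<sigma> i0 * V \<sigma> * (\<Prod>i\<in>{..<n} - {i0}. s \<sigma> i))"
      unfolding T_def split V_def using pair[OF F i0n] by (auto intro!: arg_cong2[where f = "(*)"] prod.cong)
    also have "\<dots> = V \<sigma> * (of_int (sign \<sigma>) * (\<Prod>i<n. s \<sigma> i))"
      using i0n by (subst (2) prod.remove[of _ i0]) (auto simp: mult_ac)
    also have "of_int (sign \<sigma>) = (\<Prod>i<n. s \<sigma> i)"
      unfolding sign_block_preserving[OF True] s_def by (auto intro!: prod.cong)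
    also have "(\<Prod>i<n. s \<sigma> i) * (\<Prod>i<n. s \<sigma> i) = 1"
      unfolding prod.distrib[symmetric] by (rule prod.neutral) (auto simp: s_def)
    finally show ?thesis using True by simp
  next
    case False
    then obtain i where i: "i < n" "i \<noteq> i0" "\<sigma> (2 * i) div 2 \<noteq> \<sigma> (2 * i + 1) div 2"
      using block_preserving_all_but_one[OF \<sigma> i0n] by blast
    then have "b [\<phi> (\<sigma> (2 * i)), \<phi> (\<sigma> (2 * i + 1))] = 0"
      unfolding \<phi>_def using permutes_pair_less[OF \<sigma> i(1)]
      by (intro unitary_frame_values(1)[OF b e]) (auto simp: n_def)
    then have "(\<Prod>i\<in>{..<n} - {i0}. b [\<phi> (\<sigma> (2 * i)), \<phi> (\<sigma> (2 * i + 1))]) = 0"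
      using i by (intro prod_zero) auto
    then show ?thesis using False unfolding T_def split by simp
  qed
  have len: "length L = n" by (simp add: L_def)
  have "wedge2 L (frame_list e) = (\<Sum>\<sigma> | \<sigma> permutes {..<2 * n}. T \<sigma>) / 2 ^ n"
    unfolding wedge2_def len T_def \<phi>_def n_def
    using permutes_pair_less by (auto intro!: sum.cong prod.cong arg_cong2[where f = "(*)"] simp: n_def)
  also have "(\<Sum>\<sigma> | \<sigma> permutes {..<2 * n}. T \<sigma>) =
      (\<Sum>\<sigma> | \<sigma> permutes {..<2 * n}. if block_preserving n \<sigma> then V \<sigma> else 0)"
    using T by (intro sum.cong) auto
  also have "\<dots> = (\<Sum>\<sigma> | block_preserving n \<sigma>. V \<sigma>)"
    using finite_permutations[of "{..<2 * n}"]
    by (subst sum.inter_filter[symmetric]) (auto intro!: sum.cong simp: block_preserving_def)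
  finally show ?thesis by (simp add: L_def V_def \<phi>_def n_def)
qed

lemma finite_block_preserving: "finite {\<sigma>. block_preserving n \<sigma>}"
  by (rule finite_subset[OF _ finite_permutations[of "{..<2 * n}"]]) (auto simp: block_preserving_def)

lemma wedge2_power_unitary:
  fixes e :: "'n::finite \<Rightarrow> complex ^ 'n"
  assumes b: "positive_11 b" and e: "unitary_for b e"
  shows "wedge2 (replicate CARD('n) b) (frame_list e) =
      card {\<sigma>. block_preserving CARD('n) \<sigma>} / 2 ^ CARD('n)"
    and "wedge2 (replicate CARD('n) b) (frame_list e) > 0"
proof -
  have alt: "alternating 2 b" using b by (simp add: positive_11_def)
  have "(replicate CARD('n) b)[0 := b] = replicate CARD('n) b"
    by (simp add: list_update_same_conv)
  then show eq: "wedge2 (replicate CARD('n) b) (frame_list e) =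
      card {\<sigma>. block_preserving CARD('n) \<sigma>} / 2 ^ CARD('n)"
    using wedge2_unitary[OF b alt e, of 0] unitary_frame_values(2)[OF b e, of 0 0] by simp
  have "block_preserving CARD('n) id" by (simp add: block_preserving_def permutes_id)
  then have "card {\<sigma>. block_preserving CARD('n) \<sigma>} > 0"
    using finite_block_preserving card_gt_0_iff by blast
  then show "wedge2 (replicate CARD('n) b) (frame_list e) > 0"
    unfolding eq by simp
qed

text \<open>Put \<open>F\<close> in each of the \<open>n\<close> positions of the product and add up: a block-preserving permutation
  permutes the blocks, so each of them contributes the full trace of \<open>F\<close>.\<close>

lemma wedge2_contraction_unitary:
  fixes e :: "'n::finite \<Rightarrow> complex ^ 'n"
  assumes b: "positive_11 b" and F: "alternating 2 F" and e: "unitary_for b e"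
  shows "real CARD('n) * wedge2 (replicate (CARD('n) - 1) b @ [F]) (frame_list e) =
    (\<Sum>j\<in>UNIV. F [e j, \<i> *s e j]) * wedge2 (replicate CARD('n) b) (frame_list e)"
proof -
  define n where "n = CARD('n)"
  define f where "f i = F [complex_frame e (2 * i), complex_frame e (2 * i + 1)]" for i
  have "(\<Sum>i<n. f i) = (\<Sum>j\<in>UNIV. F [e j, \<i> *s e j])"
    unfolding f_def n_def
    by (rule sum.reindex_bij_betw[where h = "(!) index_list", unfolded comp_def, THEN trans[rotated]])
       (auto simp: complex_frame_def index_list intro!: bij_betw_nth)
  have mset: "wedge2 (replicate (n - 1) b @ [F]) vs = wedge2 ((replicate n b)[i := F]) vs" if "i < n" for i vs
  proof (rule wedge2_mset_cong)
    have "mset ((replicate n b)[i := F]) = add_mset F (replicate_mset n b - {#b#})"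
      using that by (simp add: mset_update)
    also have "replicate_mset n b - {#b#} = replicate_mset (n - 1) b" using that by (cases n) auto
    finally show "mset (replicate (n - 1) b @ [F]) = mset ((replicate n b)[i := F])" by simp
  qed
  have "real n * wedge2 (replicate (n - 1) b @ [F]) (frame_list e) =
      (\<Sum>i<n. wedge2 ((replicate n b)[i := F]) (frame_list e))"
    by (subst sum.cong[OF refl mset[symmetric]]) auto
  also have "\<dots> = (\<Sum>i<n. (\<Sum>\<sigma> | block_preserving n \<sigma>. f (\<sigma> (2 * i) div 2)) / 2 ^ n)"
    unfolding n_def f_def using wedge2_unitary[OF b F e] by (intro sum.cong) auto
  also have "\<dots> = (\<Sum>\<sigma> | block_preserving n \<sigma>. \<Sum>i<n. f (\<sigma> (2 * i) div 2)) / 2 ^ n"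
    unfolding sum_divide_distrib[symmetric] by (subst sum.swap) simp
  also have "\<dots> = (\<Sum>\<sigma> | block_preserving n \<sigma>. \<Sum>i<n. f i) / 2 ^ n"
    
  proof (rule arg_cong[where f = "\<lambda>x. x / 2 ^ n"], rule sum.cong[OF refl])
    fix \<sigma> assume "\<sigma> \<in> {\<sigma>. block_preserving n \<sigma>}"
    then show "(\<Sum>i<n. f (\<sigma> (2 * i) div 2)) = (\<Sum>i<n. f i)"
      using sum.reindex_bij_betw[OF block_preserving_bij, of n \<sigma> f] by simp
  qed
  also have "\<dots> = (\<Sum>i<n. f i) * (card {\<sigma>. block_preserving n \<sigma>} / 2 ^ n)"
    by simp
  finally show ?thesis
    using \<open>(\<Sum>i<n. f i) = _\<close> wedge2_power_unitary(1)[OF b e] by (simp add: n_def)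
qed

lemma wedge2_power_alternating:
  "positive_11 (b :: (complex ^ 'n::finite) list \<Rightarrow> real) \<Longrightarrow>
     alternating (2 * CARD('n)) (wedge2 (replicate CARD('n) b))"
  by (intro wedge2_alternating) (auto simp: positive_11_def)

lemma wedge2_power_nonzero:
  fixes b :: "(complex ^ 'n::finite) list \<Rightarrow> real"
  assumes "positive_11 b"
  shows "wedge2 (replicate CARD('n) b) std_frame \<noteq> 0"
proof
  assume 0: "wedge2 (replicate CARD('n) b) std_frame = 0"
  obtain e where e: "unitary_for b e" using unitary_exists[OF assms] by blast
  have "wedge2 (replicate CARD('n) b) (frame_list e) = 0"
    by (rule alternating_top_zero[OF wedge2_power_alternating[OF assms] _ span_std_frame 0]) auto
  then show False using wedge2_power_unitary(2)[OF assms e] by simp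
qed

text \<open>The Euclidean Kaehler form, for which the coordinate frame is unitary.\<close>

definition standard_form :: "(complex ^ 'n::finite) list \<Rightarrow> real" where
  "standard_form vs = (\<i> *s (vs ! 0)) \<bullet> (vs ! 1)"

lemma standard_form: "positive_11 (standard_form :: (complex ^ 'n::finite) list \<Rightarrow> real)"
  "unitary_for standard_form (\<lambda>j::'n. axis j 1)"
proof -
  have lin: "linear (\<lambda>u. (\<i> *s u) \<bullet> w)" "linear (\<lambda>u. (\<i> *s w) \<bullet> u)" for w :: "complex ^ 'n"
    by (auto intro!: linearI simp: vector_add_ldistrib inner_add smult_scaleR)
  show "positive_11 (standard_form :: (complex ^ 'n) list \<Rightarrow> real)"
    unfolding positive_11_def alternating_def
  proof (intro conjI allI impI)
    fix xs ys :: "(complex ^ 'n) list"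
    assume "length xs + length ys + 1 = 2"
    then consider "xs = []" "length ys = 1" | "length xs = 1" "ys = []"
      by (cases xs; cases ys) auto
    then show "linear (\<lambda>u. standard_form (xs @ u # ys))"
      using lin by cases (auto simp: standard_form_def length_Suc_conv)
  next
    fix xs ys zs :: "(complex ^ 'n) list" and u
    assume "length xs + length ys + length zs + 2 = 2"
    then show "standard_form (xs @ u # ys @ u # zs) = 0"
      by (simp add: standard_form_def inner_vec_def inner_complex_def)
  next
    fix u v :: "complex ^ 'n"
    show "standard_form [\<i> *s u, \<i> *s v] = standard_form [u, v]"
      by (simp add: standard_form_def inner_vec_def inner_complex_def algebra_simps)
    assume "u \<noteq> 0"
    then have "\<i> *s u \<noteq> 0" by (metis imag_imag_smult neg_equal_0_iff_equal vector_smult_rzero)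
    then show "standard_form [u, \<i> *s u] > 0" by (simp add: standard_form_def)
  qed
  show "unitary_for standard_form (\<lambda>j::'n. axis j 1)"
    by (auto simp: unitary_for_def standard_form_def imag_smult_axis inner_axis_axis)
qed

text \<open>On a unitary frame the power is positive, so on the coordinate frame it does not vanish. Its sign
  there is constant along the segment of positive forms from the Euclidean one, where it is positive.\<close>

lemma wedge2_power_positive:
  fixes b :: "(complex ^ 'n::finite) list \<Rightarrow> real"
  assumes b: "positive_11 b"
  shows "wedge2 (replicate CARD('n) b) std_frame > 0"
proof (rule ccontr)
  assume neg: "\<not> wedge2 (replicate CARD('n) b) std_frame > 0"
  define B where "B s = (\<lambda>vs. (1 - s) * standard_form vs + s * b vs)" for s :: real
  define f where "f s = wedge2 (replicate CARD('n) (B s)) std_frame" for s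
  have pos: "positive_11 (B s)" if "s \<in> {0..1}" for s
    unfolding positive_11_def
  proof (intro conjI allI impI)
    have "alternating 2 (\<lambda>vs. (1 - s) *\<^sub>R standard_form vs + s *\<^sub>R b vs)"
      using b standard_form(1)[where 'n = 'n] by (intro alternating_combination) (auto simp: positive_11_def)
    then show "alternating 2 (B s)" by (simp add: B_def)
    show "B s [\<i> *s u, \<i> *s v] = B s [u, v]" for u v
      using b standard_form(1)[where 'n = 'n] by (simp add: B_def positive_11_def)
    fix u :: "complex ^ 'n" assume "u \<noteq> 0"
    then have "standard_form [u, \<i> *s u] > 0" "b [u, \<i> *s u] > 0"
      using b standard_form(1)[where 'n = 'n] by (auto simp: positive_11_def)
    then show "B s [u, \<i> *s u] > 0"
      using that by (cases "s = 0") (auto simp: B_def intro: add_nonneg_pos)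
  qed
  have "continuous_on {0..1} f"
    unfolding f_def wedge2_def B_def by (auto intro!: continuous_intros)
  moreover have "f 1 \<le> 0" using neg by (simp add: f_def B_def)
  moreover have "f 0 > 0"
    using wedge2_power_unitary(2)[OF standard_form] by (simp add: f_def B_def std_frame_eq)
  ultimately obtain s where "0 \<le> s" "s \<le> 1" "f s = 0"
    using IVT2'[of f 1 0 0] by auto
  then show False using wedge2_power_nonzero[OF pos[of s]] by (simp add: f_def)
qed

lemma wedge2_contraction:
  fixes e :: "'n::finite \<Rightarrow> complex ^ 'n"
  assumes b: "positive_11 b" and F: "alternating 2 F" and e: "unitary_for b e"
    and len: "length vs = 2 * CARD('n)"
  shows "real CARD('n) * wedge2 (replicate (CARD('n) - 1) b @ [F]) vs =
    (\<Sum>j\<in>UNIV. F [e j, \<i> *s e j]) * wedge2 (replicate CARD('n) b) vs"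
proof -
  define W where "W vs = wedge2 (replicate CARD('n) b) vs" for vs
  define V where "V vs = wedge2 (replicate (CARD('n) - 1) b @ [F]) vs" for vs
  have altW: "alternating (2 * CARD('n)) W"
    unfolding W_def using wedge2_power_alternating[OF b] .
  have altV: "alternating (2 * CARD('n)) V"
    unfolding V_def using b F by (intro wedge2_alternating) (auto simp: positive_11_def)
  note prop' = alternating_proportional[OF altV altW length_std_frame span_std_frame]
  define s where "s = (std_frame :: (complex ^ 'n) list)"
  have p: "V ws * W s = W ws * V s" if "length ws = 2 * CARD('n)" for ws
    unfolding s_def by (rule prop'[OF that])
  have pos: "W (frame_list e) > 0" "W s \<noteq> 0"
    unfolding W_def s_def using wedge2_power_unitary(2)[OF b e] wedge2_power_nonzero[OF b] by auto
  define tr where "tr = (\<Sum>j\<in>UNIV. F [e j, \<i> *s e j])"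
  have "real CARD('n) * V (frame_list e) = tr * W (frame_list e)"
    unfolding V_def W_def tr_def by (rule wedge2_contraction_unitary[OF b F e])
  then have "tr * W (frame_list e) * W s = real CARD('n) * V (frame_list e) * W s" by simp
  also have "\<dots> = real CARD('n) * (W (frame_list e) * V s)"
    using p[of "frame_list e"] by simp
  finally have "W (frame_list e) * (tr * W s) = W (frame_list e) * (real CARD('n) * V s)"
    by (simp add: mult_ac)
  then have "tr * W s = real CARD('n) * V s" using pos by simp
  then have "tr * W vs * W s = real CARD('n) * (V vs * W s)"
    using p[OF len] by (simp add: algebra_simps)
  then have "tr * W vs = real CARD('n) * V vs" using pos(2) by simp
  then show ?thesis by (simp add: V_def W_def tr_def)
qed

section \<open>Scaling of the scalar curvature\<close>

text \<open>A Riemannian metric \<open>G\<close> and \<open>t G\<close> have the same Levi-Civita connection, so the same Ricci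
  tensor, and the trace that produces the scalar curvature scales by \<open>1 / t\<close>. Since indices are raised
  by a definite description, this last step needs the Ricci tensor to be linear in its last argument,
  which rests on the differentiability of the Christoffel symbols.\<close>

definition metric_on :: "'a::euclidean_space set \<Rightarrow> ('a \<Rightarrow> 'a \<Rightarrow> 'a \<Rightarrow> real) \<Rightarrow> bool" where
  "metric_on U G \<longleftrightarrow> open U \<and>
     (\<forall>y\<in>U. (\<forall>v. linear (\<lambda>u. G y u v)) \<and> (\<forall>u. linear (G y u)) \<and> (\<forall>u. u \<noteq> 0 \<longrightarrow> G y u u > 0)) \<and>
     (\<forall>u v. smooth_on U (\<lambda>y. G y u v))"

lemma metric_cancel:
  assumes "metric_on U G" "y \<in> U" "\<And>x. G y w x = G y w' x"
  shows "w = w'"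
proof (rule ccontr)
  assume "w \<noteq> w'"
  then have "G y (w - w') (w - w') > 0" using assms by (auto simp: metric_on_def)
  moreover have "linear (\<lambda>u. G y u (w - w'))" using assms by (auto simp: metric_on_def)
  then have "G y (w - w') (w - w') = G y w (w - w') - G y w' (w - w')" by (rule linear_diff)
  ultimately show False using assms(3) by simp
qed

lemma sharp_eq:
  assumes "metric_on U G" "y \<in> U" "\<And>x. G y w x = l x"
  shows "sharp (G y) l = w"
  unfolding sharp_def using assms metric_cancel[OF assms(1,2)]
  by (intro the_equality) auto

lemma sharp_works:
  assumes G: "metric_on U G" "y \<in> U" and l: "linear l"
  shows "G y (sharp (G y) l) x = l x"
proof -
  have lin: "linear (\<lambda>u. G y u v)" "linear (G y u)" for u v
    using G by (auto simp: metric_on_def)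
  define T where "T w = (\<Sum>b\<in>Basis. G y w b *\<^sub>R b)" for w
  have Tx: "T w \<bullet> x = G y w x" for w x
    unfolding T_def by (rule linear_eq_inner_sum[OF lin(2)])
  have "linear T" unfolding T_def
    by (intro linear_compose_sum ballI
      linear_compose[OF lin(1) bounded_linear.linear[OF bounded_linear_scaleR_left], unfolded comp_def])
  moreover have "inj T"
    using Tx metric_cancel[OF G] by (intro injI) metis
  ultimately have "surj T" by (simp add: linear_injective_imp_surjective)
  then obtain w where "T w = (\<Sum>b\<in>Basis. l b *\<^sub>R b)" by (metis surjD)
  then have w: "G y w x = l x" for x using Tx[of w x] linear_eq_inner_sum[OF l] by simp
  then show ?thesis using sharp_eq[OF G w] by simp
qed

lemma sharp_linear:
  assumes G: "metric_on U G" "y \<in> U" and "\<And>w. linear (L w)" "\<And>x. linear (\<lambda>w. L w x)"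
  shows "linear (\<lambda>w. sharp (G y) (L w))"
proof -
  have lin: "linear (\<lambda>u. G y u v)" for v using G by (auto simp: metric_on_def)
  note works = sharp_works[OF G assms(3)]
  show ?thesis
  proof (rule linearI)
    fix v w
    show "sharp (G y) (L (v + w)) = sharp (G y) (L v) + sharp (G y) (L w)"
      by (rule sharp_eq[OF G]) (simp add: linear_add[OF lin] works linear_add[OF assms(4)])
  next
    fix r v
    show "sharp (G y) (L (r *\<^sub>R v)) = r *\<^sub>R sharp (G y) (L v)"
      by (rule sharp_eq[OF G]) (simp add: linear_scale[OF lin] works linear_scale[OF assms(4)])
  qed
qed

text \<open>The map \<open>(y, w) \<mapsto> (y, G\<^sub>y(w, \<cdot>))\<close> is a bijection, differentiable with invertible derivative,
  so its inverse, which raises the index, is differentiable.\<close>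

lemma sharp_differentiable:
  fixes G :: "'a::euclidean_space \<Rightarrow> 'a \<Rightarrow> 'a \<Rightarrow> real"
  assumes G: "metric_on U G" and z: "z \<in> U"
    and l: "\<And>y. y \<in> U \<Longrightarrow> linear (l y)" "\<And>x. (\<lambda>y. l y x) differentiable (at z)"
  shows "(\<lambda>y. sharp (G y) (l y)) differentiable (at z)"
proof -
  have U: "open U" using G by (simp add: metric_on_def)
  have lin: "linear (\<lambda>u. G y u v)" "linear (G y u)" if "y \<in> U" for y u v
    using G that by (auto simp: metric_on_def)
  have smooth: "smooth_on U (\<lambda>y. G y u v)" for u v using G by (simp add: metric_on_def)
  define f where "f = (\<lambda>(y, w). (y, \<Sum>b\<in>Basis. (\<Sum>c\<in>Basis. (w \<bullet> c) * G y c b) *\<^sub>R b))"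
  define g where "g = (\<lambda>(y, m). (y, sharp (G y) (\<lambda>x. m \<bullet> x)))"
  have expand: "(\<Sum>c\<in>Basis. (w \<bullet> c) * G y c b) = G y w b" if "y \<in> U" for y w b
    using linear_eq_inner_sum[OF lin(1)[OF that], of b w]
    by (simp add: inner_sum_right mult.commute inner_commute[of _ w])
  have f_eq: "f (y, w) = (y, \<Sum>b\<in>Basis. G y w b *\<^sub>R b)" if "y \<in> U" for y w
    unfolding f_def using expand[OF that] by simp
  have gf: "g (f x) = x" if "x \<in> U \<times> UNIV" for x :: "'a \<times> 'a"
  proof -
    obtain y w where x: "x = (y, w)" "y \<in> U" using \<open>x \<in> U \<times> UNIV\<close> by auto
    have "sharp (G y) (\<lambda>x. (\<Sum>b\<in>Basis. G y w b *\<^sub>R b) \<bullet> x) = w"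
      using linear_eq_inner_sum[OF lin(2)[OF x(2)]] by (intro sharp_eq[OF G x(2)]) simp
    then show ?thesis unfolding x(1) f_eq[OF x(2)] by (simp add: g_def)
  qed
  define f' where "f' y w = (\<lambda>(h, k). (h, \<Sum>b\<in>Basis.
      (\<Sum>c\<in>Basis. (w \<bullet> c) * pd (\<lambda>y. G y c b) y h + (k \<bullet> c) * G y c b) *\<^sub>R b))" for y w
  have df: "(f has_derivative f' y w) (at (y, w))" if "y \<in> U" for y w
  proof -
    have D: "((\<lambda>x. G (fst x) c b) has_derivative (\<lambda>h. pd (\<lambda>y. G y c b) y (fst h))) (at (y, w))" for b c
    proof -
      have "((\<lambda>y. G y c b) has_derivative pd (\<lambda>y. G y c b) y) (at (fst (y, w)))"
        using pd_has_derivative[OF smooth_on_differentiable[OF smooth that]] by simp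
      from has_derivative_compose[OF has_derivative_fst[OF has_derivative_ident] this]
      show ?thesis by simp
    qed
    have "((\<lambda>x. (fst x, \<Sum>b\<in>Basis. (\<Sum>c\<in>Basis. (snd x \<bullet> c) * G (fst x) c b) *\<^sub>R b))
       has_derivative f' y w) (at (y, w))"
      unfolding f'_def case_prod_unfold
      by (auto intro!: derivative_eq_intros D simp: fun_eq_iff)
    then show ?thesis unfolding f_def case_prod_unfold .
  qed
  \<comment> \<open>The point at which the inverse function theorem is applied.\<close>
  define w where "w = sharp (G z) (l z)"
  have inj: "inj (f' z w)"
  proof -
    have "linear (f' z w)" using df[OF z] has_derivative_linear by blast
    moreover have "x = 0" if "f' z w x = 0" for x
    proof -
      obtain h k where x: "x = (h, k)" by fastforce
      have h: "h = 0" using that unfolding x f'_def by (simp add: zero_prod_def)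
      have "pd (\<lambda>y. G y c b) z 0 = 0" for b c
        using linear_0[OF linear_frechet_derivative[OF smooth_on_differentiable[OF smooth z]]] .
      then have "(\<Sum>b\<in>Basis. G z k b *\<^sub>R b) = 0"
        using that h expand[OF z] unfolding x f'_def by (simp add: zero_prod_def)
      then have "G z k x = 0" for x
        using linear_eq_inner_sum[OF lin(2)[OF z], of k x] by simp
      moreover have "G z 0 x = 0" for x using linear_0[OF lin(1)[OF z]] .
      ultimately have "k = 0" using metric_cancel[OF G z, of k 0] by simp
      then show ?thesis using h x by (simp add: zero_prod_def)
    qed
    ultimately show ?thesis using linear_injective_0 by blast
  qed
  then obtain g' where "\<forall>x. f' z w (g' x) = x"
    using linear_injective_isomorphism[OF has_derivative_linear[OF df[OF z, of w]]] by blast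
  then have g': "f' z w \<circ> g' = id" by auto
  have "continuous_on (U \<times> UNIV) f"
    using df by (intro continuous_at_imp_continuous_on ballI)
      (auto intro: has_derivative_continuous)
  from has_derivative_inverse_strong[OF _ _ this gf df[OF z] g']
  have dg: "(g has_derivative g') (at (f (z, w)))"
    using U z by (auto intro: open_Times)
  define q where "q y = (y, \<Sum>b\<in>Basis. l y b *\<^sub>R b)" for y
  have "q z = f (z, w)"
    unfolding q_def f_eq[OF z] w_def using sharp_works[OF G z l(1)[OF z]] by simp
  then have "g differentiable (at (q z))" using dg by (auto simp: differentiable_def)
  moreover have "q differentiable (at z)"
  proof -
    have "(q has_derivative (\<lambda>h. (h, \<Sum>b\<in>Basis. pd (\<lambda>y. l y b) z h *\<^sub>R b))) (at z)"
      unfolding q_def using pd_has_derivative[OF l(2)]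
      by (auto intro!: derivative_eq_intros)
    then show ?thesis by (auto simp: differentiable_def)
  qed
  ultimately have "g \<circ> q differentiable (at z)" by (intro differentiable_chain_at)
  then obtain D where "((g \<circ> q) has_derivative D) (at z)" by (auto simp: differentiable_def)
  then have "((\<lambda>y. snd ((g \<circ> q) y)) has_derivative (\<lambda>h. snd (D h))) (at z)"
    by (rule has_derivative_snd)
  moreover have "snd ((g \<circ> q) y) = sharp (G y) (l y)" if "y \<in> U" for y
  proof -
    have "(\<lambda>x. (\<Sum>b\<in>Basis. l y b *\<^sub>R b) \<bullet> x) = l y"
      using linear_eq_inner_sum[OF l(1)[OF that]] by auto
    then show ?thesis by (simp add: g_def q_def)
  qed
  ultimately have "((\<lambda>y. sharp (G y) (l y)) has_derivative (\<lambda>h. snd (D h))) (at z)"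
    by (subst has_derivative_cong_open[OF U z, of _ "\<lambda>y. snd ((g \<circ> q) y)"]) auto
  then show ?thesis unfolding differentiable_def by blast
qed

lemma pd_linear_parameter:
  assumes "open U" "z \<in> U" "\<And>y. y \<in> U \<Longrightarrow> linear (H y)" "\<And>w. (\<lambda>y. H y w) differentiable (at z)"
  shows "linear (\<lambda>w. pd (\<lambda>y. H y w) z u)"
proof (rule linearI)
  fix v w
  have "pd (\<lambda>y. H y (v + w)) z u = pd (\<lambda>y. H y v + H y w) z u"
    using linear_add[OF assms(3)] by (subst pd_cong_open[OF assms(1,2)]) auto
  also have "\<dots> = pd (\<lambda>y. H y v) z u + pd (\<lambda>y. H y w) z u"
    by (intro pd_eqI has_derivative_add pd_has_derivative assms)
  finally show "pd (\<lambda>y. H y (v + w)) z u = pd (\<lambda>y. H y v) z u + pd (\<lambda>y. H y w) z u" .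
next
  fix r v
  have "pd (\<lambda>y. H y (r *\<^sub>R v)) z u = pd (\<lambda>y. r *\<^sub>R H y v) z u"
    using linear_scale[OF assms(3)] by (subst pd_cong_open[OF assms(1,2)]) auto
  also have "\<dots> = r *\<^sub>R pd (\<lambda>y. H y v) z u"
    by (intro pd_eqI has_derivative_scaleR_right pd_has_derivative assms)
  finally show "pd (\<lambda>y. H y (r *\<^sub>R v)) z u = r *\<^sub>R pd (\<lambda>y. H y v) z u" .
qed

text \<open>The Christoffel symbols of the first kind.\<close>

definition christoffel_form ::
    "('a::euclidean_space \<Rightarrow> 'a \<Rightarrow> 'a \<Rightarrow> real) \<Rightarrow> 'a \<Rightarrow> 'a \<Rightarrow> 'a \<Rightarrow> 'a \<Rightarrow> real" where
  "christoffel_form G z u v w =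
     (pd (\<lambda>y. G y v w) z u + pd (\<lambda>y. G y u w) z v - pd (\<lambda>y. G y u v) z w) / 2"

lemma christoffel_eq: "christoffel G z u v = sharp (G z) (christoffel_form G z u v)"
  unfolding christoffel_def christoffel_form_def ..

context
  fixes U :: "'a::euclidean_space set" and G :: "'a \<Rightarrow> 'a \<Rightarrow> 'a \<Rightarrow> real"
  assumes G: "metric_on U G"
begin

lemma metric_open: "open U" using G by (simp add: metric_on_def)

lemma metric_linear: "y \<in> U \<Longrightarrow> linear (\<lambda>u. G y u v)" "y \<in> U \<Longrightarrow> linear (G y u)"
  using G by (auto simp: metric_on_def)

lemma metric_smooth: "smooth_on U (\<lambda>y. G y u v)"
  using G by (simp add: metric_on_def)

lemma metric_differentiable: "z \<in> U \<Longrightarrow> (\<lambda>y. G y u v) differentiable (at z)"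
  using smooth_on_differentiable[OF metric_smooth] .

lemma metric_pd_linear:
  assumes "z \<in> U"
  shows "linear (\<lambda>w. pd (\<lambda>y. G y v w) z u)" "linear (\<lambda>w. pd (\<lambda>y. G y w v) z u)"
    "linear (\<lambda>w. pd (\<lambda>y. G y u v) z w)"
proof -
  show "linear (\<lambda>w. pd (\<lambda>y. G y v w) z u)"
    by (rule pd_linear_parameter[OF metric_open assms, of "\<lambda>y w. G y v w"])
       (auto intro: metric_linear metric_differentiable assms)
  show "linear (\<lambda>w. pd (\<lambda>y. G y w v) z u)"
    by (rule pd_linear_parameter[OF metric_open assms, of "\<lambda>y w. G y w v"])
       (auto intro: metric_linear metric_differentiable assms)
  show "linear (\<lambda>w. pd (\<lambda>y. G y u v) z w)"
    using linear_frechet_derivative[OF metric_differentiable[OF assms]] .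
qed

lemma linear_half: "linear f \<Longrightarrow> linear (\<lambda>x. f x / (2::real))"
  using linear_compose_scale_right[of f "1 / 2"] by simp

lemma christoffel_form_linear:
  assumes "z \<in> U"
  shows "linear (christoffel_form G z u v)" "linear (\<lambda>v. christoffel_form G z u v w)"
  unfolding christoffel_form_def
  by (intro linear_half linear_compose_add linear_compose_sub metric_pd_linear assms)+

lemma christoffel_linear:
  assumes "z \<in> U"
  shows "linear (christoffel G z u)"
  unfolding christoffel_eq
  by (rule sharp_linear[OF G assms]) (intro christoffel_form_linear assms)+

lemma christoffel_differentiable:
  assumes "z \<in> U"
  shows "(\<lambda>y. christoffel G y u v) differentiable (at z)"
  unfolding christoffel_eq
proof (rule sharp_differentiable[OF G assms])
  show "linear (christoffel_form G y u v)" if "y \<in> U" for y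
    using christoffel_form_linear that by blast
  have "(\<lambda>y. pd (\<lambda>y. G y v w) y u) differentiable (at z)" for u v w
    by (rule smooth_on_differentiable[OF smooth_on_pd[OF metric_smooth] assms])
  then show "(\<lambda>y. christoffel_form G y u v x) differentiable (at z)" for x
    unfolding christoffel_form_def by (intro derivative_intros) auto
qed

lemma riemann_linear:
  assumes "z \<in> U"
  shows "linear (riemann G z u v)"
proof -
  have *: "linear (\<lambda>w. pd (\<lambda>y. christoffel G y v w) z u)" for u v
    by (rule pd_linear_parameter[OF metric_open assms, of "\<lambda>y. christoffel G y v"])
       (auto intro: christoffel_linear christoffel_differentiable assms)
  have "linear (\<lambda>w. christoffel G z u (christoffel G z v w))" for u v
    using linear_compose[OF christoffel_linear[OF assms] christoffel_linear[OF assms]]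
    by (simp add: comp_def)
  then show ?thesis
    unfolding riemann_def[abs_def] by (intro linear_compose_add linear_compose_sub *) auto
qed

lemma ricci_linear:
  assumes "z \<in> U"
  shows "linear (ricci G z v)"
proof -
  have "linear (\<lambda>w. riemann G z b v w \<bullet> b)" for b
    using linear_compose[OF riemann_linear[OF assms] bounded_linear.linear[OF bounded_linear_inner_left]]
    by (simp add: comp_def)
  then show ?thesis unfolding ricci_def[abs_def] by (intro linear_compose_sum) auto
qed

lemma christoffel_scaled:
  assumes "t \<noteq> 0" "z \<in> U"
  shows "christoffel (\<lambda>z u v. t * G z u v) z = christoffel G z"
proof (intro ext)
  fix u v
  have "pd (\<lambda>y. t * G y u v) z w = t * pd (\<lambda>y. G y u v) z w" for u v w
    by (intro pd_eqI has_derivative_mult_right pd_has_derivative metric_differentiable assms)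
  then have "christoffel_form (\<lambda>z u v. t * G z u v) z u v = (\<lambda>w. t * christoffel_form G z u v w)"
    by (auto simp: christoffel_form_def algebra_simps)
  then show "christoffel (\<lambda>z u v. t * G z u v) z u v = christoffel G z u v"
    \<comment> \<open>The factor \<open>t\<close> cancels in the equation that defines the raised index.\<close>
    unfolding christoffel_eq sharp_def using assms(1) by simp
qed

lemma ricci_scaled:
  assumes "t \<noteq> 0" "z \<in> U"
  shows "ricci (\<lambda>z u v. t * G z u v) z = ricci G z"
proof -
  have "pd (\<lambda>y. christoffel (\<lambda>z u v. t * G z u v) y v w) z u = pd (\<lambda>y. christoffel G y v w) z u" for u v w
    by (subst pd_cong_open[OF metric_open assms(2)]) (auto simp: christoffel_scaled[OF assms(1)])
  then show ?thesis
    by (intro ext) (simp add: ricci_def riemann_def christoffel_scaled[OF assms])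
qed

lemma metric_scalar_curvature_scaled:
  assumes "t \<noteq> 0" "z \<in> U"
  shows "metric_scalar_curvature (\<lambda>z u v. t * G z u v) z = metric_scalar_curvature G z / t"
proof -
  have "sharp (\<lambda>u v. t * G z u v) (ricci G z b) = (1 / t) *\<^sub>R sharp (G z) (ricci G z b)" for b
  proof -
    let ?w = "sharp (G z) (ricci G z b)"
    have "G z ((1 / t) *\<^sub>R ?w) x = ricci G z b x / t" for x
      using linear_scale[OF metric_linear(1)[OF assms(2)]]
        sharp_works[OF G assms(2) ricci_linear[OF assms(2)]] by simp
    then have "sharp (G z) (\<lambda>x. ricci G z b x / t) = (1 / t) *\<^sub>R ?w"
      by (intro sharp_eq[OF G assms(2)])
    moreover have "sharp (\<lambda>u v. t * G z u v) (ricci G z b) = sharp (G z) (\<lambda>x. ricci G z b x / t)"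
      unfolding sharp_def using assms(1) by (simp add: field_simps)
    ultimately show ?thesis by simp
  qed
  then show ?thesis
    unfolding metric_scalar_curvature_def ricci_scaled[OF assms] by (simp add: sum_divide_distrib)
qed

end

section \<open>Charts and forms\<close>

lemma chart_image:
  assumes "complex_atlas \<A>" "c \<in> \<A>"
  shows "open (cdom c)" "open (coord c ` cdom c)"
    "homeomorphism (cdom c) (coord c ` cdom c) (coord c) (param c)"
    "p \<in> cdom c \<Longrightarrow> param c (coord c p) = p"
    "z \<in> coord c ` cdom c \<Longrightarrow> param c z \<in> cdom c"
    "z \<in> coord c ` cdom c \<Longrightarrow> coord c (param c z) = z"
proof -
  show h: "homeomorphism (cdom c) (coord c ` cdom c) (coord c) (param c)"
    and "open (cdom c)" "open (coord c ` cdom c)"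
    using assms by (simp_all add: complex_atlas_def)
  show "p \<in> cdom c \<Longrightarrow> param c (coord c p) = p"
    "z \<in> coord c ` cdom c \<Longrightarrow> param c z \<in> cdom c"
    "z \<in> coord c ` cdom c \<Longrightarrow> coord c (param c z) = z"
    using h unfolding homeomorphism_def by auto
qed

lemma chart_at:
  assumes "complex_atlas \<A>"
  shows "chart_at \<A> p \<in> \<A>" "p \<in> cdom (chart_at \<A> p)"
proof -
  have "\<exists>c. c \<in> \<A> \<and> p \<in> cdom c" using assms unfolding complex_atlas_def by (metis UNIV_I UN_iff)
  from someI_ex[OF this] show "chart_at \<A> p \<in> \<A>" "p \<in> cdom (chart_at \<A> p)"
    by (auto simp: chart_at_def)
qed

lemma form_onD:
  assumes "form_on \<A> UNIV d \<alpha>" "c \<in> \<A>"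
  shows "p \<in> cdom c \<Longrightarrow> alternating d (\<alpha> c p)"
    "length vs = d \<Longrightarrow> smooth_on (coord c ` cdom c) (\<lambda>z. \<alpha> c (param c z) vs)"
    "c' \<in> \<A> \<Longrightarrow> p \<in> cdom c \<Longrightarrow> p \<in> cdom c' \<Longrightarrow> length vs = d \<Longrightarrow>
      \<alpha> c p vs = \<alpha> c' p (map (trans_diff c c' p) vs)"
  using assms unfolding form_on_def Int_UNIV_right by blast+

section \<open>Integration over a compact manifold\<close>

text \<open>Finitely many preimages of coordinate balls cover the manifold; make them disjoint by removing from
  each the earlier ones.\<close>

lemma chart_decomposition_exists:
  fixes \<A> :: "('x::t2_space, 'n::finite) chart set"
  assumes comp: "compact (UNIV :: 'x set)" and atlas: "complex_atlas \<A>"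
  shows "\<exists>P. chart_decomposition \<A> P"
proof -
  have "\<exists>U K. open U \<and> p \<in> U \<and> U \<subseteq> K \<and> compact K \<and> K \<subseteq> cdom (chart_at \<A> p)" for p
  proof -
    define c where "c = chart_at \<A> p"
    have c: "c \<in> \<A>" "p \<in> cdom c" using chart_at[OF atlas] by (auto simp: c_def)
    note ch = chart_image[OF atlas c(1)]
    have cont: "continuous_on (cdom c) (coord c)" "continuous_on (coord c ` cdom c) (param c)"
      using ch(3) by (auto simp: homeomorphism_def)
    obtain e where e: "e > 0" "cball (coord c p) e \<subseteq> coord c ` cdom c"
      using ch(2) c(2) open_contains_cball by blast
    define U where "U = cdom c \<inter> coord c -` ball (coord c p) e"
    define K where "K = param c ` cball (coord c p) e"
    have "open U" unfolding U_def by (intro continuous_open_preimage cont ch open_ball)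
    moreover have "p \<in> U" using e c by (simp add: U_def)
    moreover have "U \<subseteq> K"
    proof
      fix q assume q: "q \<in> U"
      then have "param c (coord c q) = q" using ch(4) by (simp add: U_def)
      moreover have "coord c q \<in> cball (coord c p) e" using q by (auto simp: U_def)
      ultimately show "q \<in> K" unfolding K_def by (metis imageI)
    qed
    moreover have "compact K"
      unfolding K_def using e by (intro compact_continuous_image continuous_on_subset[OF cont(2)]) auto
    moreover have "K \<subseteq> cdom c" unfolding K_def by (rule image_subsetI, rule ch(5), rule subsetD[OF e(2)])
    ultimately show ?thesis unfolding c_def[symmetric] by (intro exI[of _ U] exI[of _ K] conjI)
  qed
  then obtain U K where U: "\<And>p. open (U p)" "\<And>p. p \<in> U p" "\<And>p. U p \<subseteq> K p"
    "\<And>p. compact (K p)" "\<And>p. K p \<subseteq> cdom (chart_at \<A> p)" by metis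
  have "(UNIV :: 'x set) \<subseteq> (\<Union>p. U p)" using U(2) by auto
  then obtain Q where Q: "finite Q" "UNIV \<subseteq> (\<Union>p\<in>Q. U p)"
    by (rule compactE_image[OF comp U(1)])
  obtain ps where ps: "set ps = Q" using finite_list[OF Q(1)] by blast
  define B where "B i = U (ps ! i) - (\<Union>j<i. U (ps ! j))" for i
  define P where "P = (\<lambda>i. (chart_at \<A> (ps ! i), B i)) ` {..<length ps}"
  have "\<forall>(c, B)\<in>P. c \<in> \<A> \<and> B \<in> sets borel \<and> (\<exists>K. compact K \<and> B \<subseteq> K \<and> K \<subseteq> cdom c)"
  proof -
    have "B i \<in> sets borel" for i
      unfolding B_def using U(1) by (intro sets.Diff sets.finite_UN) auto
    moreover have "B i \<subseteq> K (ps ! i)" for i using U(3) by (auto simp: B_def)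
    then have "\<exists>L. compact L \<and> B i \<subseteq> L \<and> L \<subseteq> cdom (chart_at \<A> (ps ! i))" for i
      using U(4,5) by (intro exI[of _ "K (ps ! i)"]) simp
    ultimately show ?thesis using chart_at(1)[OF atlas] by (simp add: P_def)
  qed
  moreover have "\<forall>x\<in>P. \<forall>y\<in>P. x \<noteq> y \<longrightarrow> snd x \<inter> snd y = {}"
  proof -
    have "B i \<inter> B j = {}" if "i \<noteq> j" for i j
      using that by (cases "i < j") (auto simp: B_def)
    then show ?thesis unfolding P_def by (auto simp del: disjoint_iff) (metis IntI empty_iff)+
  qed
  moreover have "(\<Union>x\<in>P. snd x) = UNIV"
  proof -
    have "x \<in> (\<Union>x\<in>P. snd x)" for x
    proof -
      have ex: "\<exists>i. i < length ps \<and> x \<in> U (ps ! i)"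
        using Q(2) ps by (metis UNIV_I UN_iff in_set_conv_nth subsetD)
      define i where "i = (LEAST i. i < length ps \<and> x \<in> U (ps ! i))"
      have i: "i < length ps" "x \<in> U (ps ! i)" using LeastI_ex[OF ex] by (auto simp: i_def)
      have "x \<notin> U (ps ! j)" if "j < i" for j
      proof -
        have "\<not> (j < length ps \<and> x \<in> U (ps ! j))"
          using that unfolding i_def by (rule not_less_Least)
        then show ?thesis using that i(1) by auto
      qed
      then have "x \<in> B i" using i by (auto simp: B_def)
      then show ?thesis using i by (force simp: P_def)
    qed
    then show ?thesis by auto
  qed
  ultimately have "chart_decomposition \<A> P"
    unfolding chart_decomposition_def by (simp add: P_def)
  then show ?thesis ..
qed

context
  fixes \<A> :: "('x::t2_space, 'n::finite) chart set"
  assumes comp: "compact (UNIV :: 'x set)" and atlas: "complex_atlas \<A>"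
begin

text \<open>The decomposition that is chosen in \<^const>\<open>form_integral\<close>.\<close>

definition pieces :: "(('x, 'n) chart \<times> 'x set) set" where
  "pieces = (SOME P. chart_decomposition \<A> P)"

lemma pieces: "chart_decomposition \<A> pieces"
  unfolding pieces_def by (rule someI_ex[OF chart_decomposition_exists[OF comp atlas]])

lemma piecesD:
  assumes "(c, B) \<in> pieces"
  shows "c \<in> \<A>" "B \<in> sets borel" "\<exists>K. compact K \<and> B \<subseteq> K \<and> K \<subseteq> cdom c" "B \<subseteq> cdom c"
proof -
  have *: "c \<in> \<A> \<and> B \<in> sets borel \<and> (\<exists>K. compact K \<and> B \<subseteq> K \<and> K \<subseteq> cdom c)"
    using pieces assms unfolding chart_decomposition_def by fast
  then show "c \<in> \<A>" "B \<in> sets borel" "\<exists>K. compact K \<and> B \<subseteq> K \<and> K \<subseteq> cdom c" by simp_all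
  show "B \<subseteq> cdom c" using * by auto
qed

lemma finite_pieces: "finite pieces"
  using pieces by (simp add: chart_decomposition_def)

lemma form_integral_eq:
  "form_integral \<A> \<alpha> = (\<Sum>(c, B)\<in>pieces.
     set_lebesgue_integral lborel (coord c ` B) (\<lambda>z. \<alpha> c (param c z) std_frame))"
  unfolding form_integral_def pieces_def ..

lemma form_integral_cong:
  assumes "\<And>c p. c \<in> \<A> \<Longrightarrow> p \<in> cdom c \<Longrightarrow> \<alpha> c p std_frame = \<beta> c p std_frame"
  shows "form_integral \<A> \<alpha> = form_integral \<A> \<beta>"
  unfolding form_integral_eq set_lebesgue_integral_def
proof (rule sum.cong[OF refl])
  fix x assume "x \<in> pieces"
  then obtain c B where x: "x = (c, B)" and cB: "(c, B) \<in> pieces" by (cases x) auto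
  have "\<alpha> c (param c z) std_frame = \<beta> c (param c z) std_frame" if "z \<in> coord c ` B" for z
  proof (rule assms[OF piecesD(1)[OF cB]])
    show "param c z \<in> cdom c"
      using that piecesD(4)[OF cB] by (intro chart_image(5)[OF atlas piecesD(1)[OF cB]]) auto
  qed
  then show "(case x of (c, B) \<Rightarrow> LINT z|lborel. indicat_real (coord c ` B) z *\<^sub>R \<alpha> c (param c z) std_frame) =
      (case x of (c, B) \<Rightarrow> LINT z|lborel. indicat_real (coord c ` B) z *\<^sub>R \<beta> c (param c z) std_frame)"
    unfolding x prod.case by (intro Bochner_Integration.integral_cong refl) (auto simp: indicator_def)
qed

lemma piece_measurable:
  assumes "(c, B) \<in> pieces"
  shows "coord c ` B \<in> sets borel"
proof -
  note cB = piecesD[OF assms] and ch = chart_image[OF atlas piecesD(1)[OF assms]]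
  have "coord c ` B = param c -` B \<inter> space (restrict_space borel (coord c ` cdom c))"
  proof (intro set_eqI iffI)
    fix z assume "z \<in> coord c ` B"
    then obtain q where "q \<in> B" "z = coord c q" by auto
    then show "z \<in> param c -` B \<inter> space (restrict_space borel (coord c ` cdom c))"
      using cB(4) ch(4)[of q] by (auto simp: space_restrict_space)
  next
    fix z assume "z \<in> param c -` B \<inter> space (restrict_space borel (coord c ` cdom c))"
    then have "z \<in> coord c ` cdom c" "param c z \<in> B" by (auto simp: space_restrict_space)
    then show "z \<in> coord c ` B" using ch(6)[of z] by (metis imageI)
  qed
  also have "\<dots> \<in> sets (restrict_space borel (coord c ` cdom c))"
    by (rule measurable_sets[OF borel_measurable_continuous_on_restrict[OF homeomorphism_cont2[OF ch(3)]] cB(2)])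
  finally show ?thesis using ch(2) by (auto simp: sets_restrict_space)
qed

lemma piece_integrable:
  fixes \<alpha> :: "('x, 'n, real) form"
  assumes "(c, B) \<in> pieces" and \<alpha>: "form_on \<A> UNIV (2 * CARD('n)) \<alpha>"
  shows "set_integrable lborel (coord c ` B) (\<lambda>z. \<alpha> c (param c z) std_frame)"
proof -
  note cB = piecesD[OF assms(1)] and ch = chart_image[OF atlas piecesD(1)[OF assms(1)]]
  obtain K where K: "compact K" "B \<subseteq> K" "K \<subseteq> cdom c" using cB(3) by blast
  have "compact (coord c ` K)"
    by (rule compact_continuous_image[OF continuous_on_subset[OF homeomorphism_cont1[OF ch(3)] K(3)] K(1)])
  moreover have "continuous_on (coord c ` K) (\<lambda>z. \<alpha> c (param c z) std_frame)"
    using smooth_on_continuous[OF form_onD(2)[OF \<alpha> cB(1) length_std_frame]]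
    by (rule continuous_on_subset) (use K in auto)
  ultimately have "set_integrable lborel (coord c ` K) (\<lambda>z. \<alpha> c (param c z) std_frame)"
    unfolding set_integrable_def by (rule borel_integrable_compact)
  then show ?thesis
    by (rule set_integrable_subset) (use piece_measurable[OF assms(1)] K in auto)
qed

lemma form_integral_mult:
  fixes \<alpha> :: "('x, 'n, real) form"
  shows "form_integral \<A> (\<lambda>c p vs. r * \<alpha> c p vs) = r * form_integral \<A> \<alpha>"
proof -
  have "set_lebesgue_integral lborel S (\<lambda>z. r * f z) = r * set_lebesgue_integral lborel S f"
    for S and f :: "complex ^ 'n \<Rightarrow> real"
  proof -
    have "(\<lambda>z. indicat_real S z *\<^sub>R (r * f z)) = (\<lambda>z. r * (indicat_real S z *\<^sub>R f z))" by auto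
    then show ?thesis unfolding set_lebesgue_integral_def by (simp only: integral_mult_right_zero)
  qed
  then show ?thesis
    unfolding form_integral_eq by (simp add: sum_distrib_left case_prod_unfold)
qed

lemma form_integral_complex_combination:
  fixes \<alpha> :: "'i \<Rightarrow> ('x, 'n, real) form" and r :: "'i \<Rightarrow> complex"
  assumes "finite I" and "\<And>i. i \<in> I \<Longrightarrow> form_on \<A> UNIV (2 * CARD('n)) (\<alpha> i)"
  shows "form_integral \<A> (\<lambda>c p vs. \<Sum>i\<in>I. r i * complex_of_real (\<alpha> i c p vs)) =
    (\<Sum>i\<in>I. r i * complex_of_real (form_integral \<A> (\<alpha> i)))"
proof -
  have piece: "set_lebesgue_integral lborel (coord c ` B)
        (\<lambda>z. \<Sum>i\<in>I. r i * complex_of_real (\<alpha> i c (param c z) std_frame)) =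
      (\<Sum>i\<in>I. r i * complex_of_real (set_lebesgue_integral lborel (coord c ` B)
        (\<lambda>z. \<alpha> i c (param c z) std_frame)))" if "(c, B) \<in> pieces" for c B
  proof -
    have int: "integrable lborel (\<lambda>z. indicat_real (coord c ` B) z *\<^sub>R \<alpha> i c (param c z) std_frame)"
      if "i \<in> I" for i
      using piece_integrable[OF \<open>(c, B) \<in> pieces\<close> assms(2)[OF that]] by (simp add: set_integrable_def)
    have "set_lebesgue_integral lborel (coord c ` B)
        (\<lambda>z. \<Sum>i\<in>I. r i * complex_of_real (\<alpha> i c (param c z) std_frame)) =
      (CLINT z|lborel. \<Sum>i\<in>I. r i * complex_of_real
        (indicat_real (coord c ` B) z *\<^sub>R \<alpha> i c (param c z) std_frame))"
      unfolding set_lebesgue_integral_def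
      by (intro Bochner_Integration.integral_cong refl)
         (simp add: scaleR_conv_of_real sum_distrib_left mult_ac)
    also have "\<dots> = (\<Sum>i\<in>I. CLINT z|lborel. r i * complex_of_real
        (indicat_real (coord c ` B) z *\<^sub>R \<alpha> i c (param c z) std_frame))"
      by (rule Bochner_Integration.integral_sum) (intro integrable_mult_right integrable_of_real int)
    also have "\<dots> = (\<Sum>i\<in>I. r i * complex_of_real (LINT z|lborel.
        indicat_real (coord c ` B) z *\<^sub>R \<alpha> i c (param c z) std_frame))"
      by (simp only: integral_mult_right_zero integral_complex_of_real)
    finally show ?thesis unfolding set_lebesgue_integral_def .
  qed
  have "form_integral \<A> (\<lambda>c p vs. \<Sum>i\<in>I. r i * complex_of_real (\<alpha> i c p vs)) =
     (\<Sum>(c, B)\<in>pieces. \<Sum>i\<in>I. r i * complex_of_real (set_lebesgue_integral lborel (coord c ` B)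
        (\<lambda>z. \<alpha> i c (param c z) std_frame)))"
    unfolding form_integral_eq using piece by (intro sum.cong) auto
  also have "\<dots> = (\<Sum>i\<in>I. r i * complex_of_real (form_integral \<A> (\<alpha> i)))"
    unfolding form_integral_eq case_prod_unfold of_real_sum sum_distrib_left by (rule sum.swap)
  finally show ?thesis .
qed

text \<open>If the integral were zero, every piece would be a null set in its chart, and since coordinate
  changes map null sets to null sets, the image of a nonempty chart would be null although it is open.\<close>

lemma form_integral_positive:
  fixes \<alpha> :: "('x, 'n, real) form"
  assumes \<alpha>: "form_on \<A> UNIV (2 * CARD('n)) \<alpha>"
    and pos: "\<And>c p. c \<in> \<A> \<Longrightarrow> p \<in> cdom c \<Longrightarrow> \<alpha> c p std_frame > 0"
  shows "form_integral \<A> \<alpha> > 0"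
proof -
  define J where "J = (\<lambda>(c, B). set_lebesgue_integral lborel (coord c ` B) (\<lambda>z. \<alpha> c (param c z) std_frame))"
  have pos': "\<alpha> c (param c z) std_frame > 0" if "(c, B) \<in> pieces" "z \<in> coord c ` B" for c B z
    using that piecesD[OF that(1)] chart_image(5)[OF atlas] by (intro pos) blast+
  have nn: "J x \<ge> 0" if "x \<in> pieces" for x
  proof -
    obtain c B where x: "x = (c, B)" by fastforce
    show ?thesis unfolding x J_def set_lebesgue_integral_def
      using pos'[of c B] that x by (auto intro!: integral_nonneg_AE simp: indicator_def less_imp_le)
  qed
  have eq: "form_integral \<A> \<alpha> = sum J pieces" by (simp add: form_integral_eq J_def)
  have "sum J pieces \<noteq> 0"
  proof
    assume "sum J pieces = 0"
    then have J0: "J x = 0" if "x \<in> pieces" for x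
      using that nn sum_nonneg_eq_0_iff[OF finite_pieces, of J] by auto
    have negl: "negligible (coord c ` B)" if cB: "(c, B) \<in> pieces" for c B
    proof -
      have "AE z in lborel. indicat_real (coord c ` B) z *\<^sub>R \<alpha> c (param c z) std_frame = 0"
        using J0[OF cB] piece_integrable[OF cB \<alpha>] pos'[OF cB]
        by (subst integral_nonneg_eq_0_iff_AE[symmetric])
           (auto simp: J_def set_lebesgue_integral_def set_integrable_def indicator_def less_imp_le)
      then have "AE z in lborel. z \<notin> coord c ` B"
      proof eventually_elim
        case (elim z)
        then show ?case using pos'[OF cB, of z] by (auto simp: indicator_def split: if_splits)
      qed
      then have "coord c ` B \<in> null_sets lborel"
        using piece_measurable[OF cB] AE_iff_null_sets[of "coord c ` B" lborel] by simp
      then show ?thesis by (simp add: negligible_iff_null_sets null_sets_completionI)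
    qed
    fix p :: 'x
    define c0 where "c0 = chart_at \<A> p"
    have c0: "c0 \<in> \<A>" "p \<in> cdom c0" using chart_at[OF atlas] by (auto simp: c0_def)
    have "negligible ((coord c0 \<circ> param c) ` (coord c ` (B \<inter> cdom c0)))" if cB: "(c, B) \<in> pieces" for c B
    proof (rule negligible_differentiable_image_negligible)
      show "negligible (coord c ` (B \<inter> cdom c0))"
        using negl[OF cB] by (rule negligible_subset) auto
      have sm: "smooth_on (coord c ` (cdom c \<inter> cdom c0)) (coord c0 \<circ> param c)"
        using atlas piecesD(1)[OF cB] c0(1) unfolding complex_atlas_def by (elim conjE) simp
      show "(coord c0 \<circ> param c) differentiable_on coord c ` (B \<inter> cdom c0)"
        unfolding differentiable_on_def
      proof (rule ballI, rule differentiable_at_withinI)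
        fix z assume "z \<in> coord c ` (B \<inter> cdom c0)"
        moreover have "coord c ` (B \<inter> cdom c0) \<subseteq> coord c ` (cdom c \<inter> cdom c0)"
          using piecesD(4)[OF cB] by (intro image_mono) auto
        ultimately show "(coord c0 \<circ> param c) differentiable (at z)"
          using smooth_on_differentiable[OF sm] by (meson subsetD)
      qed
    qed simp
    then have "negligible (\<Union>x\<in>pieces. (coord c0 \<circ> param (fst x)) ` (coord (fst x) ` (snd x \<inter> cdom c0)))"
      using finite_pieces by (intro negligible_Union) (auto simp: split_paired_all)
    moreover have "coord c0 ` cdom c0 \<subseteq> (\<Union>x\<in>pieces. (coord c0 \<circ> param (fst x)) ` (coord (fst x) ` (snd x \<inter> cdom c0)))"
    proof
      fix z assume "z \<in> coord c0 ` cdom c0"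
      then obtain q where q: "q \<in> cdom c0" "z = coord c0 q" by auto
      have "q \<in> (\<Union>x\<in>pieces. snd x)" using pieces by (simp add: chart_decomposition_def)
      then obtain c B where cB: "(c, B) \<in> pieces" "q \<in> B" by auto
      have "param c (coord c q) = q"
        using cB piecesD[OF cB(1)] chart_image(4)[OF atlas] by blast
      then have "z = (coord c0 \<circ> param c) (coord c q)" using q by simp
      then have "z \<in> (coord c0 \<circ> param c) ` (coord c ` (B \<inter> cdom c0))" using cB q by blast
      then show "z \<in> (\<Union>x\<in>pieces. (coord c0 \<circ> param (fst x)) ` (coord (fst x) ` (snd x \<inter> cdom c0)))"
        using cB by force
    qed
    ultimately have "negligible (coord c0 ` cdom c0)" by (rule negligible_subset)
    then show False using open_not_negligible[OF chart_image(2)[OF atlas c0(1)]] c0(2) by blast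
  qed
  moreover have "sum J pieces \<ge> 0" using nn by (rule sum_nonneg)
  ultimately show ?thesis unfolding eq by simp
qed

end

section \<open>The phase for large radius\<close>

text \<open>Divided by \<open>t\<^sup>n [\<omega>]\<^sup>n\<close>, the integral of \<open>(t \<omega> - \<i> F)\<^sup>n\<close> is a polynomial in \<open>1 / t\<close> whose
  even coefficients are real and whose odd ones are imaginary. It starts with \<open>1 - \<i> c / t\<close>, so the next
  corrections to its real and imaginary part are of order \<open>t\<^sup>-\<^sup>2\<close> and \<open>t\<^sup>-\<^sup>3\<close>. The parity is what makes the
  error terms two orders smaller than the main ones.\<close>

lemma bigo_inverse_power_mono:
  "m \<le> k \<Longrightarrow> (\<lambda>t::real. inverse t ^ k) \<in> O(\<lambda>t. inverse t ^ m)"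
proof (rule bigoI[of _ 1])
  assume "m \<le> k"
  then show "\<forall>\<^sub>F t::real in at_top. norm (inverse t ^ k) \<le> 1 * norm (inverse t ^ m)"
    by (intro eventually_mono[OF eventually_ge_at_top[of 1]])
       (auto simp: norm_power intro!: power_decreasing le_imp_inverse_le[of 1, simplified])
qed

lemma bigo_inverse_power_sum:
  fixes a :: "nat \<Rightarrow> real"
  assumes "\<And>k. k \<in> K \<Longrightarrow> m \<le> k"
  shows "(\<lambda>t. \<Sum>k\<in>K. a k * inverse t ^ k) \<in> O(\<lambda>t. inverse t ^ m)"
proof (rule big_sum_in_bigo)
  fix k assume "k \<in> K"
  then show "(\<lambda>t. a k * inverse t ^ k) \<in> O(\<lambda>t. inverse t ^ m)"
    using bigo_inverse_power_mono[OF assms] by (cases "a k = 0") simp_all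
qed

lemma bigo_eventually_eq:
  fixes f g :: "real \<Rightarrow> real"
  assumes "g \<in> O(h)" "\<forall>\<^sub>F t in at_top. f t = g t"
  shows "f \<in> O(h)"
  using assms landau_o.big.in_cong by blast

lemma bigo_inverse_power_weaken:
  "f \<in> O(\<lambda>t::real. inverse t ^ k) \<Longrightarrow> m \<le> k \<Longrightarrow> f \<in> O(\<lambda>t. inverse t ^ m)"
  using bigo_inverse_power_mono landau_o.big.trans by blast

lemma bigo_inverse_power_mult:
  fixes f g :: "real \<Rightarrow> real"
  assumes "f \<in> O(\<lambda>t. inverse t ^ a)" "g \<in> O(\<lambda>t. inverse t ^ b)"
  shows "(\<lambda>t. f t * g t) \<in> O(\<lambda>t. inverse t ^ (a + b))"
  using landau_o.big.mult[OF assms] by (simp add: power_add)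

lemma inverse_sqrt_expansion:
  assumes "(s::real) \<ge> 0"
  shows "\<bar>1 / sqrt (1 + s) - 1 + s / 2\<bar> \<le> s\<^sup>2"
proof -
  define q where "q = sqrt (1 + s)"
  have q: "q \<ge> 1" "s = q\<^sup>2 - 1" using assms by (auto simp: q_def)
  have eq: "1 / q - 1 + s / 2 = (q - 1)\<^sup>2 * ((q + 2) / (2 * q))"
    using q(1) unfolding q(2) by (simp add: field_simps power2_eq_square)
  have "(q + 2) / (2 * q) \<le> (q + 1)\<^sup>2"
  proof -
    have "(q + 2) / (2 * q) \<le> 2\<^sup>2" using q(1) by (simp add: field_simps)
    also have "2\<^sup>2 \<le> (q + 1)\<^sup>2" using q(1) by (intro power_mono) auto
    finally show ?thesis .
  qed
  then have "(q - 1)\<^sup>2 * ((q + 2) / (2 * q)) \<le> (q - 1)\<^sup>2 * (q + 1)\<^sup>2"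
    by (intro mult_left_mono) auto
  also have "\<dots> = s\<^sup>2" unfolding q(2) by (simp add: power2_eq_square algebra_simps)
  finally show ?thesis unfolding q_def[symmetric] eq using q(1) by simp
qed

lemma neg_imag_power:
  "(- \<i>) ^ 0 = 1" "(- \<i>) ^ 1 = - \<i>" "(- \<i>) ^ 2 = - 1" "(- \<i>) ^ 3 = \<i>"
  by (auto simp: power2_eq_square power3_eq_cube)

text \<open>With \<open>u\<close> the tangent of the phase one has \<open>u = - c / t + O(t\<^sup>-\<^sup>3)\<close>, while the cosine is
  \<open>(1 + u\<^sup>2)\<^sup>-\<^sup>1\<^sup>/\<^sup>2\<close> and the sine is \<open>u\<close> times the cosine. Here \<open>Z t\<close> stands for the integral and \<open>w k\<close>
  for the integral of \<open>\<omega>\<^sup>n\<^sup>-\<^sup>k \<and> F\<^sup>k\<close>.\<close>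

lemma phase_asymptotics:
  fixes w :: "nat \<Rightarrow> real" and n :: nat and \<theta> :: "real \<Rightarrow> real"
  assumes n: "n \<ge> 1" and w0: "w 0 > 0" and c: "c = real n * w 1 / w 0"
    and Z: "\<And>t. t > 0 \<Longrightarrow> Z t = (\<Sum>k\<le>n. of_nat (n choose k) * (- \<i>) ^ k * of_real (t ^ (n - k) * w k))"
    and \<theta>: "\<And>t. Z t \<noteq> 0 \<Longrightarrow> \<exists>r>0. Z t = of_real r * exp (\<i> * of_real (\<theta> t))"
  shows "\<forall>\<^sub>F t in at_top. Z t \<noteq> 0"
    and "(\<lambda>t. cos (\<theta> t) - 1 + c\<^sup>2 / 2 * inverse t ^ 2) \<in> O(\<lambda>t. inverse t ^ 4)"
    and "(\<lambda>t. sin (\<theta> t) + c * inverse t) \<in> O(\<lambda>t. inverse t ^ 3)"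
proof -
  define x where "x t = (\<Sum>k\<le>n. Re ((- \<i>) ^ k) * (real (n choose k) * w k / w 0) * inverse t ^ k)" for t
  define y where "y t = (\<Sum>k\<le>n. Im ((- \<i>) ^ k) * (real (n choose k) * w k / w 0) * inverse t ^ k)" for t
  have Zxy: "Z t = of_real (t ^ n * w 0) * Complex (x t) (y t)" if "t > 0" for t
  proof -
    have "t ^ (n - k) = t ^ n * inverse t ^ k" if "k \<le> n" for k
      using \<open>t > 0\<close> that by (simp add: power_diff field_simps)
    then show ?thesis
      unfolding Z[OF that] x_def y_def complex_eq_iff using w0
      by (auto simp: sum_distrib_left field_simps intro!: sum.cong)
  qed
  have X: "(\<lambda>t. x t - 1) \<in> O(\<lambda>t. inverse t ^ 2)"
  proof -
    have "x t - 1 = (\<Sum>k\<in>{2..n}. Re ((- \<i>) ^ k) * (real (n choose k) * w k / w 0) * inverse t ^ k)" for t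
    proof -
      have "{..n} = {0, 1} \<union> {2..n}" using n by auto
      then show ?thesis unfolding x_def using w0 by (simp add: sum.union_disjoint)
    qed
    then show ?thesis by (simp only:) (rule bigo_inverse_power_sum, simp)
  qed
  have Y: "(\<lambda>t. y t + c * inverse t) \<in> O(\<lambda>t. inverse t ^ 3)"
  proof -
    have "y t + c * inverse t = (\<Sum>k\<in>{3..n}. Im ((- \<i>) ^ k) * (real (n choose k) * w k / w 0) * inverse t ^ k)" for t
    proof -
      have "y t = (\<Sum>k\<in>{0, 1, 2} \<union> {3..n}. Im ((- \<i>) ^ k) * (real (n choose k) * w k / w 0) * inverse t ^ k)"
        unfolding y_def using n by (intro sum.mono_neutral_left) (auto simp: binomial_eq_0)
      then show ?thesis unfolding c using w0 by (simp add: sum.union_disjoint)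
    qed
    then show ?thesis by (simp only:) (rule bigo_inverse_power_sum, simp)
  qed
  have lim0: "((\<lambda>t::real. inverse t ^ 2) \<longlongrightarrow> 0) at_top"
    using tendsto_power[OF tendsto_inverse_0_at_top[OF filterlim_ident], of 2] by simp
  have "((\<lambda>t. x t - 1) \<longlongrightarrow> 0) at_top"
  proof -
    obtain K where "\<forall>\<^sub>F t in at_top. norm (x t - 1) \<le> K * norm (inverse t ^ 2)"
      using X by (rule landau_o.bigE)
    then show ?thesis
      by (intro tendsto_0_le[OF lim0, of _ K]) (simp add: mult.commute)
  qed
  then have xlim: "(x \<longlongrightarrow> 1) at_top" using Lim_null by blast
  then have xpos: "\<forall>\<^sub>F t in at_top. x t > 1 / 2" by (rule order_tendstoD) simp
  define u where "u t = y t / x t" for t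
  show "\<forall>\<^sub>F t in at_top. Z t \<noteq> 0"
    using xpos eventually_gt_at_top[of 0]
    by eventually_elim (use w0 in \<open>simp add: Zxy complex_eq_iff\<close>)
  then have cs: "\<forall>\<^sub>F t in at_top. cos (\<theta> t) = 1 / sqrt (1 + (u t)\<^sup>2) \<and> sin (\<theta> t) = u t * cos (\<theta> t)"
    using xpos eventually_gt_at_top[of 0]
  proof eventually_elim
    case (elim t)
    obtain r where r: "r > 0" "Z t = of_real r * exp (\<i> * of_real (\<theta> t))" using \<theta>[OF elim(1)] by blast
    define m where "m = t ^ n * w 0 / r"
    have m: "m > 0" using r(1) w0 elim by (simp add: m_def)
    have "cos (\<theta> t) = m * x t" "sin (\<theta> t) = m * y t"
      using r Zxy[OF elim(3)] by (auto simp: complex_eq_iff m_def Re_exp Im_exp field_simps)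
    then have s: "sin (\<theta> t) = u t * cos (\<theta> t)" and cpos: "cos (\<theta> t) > 0"
      using elim m by (auto simp: u_def)
    have "(cos (\<theta> t))\<^sup>2 * (1 + (u t)\<^sup>2) = 1"
      using sin_cos_squared_add[of "\<theta> t"] unfolding s by (simp add: algebra_simps power_mult_distrib)
    moreover have "1 + (u t)\<^sup>2 > 0" by (simp add: add_pos_nonneg)
    ultimately have "(cos (\<theta> t))\<^sup>2 = 1 / (1 + (u t)\<^sup>2)" by (simp add: eq_divide_eq)
    then have "(cos (\<theta> t))\<^sup>2 = (1 / sqrt (1 + (u t)\<^sup>2))\<^sup>2"
      using \<open>1 + (u t)\<^sup>2 > 0\<close> by (simp add: power_divide)
    then have "cos (\<theta> t) = 1 / sqrt (1 + (u t)\<^sup>2)"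
      by (rule power2_eq_imp_eq) (use cpos \<open>1 + (u t)\<^sup>2 > 0\<close> in simp_all)
    then show ?case using s by simp
  qed
  have invx: "(\<lambda>t. 1 / x t) \<in> O(\<lambda>t. inverse t ^ 0)"
    using xpos by (intro bigoI[of _ 2]) (auto elim!: eventually_mono simp: field_simps)
  have u1: "(\<lambda>t. u t + c * inverse t) \<in> O(\<lambda>t. inverse t ^ 3)"
  proof -
    have "(\<lambda>t. (y t + c * inverse t) * (1 / x t)) \<in> O(\<lambda>t. inverse t ^ (3 + 0))"
      by (rule bigo_inverse_power_mult[OF Y invx])
    moreover have "(\<lambda>t. c * inverse t ^ 1 * ((x t - 1) * (1 / x t))) \<in> O(\<lambda>t. inverse t ^ (1 + (2 + 0)))"
      by (intro bigo_inverse_power_mult X invx) simp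
    ultimately have *: "(\<lambda>t. (y t + c * inverse t) * (1 / x t) + c * inverse t ^ 1 * ((x t - 1) * (1 / x t)))
        \<in> O(\<lambda>t. inverse t ^ 3)"
      by (intro sum_in_bigo) (simp_all add: numeral_3_eq_3)
    have alg: "b / a + d = (b + d) * (1 / a) + d * ((a - 1) * (1 / a))" if "a \<noteq> 0" for a b d :: real
      using that by (simp add: field_simps)
    show ?thesis
    proof (rule bigo_eventually_eq[OF *])
      show "\<forall>\<^sub>F t in at_top. u t + c * inverse t =
          (y t + c * inverse t) * (1 / x t) + c * inverse t ^ 1 * ((x t - 1) * (1 / x t))"
        using xpos
      proof eventually_elim
        case (elim t)
        show ?case unfolding u_def power_one_right using elim by (intro alg) simp
      qed
    qed
  qed
  have u0: "u \<in> O(\<lambda>t. inverse t ^ 1)"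
  proof -
    have "(\<lambda>t. (u t + c * inverse t) - c * inverse t) \<in> O(\<lambda>t. inverse t ^ 1)"
      by (intro sum_in_bigo bigo_inverse_power_weaken[OF u1]) auto
    then show ?thesis by simp
  qed
  have u2: "(\<lambda>t. (u t)\<^sup>2 - c\<^sup>2 * inverse t ^ 2) \<in> O(\<lambda>t. inverse t ^ 4)"
  proof -
    have "(\<lambda>t. u t - c * inverse t) \<in> O(\<lambda>t. inverse t ^ 1)"
      by (intro sum_in_bigo u0) auto
    from bigo_inverse_power_mult[OF this u1]
    show ?thesis by (simp add: power2_eq_square algebra_simps)
  qed
  show C: "(\<lambda>t. cos (\<theta> t) - 1 + c\<^sup>2 / 2 * inverse t ^ 2) \<in> O(\<lambda>t. inverse t ^ 4)"
  proof -
    have "(\<lambda>t. 1 / sqrt (1 + (u t)\<^sup>2) - 1 + (u t)\<^sup>2 / 2) \<in> O(\<lambda>t. (u t)\<^sup>2 * (u t)\<^sup>2)"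
      using inverse_sqrt_expansion[OF zero_le_power2]
      by (intro bigoI[of _ 1] always_eventually) (auto simp: power2_eq_square abs_mult)
    also have "(\<lambda>t. (u t)\<^sup>2 * (u t)\<^sup>2) \<in> O(\<lambda>t. inverse t ^ ((1 + 1) + (1 + 1)))"
      unfolding power2_eq_square by (intro bigo_inverse_power_mult u0)
    finally have "(\<lambda>t. 1 / sqrt (1 + (u t)\<^sup>2) - 1 + (u t)\<^sup>2 / 2) \<in> O(\<lambda>t. inverse t ^ 4)"
      by (simp add: power4_eq_xxxx mult.assoc)
    moreover have "(\<lambda>t. 1 / 2 * ((u t)\<^sup>2 - c\<^sup>2 * inverse t ^ 2)) \<in> O(\<lambda>t. inverse t ^ 4)"
      using u2 by simp
    ultimately have *: "(\<lambda>t. (1 / sqrt (1 + (u t)\<^sup>2) - 1 + (u t)\<^sup>2 / 2) - 1 / 2 * ((u t)\<^sup>2 - c\<^sup>2 * inverse t ^ 2))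
        \<in> O(\<lambda>t. inverse t ^ 4)"
      by (rule sum_in_bigo(2))
    show ?thesis
      by (rule bigo_eventually_eq[OF *])
         (use cs in \<open>eventually_elim, simp add: field_simps\<close>)
  qed
  have C0: "(\<lambda>t. cos (\<theta> t) - 1) \<in> O(\<lambda>t. inverse t ^ 2)"
  proof -
    have "(\<lambda>t. (cos (\<theta> t) - 1 + c\<^sup>2 / 2 * inverse t ^ 2) - c\<^sup>2 / 2 * inverse t ^ 2) \<in> O(\<lambda>t. inverse t ^ 2)"
      by (intro sum_in_bigo bigo_inverse_power_weaken[OF C]) auto
    then show ?thesis by simp
  qed
  have *: "(\<lambda>t. (u t + c * inverse t) + u t * (cos (\<theta> t) - 1)) \<in> O(\<lambda>t. inverse t ^ 3)"
  proof (rule sum_in_bigo(1)[OF u1])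
    show "(\<lambda>t. u t * (cos (\<theta> t) - 1)) \<in> O(\<lambda>t. inverse t ^ 3)"
      using bigo_inverse_power_mult[OF u0 C0] by (simp add: numeral_3_eq_3)
  qed
  show "(\<lambda>t. sin (\<theta> t) + c * inverse t) \<in> O(\<lambda>t. inverse t ^ 3)"
    by (rule bigo_eventually_eq[OF *])
       (use cs in \<open>eventually_elim, simp add: algebra_simps\<close>)
qed

lemma rotated_power_Re_Im:
  "Im (exp (- \<i> * of_real \<theta>) * (- \<i>) ^ 0) = - sin \<theta>" "Re (exp (- \<i> * of_real \<theta>) * (- \<i>) ^ 0) = cos \<theta>"
  "Im (exp (- \<i> * of_real \<theta>) * (- \<i>) ^ 1) = - cos \<theta>" "Re (exp (- \<i> * of_real \<theta>) * (- \<i>) ^ 1) = - sin \<theta>"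
  "Im (exp (- \<i> * of_real \<theta>) * (- \<i>) ^ 2) = sin \<theta>" "Re (exp (- \<i> * of_real \<theta>) * (- \<i>) ^ 2) = - cos \<theta>"
  "Re (exp (- \<i> * of_real \<theta>) * (- \<i>) ^ 3) = sin \<theta>"
  unfolding neg_imag_power by (auto simp: Re_exp Im_exp)

lemma rotated_power_bounded:
  "\<bar>Im (exp (- \<i> * of_real \<theta>) * (- \<i>) ^ k)\<bar> \<le> 1" "\<bar>Re (exp (- \<i> * of_real \<theta>) * (- \<i>) ^ k)\<bar> \<le> 1"
proof -
  have "cmod (exp (- \<i> * of_real \<theta>) * (- \<i>) ^ k) = 1" by (simp add: norm_mult norm_power)
  then show "\<bar>Im (exp (- \<i> * of_real \<theta>) * (- \<i>) ^ k)\<bar> \<le> 1" "\<bar>Re (exp (- \<i> * of_real \<theta>) * (- \<i>) ^ k)\<bar> \<le> 1"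
    using abs_Im_le_cmod abs_Re_le_cmod by metis+
qed

text \<open>The factors of \<open>t\<^sup>n\<^sup>-\<^sup>k \<omega>\<^sup>n\<^sup>-\<^sup>k \<and> F\<^sup>k\<close> in the imaginary and the real part of
  \<open>e\<^sup>-\<^sup>\<i>\<^sup>\<theta> (t \<omega> - \<i> F)\<^sup>n\<close>.\<close>

definition im_coeff :: "nat \<Rightarrow> real \<Rightarrow> nat \<Rightarrow> real" where
  "im_coeff n \<theta> k = real (n choose k) * Im (exp (- \<i> * of_real \<theta>) * (- \<i>) ^ k)"

definition re_coeff :: "nat \<Rightarrow> real \<Rightarrow> nat \<Rightarrow> real" where
  "re_coeff n \<theta> k = real (n choose k) * Re (exp (- \<i> * of_real \<theta>) * (- \<i>) ^ k)"

text \<open>The main part of the imaginary part has degree \<open>n - 1\<close> in \<open>t\<close>; that of the real part consists of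
  \<open>t\<^sup>n \<omega>\<^sup>n\<close> and of terms of degree \<open>n - 2\<close>.\<close>

definition im_main_coeff :: "real \<Rightarrow> nat \<Rightarrow> nat \<Rightarrow> real" where
  "im_main_coeff c n k = (if k = 0 then c else if k = 1 then - real n else 0)"

definition re_main_coeff :: "real \<Rightarrow> nat \<Rightarrow> nat \<Rightarrow> real" where
  "re_main_coeff c n k = (if k = 0 then - (c\<^sup>2 / 2) else if k = 1 then c * real n
     else if k = 2 then - (real n * (real n - 1) / 2) else 0)"

lemma nat_cases_4:
  obtains "k = 0" | "k = 1" | "k = 2" | "k = 3" | "(k::nat) \<ge> 4"
  by linarith

lemma coefficient_asymptotics:
  assumes C: "(\<lambda>t. cos (\<theta> t) - 1 + c\<^sup>2 / 2 * inverse t ^ 2) \<in> O(\<lambda>t. inverse t ^ 4)"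
    and S: "(\<lambda>t. sin (\<theta> t) + c * inverse t) \<in> O(\<lambda>t. inverse t ^ 3)"
  shows "(\<lambda>t. im_coeff n (\<theta> t) k * inverse t ^ k - im_main_coeff c n k * inverse t) \<in> O(\<lambda>t. inverse t ^ 3)"
    and "(\<lambda>t. re_coeff n (\<theta> t) k * inverse t ^ k - ((if k = 0 then 1 else 0)
      + re_main_coeff c n k * inverse t ^ 2)) \<in> O(\<lambda>t. inverse t ^ 4)"
proof -
  have S0: "(\<lambda>t. sin (\<theta> t)) \<in> O(\<lambda>t. inverse t ^ 1)"
  proof -
    have "(\<lambda>t. (sin (\<theta> t) + c * inverse t) - c * inverse t) \<in> O(\<lambda>t. inverse t ^ 1)"
      by (intro sum_in_bigo bigo_inverse_power_weaken[OF S]) auto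
    then show ?thesis by simp
  qed
  have C0: "(\<lambda>t. cos (\<theta> t) - 1) \<in> O(\<lambda>t. inverse t ^ 2)"
  proof -
    have "(\<lambda>t. (cos (\<theta> t) - 1 + c\<^sup>2 / 2 * inverse t ^ 2) - c\<^sup>2 / 2 * inverse t ^ 2) \<in> O(\<lambda>t. inverse t ^ 2)"
      by (intro sum_in_bigo bigo_inverse_power_weaken[OF C]) auto
    then show ?thesis by simp
  qed
  have E: "(\<lambda>t::real. a * inverse t ^ m) \<in> O(\<lambda>t. inverse t ^ m)" for a m by simp
  have n2: "real (n choose 2) = real n * (real n - 1) / 2"
    by (simp add: choose_two real_of_nat_div algebra_simps of_nat_diff)
  have I: "(\<lambda>t. im_coeff n (\<theta> t) k) \<in> O(\<lambda>t. inverse t ^ 0)"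
    and R: "(\<lambda>t. re_coeff n (\<theta> t) k) \<in> O(\<lambda>t. inverse t ^ 0)"
  proof -
    have "\<bar>im_coeff n x k\<bar> \<le> real (n choose k)" "\<bar>re_coeff n x k\<bar> \<le> real (n choose k)" for x
      unfolding im_coeff_def re_coeff_def abs_mult abs_of_nat
      by (rule mult_left_le[OF rotated_power_bounded(1)], simp)
         (rule mult_left_le[OF rotated_power_bounded(2)], simp)
    then show "(\<lambda>t. im_coeff n (\<theta> t) k) \<in> O(\<lambda>t. inverse t ^ 0)"
      "(\<lambda>t. re_coeff n (\<theta> t) k) \<in> O(\<lambda>t. inverse t ^ 0)"
      by (auto intro!: bigoI[of _ "real (n choose k)"] always_eventually)
  qed
  note eval = im_coeff_def re_coeff_def im_main_coeff_def re_main_coeff_def rotated_power_Re_Im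
  show "(\<lambda>t. im_coeff n (\<theta> t) k * inverse t ^ k - im_main_coeff c n k * inverse t) \<in> O(\<lambda>t. inverse t ^ 3)"
  proof (cases k rule: nat_cases_4)
    case 1
    have "(\<lambda>t. - (sin (\<theta> t) + c * inverse t)) \<in> O(\<lambda>t. inverse t ^ 3)"
      using S by (simp only: landau_o.big.uminus_in_iff)
    then show ?thesis unfolding 1 eval by (simp add: algebra_simps)
  next
    case 2
    have "(\<lambda>t. (- real n * inverse t ^ 1) * (cos (\<theta> t) - 1)) \<in> O(\<lambda>t. inverse t ^ (1 + 2))"
      by (rule bigo_inverse_power_mult[OF E C0])
    then show ?thesis unfolding 2 eval by (simp add: algebra_simps power3_eq_cube)
  next
    case 3
    have "(\<lambda>t. (real (n choose 2) * inverse t ^ 2) * sin (\<theta> t)) \<in> O(\<lambda>t. inverse t ^ (2 + 1))"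
      by (rule bigo_inverse_power_mult[OF E S0])
    then show ?thesis unfolding 3 eval by (simp add: mult_ac)
  next
    case 4
    have "(\<lambda>t. im_coeff n (\<theta> t) k * inverse t ^ k) \<in> O(\<lambda>t. inverse t ^ (0 + 3))"
      by (rule bigo_inverse_power_mult[OF I bigo_inverse_power_mono]) (simp add: 4)
    then show ?thesis using 4 by (simp add: im_main_coeff_def)
  next
    case 5
    have "(\<lambda>t. im_coeff n (\<theta> t) k * inverse t ^ k) \<in> O(\<lambda>t. inverse t ^ (0 + 3))"
      by (rule bigo_inverse_power_mult[OF I bigo_inverse_power_mono]) (use 5 in simp)
    then show ?thesis using 5 by (simp add: im_main_coeff_def)
  qed
  show "(\<lambda>t. re_coeff n (\<theta> t) k * inverse t ^ k - ((if k = 0 then 1 else 0)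
      + re_main_coeff c n k * inverse t ^ 2)) \<in> O(\<lambda>t. inverse t ^ 4)"
  proof (cases k rule: nat_cases_4)
    case 1
    show ?thesis using C unfolding 1 eval by (simp add: algebra_simps)
  next
    case 2
    have "(\<lambda>t. (- real n * inverse t ^ 1) * (sin (\<theta> t) + c * inverse t)) \<in> O(\<lambda>t. inverse t ^ (1 + 3))"
      by (rule bigo_inverse_power_mult[OF E S])
    then show ?thesis unfolding 2 eval by (simp add: algebra_simps power2_eq_square)
  next
    case 3
    have "(\<lambda>t. (- real (n choose 2) * inverse t ^ 2) * (cos (\<theta> t) - 1)) \<in> O(\<lambda>t. inverse t ^ (2 + 2))"
      by (rule bigo_inverse_power_mult[OF E C0])
    then show ?thesis unfolding 3 eval n2[symmetric] by (simp add: algebra_simps)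
  next
    case 4
    have "(\<lambda>t. (real (n choose 3) * inverse t ^ 3) * sin (\<theta> t)) \<in> O(\<lambda>t. inverse t ^ (3 + 1))"
      by (rule bigo_inverse_power_mult[OF E S0])
    then show ?thesis unfolding 4 eval by (simp add: mult_ac)
  next
    case 5
    have "(\<lambda>t. re_coeff n (\<theta> t) k * inverse t ^ k) \<in> O(\<lambda>t. inverse t ^ (0 + 4))"
      by (rule bigo_inverse_power_mult[OF R bigo_inverse_power_mono]) (use 5 in simp)
    then show ?thesis using 5 by (simp add: re_main_coeff_def)
  qed
qed

section \<open>Combinations of forms with coefficients depending on the radius\<close>

lemma wedge2_cong:
  assumes "length bs = length cs"
    "\<And>i xs. i < length cs \<Longrightarrow> length xs = 2 \<Longrightarrow> (bs ! i) xs = (cs ! i) xs"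
  shows "wedge2 bs vs = wedge2 cs vs"
  using assms by (simp add: wedge2_def)

lemma wedge2_scaled:
  fixes rbs :: "('k::real_field \<times> ('v list \<Rightarrow> real)) list"
  shows "wedge2 (map (\<lambda>(r, b) xs. r * of_real (b xs)) rbs) vs =
    prod_list (map fst rbs) * of_real (wedge2 (map snd rbs) vs)"
proof (cases "length vs = 2 * length rbs")
  case True
  have "prod_list (map fst rbs) = (\<Prod>i<length rbs. fst (rbs ! i))"
    by (simp add: prod.list_conv_set_nth lessThan_atLeast0)
  moreover have "(\<Prod>i<length rbs. (map (\<lambda>(r, b) xs. r * of_real (b xs)) rbs ! i) [vs ! \<sigma> (2 * i), vs ! \<sigma> (2 * i + 1)])
     = (\<Prod>i<length rbs. fst (rbs ! i)) *
       of_real (\<Prod>i<length rbs. (map snd rbs ! i) [vs ! \<sigma> (2 * i), vs ! \<sigma> (2 * i + 1)])" for \<sigma>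
    unfolding of_real_prod prod.distrib[symmetric]
    by (intro prod.cong) (auto simp: case_prod_unfold)
  ultimately show ?thesis
    using True by (simp add: wedge2_def sum_distrib_left mult_ac)
next
  case False
  then show ?thesis by (simp add: wedge2_def)
qed

lemma wedge_forms_form_on:
  fixes \<beta>s :: "('x::topological_space, 'n::finite, real) form list"
  assumes atlas: "complex_atlas \<A>" and \<beta>s: "\<And>\<beta>. \<beta> \<in> set \<beta>s \<Longrightarrow> form_on \<A> UNIV 2 \<beta>"
    and d: "d = 2 * length \<beta>s"
  shows "form_on \<A> UNIV d (wedge_forms \<beta>s)"
  unfolding form_on_def Int_UNIV_right
proof (intro conjI ballI allI impI)
  fix c p assume cp: "c \<in> \<A>" "p \<in> cdom c"
  show "alternating d (wedge_forms \<beta>s c p)"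
    unfolding wedge_forms_def using form_onD(1)[OF \<beta>s cp] d by (intro wedge2_alternating) auto
next
  fix c and vs :: "(complex ^ 'n) list" assume c: "c \<in> \<A>" and vs: "length vs = d"
  define U where "U = coord c ` cdom c"
  have U: "open U" unfolding U_def using chart_image(2)[OF atlas c] .
  have "smooth_on U (\<lambda>z. (\<Sum>\<sigma> | \<sigma> permutes {..<2 * length \<beta>s}. of_int (sign \<sigma>) *
         (\<Prod>i<length \<beta>s. (\<beta>s ! i) c (param c z) [vs ! \<sigma> (2 * i), vs ! \<sigma> (2 * i + 1)])) * (1 / 2 ^ length \<beta>s))"
    unfolding U_def
    by (intro smooth_on_mult smooth_on_sum smooth_on_prod U[unfolded U_def] smooth_on_const
      form_onD(2)[OF \<beta>s c]) auto
  moreover have "(\<lambda>z. wedge_forms \<beta>s c (param c z) vs) =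
      (\<lambda>z. (\<Sum>\<sigma> | \<sigma> permutes {..<2 * length \<beta>s}. of_int (sign \<sigma>) *
         (\<Prod>i<length \<beta>s. (\<beta>s ! i) c (param c z) [vs ! \<sigma> (2 * i), vs ! \<sigma> (2 * i + 1)])) * (1 / 2 ^ length \<beta>s))"
    using vs d by (simp add: wedge_forms_def wedge2_def)
  ultimately show "smooth_on (coord c ` cdom c) (\<lambda>z. wedge_forms \<beta>s c (param c z) vs)"
    by (simp only: U_def)
next
  fix c c' p and vs :: "(complex ^ 'n) list"
  assume c: "c \<in> \<A>" "c' \<in> \<A>" "p \<in> cdom c \<inter> cdom c'" and vs: "length vs = d"
  have "(\<beta>s ! i) c p [vs ! \<sigma> (2 * i), vs ! \<sigma> (2 * i + 1)] =
     (\<beta>s ! i) c' p [map (trans_diff c c' p) vs ! \<sigma> (2 * i), map (trans_diff c c' p) vs ! \<sigma> (2 * i + 1)]"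
    if "\<sigma> permutes {..<2 * length \<beta>s}" "i < length \<beta>s" for \<sigma> i
  proof -
    have "(\<beta>s ! i) c p [vs ! \<sigma> (2 * i), vs ! \<sigma> (2 * i + 1)] =
       (\<beta>s ! i) c' p (map (trans_diff c c' p) [vs ! \<sigma> (2 * i), vs ! \<sigma> (2 * i + 1)])"
      using c that by (intro form_onD(3)[OF \<beta>s]) auto
    then show ?thesis using permutes_pair_less[OF that] vs d by simp
  qed
  then show "wedge_forms \<beta>s c p vs = wedge_forms \<beta>s c' p (map (trans_diff c c' p) vs)"
    unfolding wedge_forms_def wedge2_def by (auto intro!: sum.cong prod.cong)
qed

lemma form_on_combination:
  fixes B :: "'i \<Rightarrow> ('x::topological_space, 'n::finite, real) form"
  assumes atlas: "complex_atlas \<A>" and B: "\<And>k. k \<in> K \<Longrightarrow> form_on \<A> UNIV d (B k)"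
  shows "form_on \<A> UNIV d (\<lambda>c p vs. \<Sum>k\<in>K. r k * B k c p vs)"
  unfolding form_on_def Int_UNIV_right
proof (intro conjI ballI allI impI)
  fix c p assume cp: "c \<in> \<A>" "p \<in> cdom c"
  have "alternating d (\<lambda>vs. \<Sum>k\<in>K. r k *\<^sub>R B k c p vs)"
    using form_onD(1)[OF B cp] unfolding alternating_def
    by (intro conjI allI impI linear_compose_sum ballI linear_compose_scale_right) (auto intro!: sum.neutral)
  then show "alternating d (\<lambda>vs. \<Sum>k\<in>K. r k * B k c p vs)" by simp
next
  fix c and vs :: "(complex ^ 'n) list" assume c: "c \<in> \<A>" and vs: "length vs = d"
  show "smooth_on (coord c ` cdom c) (\<lambda>z. \<Sum>k\<in>K. r k * B k c (param c z) vs)"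
    using form_onD(2)[OF B c vs] chart_image(2)[OF atlas c]
    by (intro smooth_on_sum smooth_on_mult) auto
next
  fix c c' p and vs :: "(complex ^ 'n) list"
  assume "c \<in> \<A>" "c' \<in> \<A>" "p \<in> cdom c \<inter> cdom c'" "length vs = d"
  then show "(\<Sum>k\<in>K. r k * B k c p vs) = (\<Sum>k\<in>K. r k * B k c' p (map (trans_diff c c' p) vs))"
    by (intro sum.cong refl arg_cong2[where f = "(*)"] form_onD(3)[OF B]) auto
qed

lemma form_bigo_combination:
  fixes B :: "'i \<Rightarrow> ('x::topological_space, 'n::finite, real) form" and r :: "real \<Rightarrow> 'i \<Rightarrow> real"
  assumes atlas: "complex_atlas \<A>" and fin: "finite I" and B: "\<And>k. k \<in> I \<Longrightarrow> form_on \<A> UNIV d (B k)"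
    and r: "\<And>k. k \<in> I \<Longrightarrow> \<exists>C. \<forall>\<^sub>F t in at_top. \<bar>r t k\<bar> \<le> C * t powi m"
  shows "form_bigo \<A> d m (\<lambda>t c p vs. \<Sum>k\<in>I. r t k * B k c p vs)"
  unfolding form_bigo_def
proof (intro conjI ballI allI impI)
  show "form_on \<A> UNIV d (\<lambda>c p vs. \<Sum>k\<in>I. r t k * B k c p vs)" for t
    by (rule form_on_combination[OF atlas B])
  fix c K and vs ws :: "(complex ^ 'n) list"
  assume c: "c \<in> \<A>" and *: "compact K \<and> K \<subseteq> coord c ` cdom c \<and> length vs = d"
  note op = chart_image(2)[OF atlas c]
  define f where "f t = iter_pd ws (\<lambda>y. \<Sum>k\<in>I. r t k * B k c (param c y) vs)" for t
  define D where "D k = iter_pd ws (\<lambda>z. B k c (param c z) vs)" for k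
  have smooth: "smooth_on (coord c ` cdom c) (\<lambda>z. B k c (param c z) vs)" if "k \<in> I" for k
    using form_onD(2)[OF B[OF that] c] * by blast
  have "\<exists>M. \<forall>z\<in>K. \<bar>D k z\<bar> \<le> M" if "k \<in> I" for k
  proof -
    have "continuous_on (coord c ` cdom c) (D k)"
      unfolding D_def by (intro smooth_on_continuous smooth_on_iter_pd smooth[OF that])
    then have "compact (D k ` K)"
      using * by (intro compact_continuous_image) (auto intro: continuous_on_subset)
    then obtain M where "\<forall>x\<in>D k ` K. norm x \<le> M" using compact_imp_bounded bounded_iff by metis
    then show ?thesis by auto
  qed
  then obtain M where M: "\<And>k z. k \<in> I \<Longrightarrow> z \<in> K \<Longrightarrow> \<bar>D k z\<bar> \<le> M k" by metis
  obtain C where C: "\<And>k. k \<in> I \<Longrightarrow> \<forall>\<^sub>F t in at_top. \<bar>r t k\<bar> \<le> C k * t powi m" using r by metis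
  have "\<forall>\<^sub>F t in at_top. \<forall>k\<in>I. \<bar>r t k\<bar> \<le> C k * t powi m"
    using C fin by (simp add: eventually_ball_finite)
  then have "\<forall>\<^sub>F t in at_top. \<forall>z\<in>K. norm (f t z) \<le> (\<Sum>k\<in>I. C k * M k) * t powi m"
  proof eventually_elim
    case (elim t)
    show ?case
    proof
      fix z assume z: "z \<in> K"
      have "f t z = (\<Sum>k\<in>I. r t k * D k z)"
        unfolding f_def D_def using z * by (intro iter_pd_linear_combination[OF op fin smooth]) auto
      also have "\<bar>\<dots>\<bar> \<le> (\<Sum>k\<in>I. \<bar>r t k * D k z\<bar>)" by (rule sum_abs)
      also have "\<dots> \<le> (\<Sum>k\<in>I. (C k * t powi m) * M k)"
      proof (rule sum_mono)
        fix k assume k: "k \<in> I"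
        have "\<bar>r t k\<bar> \<le> C k * t powi m" using elim k by blast
        then show "\<bar>r t k * D k z\<bar> \<le> (C k * t powi m) * M k"
          unfolding abs_mult using M[OF k z] by (intro mult_mono) auto
      qed
      also have "\<dots> = (\<Sum>k\<in>I. C k * M k) * t powi m"
        by (simp add: sum_distrib_left mult_ac)
      finally show "norm (f t z) \<le> (\<Sum>k\<in>I. C k * M k) * t powi m"
        by simp
    qed
  qed
  then show "\<exists>C. \<forall>\<^sub>F t in at_top. \<forall>z\<in>K.
      norm (iter_pd ws (\<lambda>y. \<Sum>k\<in>I. r t k * B k c (param c y) vs) z) \<le> C * t powi m"
    unfolding f_def by blast
qed

lemma powi_bound_weaken:
  fixes f :: "real \<Rightarrow> real"
  assumes "\<exists>C. \<forall>\<^sub>F t in at_top. \<bar>f t\<bar> \<le> C * t powi l" "l \<le> m"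
  shows "\<exists>C. \<forall>\<^sub>F t in at_top. \<bar>f t\<bar> \<le> C * t powi m"
proof -
  obtain C where C: "\<forall>\<^sub>F t in at_top. \<bar>f t\<bar> \<le> C * t powi l" using assms(1) by blast
  then have "\<forall>\<^sub>F t in at_top. \<bar>f t\<bar> \<le> \<bar>C\<bar> * t powi m"
    using eventually_ge_at_top[of 1]
  proof eventually_elim
    case (elim t)
    have "C * t powi l \<le> \<bar>C\<bar> * t powi l" using elim(2) by (intro mult_right_mono) auto
    also have "\<dots> \<le> \<bar>C\<bar> * t powi m" using elim(2) assms(2) by (intro mult_left_mono power_int_increasing) auto
    finally show ?case using elim(1) by linarith
  qed
  then show ?thesis by blast
qed

section \<open>Volume, ratios and contraction on a Kaehler manifold\<close>

locale kaehler_with_form =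
  fixes \<A> :: "('x::t2_space, 'n::finite) chart set" and \<omega> F :: "('x, 'n, real) form"
  assumes compact_space: "compact (UNIV :: 'x set)" and atlas: "complex_atlas \<A>"
    and kaehler: "kaehler_form \<A> \<omega>" and form_F: "form_on \<A> UNIV 2 F"
begin

text \<open>The form \<open>\<omega>\<^sup>n\<^sup>-\<^sup>k \<and> F\<^sup>k\<close>, for \<^term>\<open>k \<le> CARD('n)\<close>.\<close>

definition mixed_power :: "nat \<Rightarrow> ('x, 'n, real) form" where
  "mixed_power k = wedge_forms (replicate (CARD('n) - k) \<omega> @ replicate k F)"

lemma dim_pos: "CARD('n) \<ge> 1" using zero_less_card_finite[where 'a = 'n] by linarith

lemma mixed_power_0: "mixed_power 0 = form_power \<omega>"
  by (simp add: mixed_power_def form_power_def)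

lemma mixed_power_1: "mixed_power 1 = wedge_F \<omega> F"
  by (simp add: mixed_power_def wedge_F_def)

lemma mixed_power_2: "mixed_power 2 = wedge_FF \<omega> F"
  by (simp add: mixed_power_def wedge_FF_def numeral_2_eq_2)

lemma form_\<omega>: "form_on \<A> UNIV 2 \<omega>" using kaehler by (simp add: kaehler_form_def)

lemma mixed_power_form: "k \<le> CARD('n) \<Longrightarrow> form_on \<A> UNIV (2 * CARD('n)) (mixed_power k)"
  unfolding mixed_power_def using form_\<omega> form_F by (intro wedge_forms_form_on atlas) auto

lemma positive_\<omega>: "c \<in> \<A> \<Longrightarrow> p \<in> cdom c \<Longrightarrow> positive_11 (\<omega> c p)"
  unfolding positive_11_def using kaehler form_onD(1)[OF form_\<omega>] by (simp add: kaehler_form_def)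

lemma form_power_eq: "form_power \<omega> c p = wedge2 (replicate CARD('n) (\<omega> c p))"
  by (simp add: form_power_def wedge_forms_def)

lemma form_power_positive: "c \<in> \<A> \<Longrightarrow> p \<in> cdom c \<Longrightarrow> form_power \<omega> c p std_frame > 0"
  unfolding form_power_eq by (rule wedge2_power_positive[OF positive_\<omega>])

lemma form_power_form: "form_on \<A> UNIV (2 * CARD('n)) (form_power \<omega>)"
  using mixed_power_form[of 0] by (simp add: mixed_power_0)

lemma volume_positive: "form_integral \<A> (form_power \<omega>) > 0"
  using form_power_form form_power_positive by (intro form_integral_positive[OF compact_space atlas])

lemma form_power_fscale:
  "length vs = 2 * CARD('n) \<Longrightarrow> form_power (fscale t \<omega>) c p vs = t ^ CARD('n) * form_power \<omega> c p vs"
  using wedge2_scaled[of "replicate CARD('n) (t, \<omega> c p)" vs]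
  by (simp add: form_power_def wedge_forms_def fscale_def[abs_def] prod_list_replicate)

text \<open>Top-degree forms at a point are proportional, so their ratio can be computed in any chart; read in a
  fixed chart it is visibly smooth.\<close>

lemma form_ratio_chart:
  assumes \<beta>: "form_on \<A> UNIV (2 * CARD('n)) \<beta>" and c: "c \<in> \<A>" "p \<in> cdom c"
  shows "form_ratio \<A> \<beta> (form_power \<omega>) p = \<beta> c p std_frame / form_power \<omega> c p std_frame"
proof -
  define c0 where "c0 = chart_at \<A> p"
  have c0: "c0 \<in> \<A>" "p \<in> cdom c0" using chart_at[OF atlas] by (auto simp: c0_def)
  define vs where "vs = map (trans_diff c0 c p) std_frame"
  have "\<beta> c0 p std_frame = \<beta> c p vs" "form_power \<omega> c0 p std_frame = form_power \<omega> c p vs"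
    unfolding vs_def
    by (rule form_onD(3)[OF _ c0(1) c(1) c0(2) c(2) length_std_frame], rule \<beta> form_power_form)+
  moreover have "\<beta> c p vs * form_power \<omega> c p std_frame = form_power \<omega> c p vs * \<beta> c p std_frame"
    using form_onD(1)[OF \<beta> c] form_onD(1)[OF form_power_form c]
    by (rule alternating_proportional[OF _ _ length_std_frame span_std_frame]) (simp add: vs_def)
  ultimately show ?thesis
    using form_power_positive[OF c] form_power_positive[OF c0] unfolding form_ratio_def c0_def[symmetric]
    by (simp add: field_simps)
qed

lemma form_ratio_form:
  assumes \<beta>: "form_on \<A> UNIV (2 * CARD('n)) \<beta>"
  shows "form_on \<A> UNIV 0 (fn (form_ratio \<A> \<beta> (form_power \<omega>)))"
  unfolding form_on_def Int_UNIV_right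
proof (intro conjI ballI allI impI)
  show "alternating 0 (fn (form_ratio \<A> \<beta> (form_power \<omega>)) c p)" for c :: "('x, 'n) chart" and p
    by (simp add: alternating_def)
  show "fn (form_ratio \<A> \<beta> (form_power \<omega>)) c p vs =
     fn (form_ratio \<A> \<beta> (form_power \<omega>)) c' p (map (trans_diff c c' p) vs)"
    for c c' :: "('x, 'n) chart" and p and vs :: "(complex ^ 'n) list"
    by (simp add: fn_def)
  fix c and vs :: "(complex ^ 'n) list" assume c: "c \<in> \<A>"
  note ch = chart_image[OF atlas c]
  have "smooth_on (coord c ` cdom c) (\<lambda>z. \<beta> c (param c z) std_frame / form_power \<omega> c (param c z) std_frame)"
  proof (rule smooth_on_divide[OF ch(2)])
    show "smooth_on (coord c ` cdom c) (\<lambda>z. \<beta> c (param c z) std_frame)"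
      "smooth_on (coord c ` cdom c) (\<lambda>z. form_power \<omega> c (param c z) std_frame)"
      using form_onD(2)[OF \<beta> c] form_onD(2)[OF form_power_form c] by simp_all
    show "form_power \<omega> c (param c z) std_frame \<noteq> 0" if "z \<in> coord c ` cdom c" for z
      using form_power_positive[OF c ch(5)[OF that]] by simp
  qed
  then show "smooth_on (coord c ` cdom c) (\<lambda>z. fn (form_ratio \<A> \<beta> (form_power \<omega>)) c (param c z) vs)"
    by (subst smooth_on_cong[OF ch(2)]) (simp_all only: fn_def form_ratio_chart[OF \<beta> c ch(5)])
qed

lemma scalar_curvature_fscale:
  assumes "t \<noteq> 0"
  shows "scalar_curvature \<A> (fscale t \<omega>) p = scalar_curvature \<A> \<omega> p / t"
proof -
  define c where "c = chart_at \<A> p"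
  have c: "c \<in> \<A>" "p \<in> cdom c" using chart_at[OF atlas] by (auto simp: c_def)
  note ch = chart_image[OF atlas c(1)]
  define G where "G z u v = \<omega> c (param c z) [u, \<i> *s v]" for z u v
  have "linear (\<lambda>v :: complex ^ 'n. \<i> *s v)"
    by (intro linearI) (auto simp: vector_add_ldistrib smult_scaleR)
  then have lin: "linear (\<lambda>v. b [u, \<i> *s v])" if "alternating 2 b" for b :: "(complex ^ 'n) list \<Rightarrow> real" and u
    using linear_compose[OF _ alternating2(2)[OF that]] by (simp add: comp_def)
  have "metric_on (coord c ` cdom c) G"
    unfolding metric_on_def
  proof (intro conjI ballI allI impI ch(2))
    fix z assume "z \<in> coord c ` cdom c"
    then have pos: "positive_11 (\<omega> c (param c z))" by (intro positive_\<omega> c ch(5))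
    then have alt: "alternating 2 (\<omega> c (param c z))" by (simp add: positive_11_def)
    show "linear (\<lambda>u. G z u v)" for v unfolding G_def by (rule alternating2(1)[OF alt])
    show "linear (G z u)" for u unfolding G_def[abs_def] by (rule lin[OF alt])
    show "G z u u > 0" if "u \<noteq> 0" for u using pos that by (simp add: G_def positive_11_def)
  next
    show "smooth_on (coord c ` cdom c) (\<lambda>z. G z u v)" for u v
      unfolding G_def by (rule form_onD(2)[OF form_\<omega> c(1)]) simp
  qed
  from metric_scalar_curvature_scaled[OF this assms, of "coord c p"] c(2)
  show ?thesis
    unfolding scalar_curvature_def Let_def c_def[symmetric] fscale_def G_def by simp
qed

lemma contraction_identity:
  assumes "length vs = 2 * CARD('n)"
  shows "real CARD('n) * wedge_F \<omega> F (chart_at \<A> p) p vs =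
    contraction \<A> \<omega> F p * form_power \<omega> (chart_at \<A> p) p vs"
proof -
  define c where "c = chart_at \<A> p"
  have c: "c \<in> \<A>" "p \<in> cdom c" using chart_at[OF atlas] by (auto simp: c_def)
  define e where "e = (SOME e. unitary_frame \<omega> c p e)"
  have "\<exists>e. unitary_frame \<omega> c p e"
    using unitary_exists[OF positive_\<omega>[OF c]] by (simp add: unitary_frame_def unitary_for_def)
  then have "unitary_frame \<omega> c p e" unfolding e_def by (rule someI_ex)
  then have "unitary_for (\<omega> c p) e" by (simp add: unitary_frame_def unitary_for_def)
  from wedge2_contraction[OF positive_\<omega>[OF c] form_onD(1)[OF form_F c] this assms]
  show ?thesis
    by (simp add: wedge_F_def wedge_forms_def form_power_eq contraction_def Let_def
        c_def[symmetric] e_def[symmetric])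
qed

lemma contraction_constant_iff:
  "(\<forall>p. contraction \<A> \<omega> F p = a) \<longleftrightarrow>
   form_eq \<A> (2 * CARD('n)) (\<lambda>c p vs. real CARD('n) * wedge_F \<omega> F c p vs) (\<lambda>c p vs. a * form_power \<omega> c p vs)"
proof
  assume L: "\<forall>p. contraction \<A> \<omega> F p = a"
  show "form_eq \<A> (2 * CARD('n)) (\<lambda>c p vs. real CARD('n) * wedge_F \<omega> F c p vs) (\<lambda>c p vs. a * form_power \<omega> c p vs)"
    unfolding form_eq_def
  proof (intro ballI allI impI)
    fix c p and vs :: "(complex ^ 'n) list" assume *: "c \<in> \<A>" "p \<in> cdom c" "length vs = 2 * CARD('n)"
    have "form_on \<A> UNIV (2 * CARD('n)) (wedge_F \<omega> F)"
      using mixed_power_form[OF dim_pos] by (simp only: mixed_power_1)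
    then have "wedge_F \<omega> F c p vs = wedge_F \<omega> F (chart_at \<A> p) p (map (trans_diff c (chart_at \<A> p) p) vs)"
      using * chart_at[OF atlas] by (intro form_onD(3)) auto
    moreover have "form_power \<omega> c p vs = form_power \<omega> (chart_at \<A> p) p (map (trans_diff c (chart_at \<A> p) p) vs)"
      using * chart_at[OF atlas] by (intro form_onD(3)[OF form_power_form]) auto
    ultimately show "real CARD('n) * wedge_F \<omega> F c p vs = a * form_power \<omega> c p vs"
      using contraction_identity[of "map (trans_diff c (chart_at \<A> p) p) vs" p] L * by simp
  qed
next
  assume R: "form_eq \<A> (2 * CARD('n)) (\<lambda>c p vs. real CARD('n) * wedge_F \<omega> F c p vs) (\<lambda>c p vs. a * form_power \<omega> c p vs)"
  show "\<forall>p. contraction \<A> \<omega> F p = a"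
  proof
    fix p
    have "real CARD('n) * wedge_F \<omega> F (chart_at \<A> p) p std_frame = a * form_power \<omega> (chart_at \<A> p) p std_frame"
      using R chart_at[OF atlas, of p] unfolding form_eq_def by simp
    then have "contraction \<A> \<omega> F p * form_power \<omega> (chart_at \<A> p) p std_frame
        = a * form_power \<omega> (chart_at \<A> p) p std_frame"
      unfolding contraction_identity[OF length_std_frame] .
    moreover have "form_power \<omega> (chart_at \<A> p) p std_frame \<noteq> 0"
      using form_power_positive[OF chart_at[OF atlas], of p] by linarith
    ultimately show "contraction \<A> \<omega> F p = a" by (simp only: mult_cancel_right) simp
  qed
qed

text \<open>Integrate \<open>n \<omega>\<^sup>n\<^sup>-\<^sup>1 \<and> F = a \<omega>\<^sup>n\<close>.\<close>

lemma contraction_constant_slope: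
  assumes "\<forall>p. contraction \<A> \<omega> F p = a"
  shows "slope \<A> \<omega> F = a"
proof -
  have "form_integral \<A> (\<lambda>c p vs. real CARD('n) * wedge_F \<omega> F c p vs) =
      form_integral \<A> (\<lambda>c p vs. a * form_power \<omega> c p vs)"
    using assms unfolding contraction_constant_iff form_eq_def
    by (intro form_integral_cong[OF compact_space atlas]) simp
  then show ?thesis
    using volume_positive unfolding form_integral_mult[OF compact_space atlas] by (simp add: slope_def)
qed

text \<open>In complex dimension one the form \<open>F \<and> F\<close> vanishes, so that any positive coupling constant can be
  taken; it is set to one.\<close>

lemma limit_system_iff_kaehler_yang_mills:
  assumes "\<alpha> > 0"
  shows "\<exists>\<kappa>>0. (CARD('n) \<ge> 2 \<longrightarrow> \<kappa> = \<alpha> * (real CARD('n) * (real CARD('n) - 1) / 2)) \<and>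
    ((\<exists>a. limit_system \<A> \<omega> F \<alpha> (\<lambda>p. a)) \<longleftrightarrow> kaehler_yang_mills \<A> \<omega> F \<kappa>)"
proof -
  define c where "c = slope \<A> \<omega> F"
  define q where "q = form_ratio \<A> (wedge_FF \<omega> F) (form_power \<omega>)"
  define \<kappa> where "\<kappa> = (if CARD('n) \<ge> 2 then \<alpha> * (real CARD('n) * (real CARD('n) - 1) / 2) else 1)"
  have \<kappa>q: "\<kappa> * q p = \<alpha> * (real CARD('n) * (real CARD('n) - 1) / 2) * q p" for p
  proof (cases "CARD('n) \<ge> 2")
    case False
    then have d: "CARD('n) = 1" using dim_pos by linarith
    then have "wedge_FF \<omega> F c p std_frame = 0" for c
      by (simp add: wedge_FF_def wedge_forms_def wedge2_def)
    then have "q p = 0" by (simp add: q_def form_ratio_def)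
    then show ?thesis by simp
  qed (simp add: \<kappa>_def)
  have "(\<exists>a. limit_system \<A> \<omega> F \<alpha> (\<lambda>p. a)) \<longleftrightarrow>
     (\<forall>p. contraction \<A> \<omega> F p = c) \<and> (\<exists>a. \<forall>p. scalar_curvature \<A> \<omega> p + \<kappa> * q p - \<alpha> * c\<^sup>2 / 2 = a)"
    unfolding limit_system_def contraction_constant_iff c_def[symmetric] q_def[symmetric] \<kappa>q
    by (simp add: algebra_simps)
  also have "\<dots> \<longleftrightarrow> kaehler_yang_mills \<A> \<omega> F \<kappa>"
  proof -
    have "(\<forall>p. contraction \<A> \<omega> F p = c) \<longleftrightarrow> (\<exists>a. \<forall>p. contraction \<A> \<omega> F p = a)"
      using contraction_constant_slope unfolding c_def by blast
    moreover have "(\<exists>a. \<forall>p. scalar_curvature \<A> \<omega> p + \<kappa> * q p - \<alpha> * c\<^sup>2 / 2 = a) \<longleftrightarrow>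
        (\<exists>b. \<forall>p. scalar_curvature \<A> \<omega> p + \<kappa> * q p = b)"
      by (metis diff_add_cancel add_diff_cancel)
    ultimately show ?thesis unfolding kaehler_yang_mills_def q_def by simp
  qed
  finally have "(\<exists>a. limit_system \<A> \<omega> F \<alpha> (\<lambda>p. a)) \<longleftrightarrow> kaehler_yang_mills \<A> \<omega> F \<kappa>" .
  moreover have "\<kappa> > 0" using assms by (auto simp: \<kappa>_def)
  ultimately show ?thesis by (intro exI[of _ \<kappa>]) (simp add: \<kappa>_def)
qed

end

section \<open>The moment map and the coupled equations for large radius\<close>

lemma power_diff_inverse:
  assumes "(t::real) > 0" "k \<le> n"
  shows "t ^ (n - k) = t ^ n * inverse t ^ k"
  using assms by (simp add: power_diff field_simps)

lemma powi_diff_inverse: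
  assumes "(t::real) > 0"
  shows "t powi (int n - int k) = t ^ n * inverse t ^ k"
  using assms by (simp add: power_int_diff field_simps)

lemma bigo_inverse_power_powi:
  fixes f r :: "real \<Rightarrow> real"
  assumes "f \<in> O(\<lambda>t. inverse t ^ m)" "\<And>t. t > 0 \<Longrightarrow> r t = t ^ n * f t"
  shows "\<exists>C. \<forall>\<^sub>F t in at_top. \<bar>r t\<bar> \<le> C * t powi (int n - int m)"
proof -
  obtain C where C: "\<forall>\<^sub>F t in at_top. norm (f t) \<le> C * norm (inverse t ^ m)"
    using assms(1) by (rule landau_o.bigE)
  then have "\<forall>\<^sub>F t in at_top. \<bar>r t\<bar> \<le> C * t powi (int n - int m)"
    using eventually_gt_at_top[of 0]
  proof eventually_elim
    case (elim t)
    have "\<bar>r t\<bar> = t ^ n * \<bar>f t\<bar>" using assms(2)[OF elim(2)] elim(2) by (simp add: abs_mult)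
    also have "\<dots> \<le> t ^ n * (C * inverse t ^ m)"
      using elim by (intro mult_left_mono) auto
    finally show ?case using powi_diff_inverse[OF elim(2)] by (simp add: mult_ac)
  qed
  then show ?thesis by blast
qed

context kaehler_with_form
begin

lemma dhym_form_expansion:
  assumes \<Phi>: "form_eq \<A> 2 \<Phi> (\<lambda>c p vs. \<i> * complex_of_real (F c p vs))"
    and c: "c \<in> \<A>" "p \<in> cdom c"
  shows "dhym_form (fscale t \<omega>) \<Phi> c p vs = (\<Sum>k\<le>CARD('n).
    of_nat (CARD('n) choose k) * (- \<i>) ^ k * of_real (t ^ (CARD('n) - k)) * of_real (mixed_power k c p vs))"
proof -
  define a where "a = (\<lambda>xs. complex_of_real t * of_real (\<omega> c p xs))"
  define b where "b = (\<lambda>xs. (- \<i>) * complex_of_real (F c p xs))"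
  have "dhym_form (fscale t \<omega>) \<Phi> c p vs =
      wedge2 (replicate CARD('n) (\<lambda>xs. complex_of_real (fscale t \<omega> c p xs) - \<Phi> c p xs)) vs"
    by (simp add: dhym_form_def form_power_def wedge_forms_def)
  also have "\<dots> = wedge2 (replicate CARD('n) (\<lambda>xs. a xs + b xs)) vs"
    using \<Phi> c by (intro wedge2_cong) (auto simp: form_eq_def fscale_def a_def b_def)
  also have "\<dots> = (\<Sum>k\<le>CARD('n). of_nat (CARD('n) choose k) *
      wedge2 (replicate (CARD('n) - k) a @ replicate k b) vs)"
    by (rule wedge2_binomial)
  finally have sum: "dhym_form (fscale t \<omega>) \<Phi> c p vs = (\<Sum>k\<le>CARD('n). of_nat (CARD('n) choose k) *
      wedge2 (replicate (CARD('n) - k) a @ replicate k b) vs)" .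
  have "wedge2 (replicate (CARD('n) - k) a @ replicate k b) vs =
      (- \<i>) ^ k * of_real (t ^ (CARD('n) - k)) * of_real (mixed_power k c p vs)" for k
    using wedge2_scaled[of "replicate (CARD('n) - k) (complex_of_real t, \<omega> c p) @ replicate k (- \<i>, F c p)" vs]
    by (simp add: a_def b_def mixed_power_def wedge_forms_def prod_list_replicate mult_ac)
  then show ?thesis unfolding sum by (simp add: mult_ac)
qed

lemma dhym_coefficients:
  assumes \<Phi>: "form_eq \<A> 2 \<Phi> (\<lambda>c p vs. \<i> * complex_of_real (F c p vs))"
    and c: "c \<in> \<A>" "p \<in> cdom c"
  shows "dhym_Im \<A> (fscale t \<omega>) \<Phi> c p vs = (\<Sum>k\<le>CARD('n).
     (im_coeff CARD('n) (phase_angle \<A> (fscale t \<omega>) \<Phi>) k * t ^ (CARD('n) - k)) * mixed_power k c p vs)"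
    and "dhym_Re \<A> (fscale t \<omega>) \<Phi> c p vs = (\<Sum>k\<le>CARD('n).
     (re_coeff CARD('n) (phase_angle \<A> (fscale t \<omega>) \<Phi>) k * t ^ (CARD('n) - k)) * mixed_power k c p vs)"
proof -
  define u where "u = exp (- \<i> * complex_of_real (phase_angle \<A> (fscale t \<omega>) \<Phi>))"
  have *: "u * dhym_form (fscale t \<omega>) \<Phi> c p vs = (\<Sum>k\<le>CARD('n).
     of_real (real (CARD('n) choose k) * t ^ (CARD('n) - k) * mixed_power k c p vs) * (u * (- \<i>) ^ k))"
    unfolding dhym_form_expansion[OF \<Phi> c] sum_distrib_left by (intro sum.cong) (simp_all add: mult_ac)
  have Im_mult: "Im (of_real x * z) = x * Im z" and Re_mult: "Re (of_real x * z) = x * Re z" for x z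
    by simp_all
  show "dhym_Im \<A> (fscale t \<omega>) \<Phi> c p vs = (\<Sum>k\<le>CARD('n).
     (im_coeff CARD('n) (phase_angle \<A> (fscale t \<omega>) \<Phi>) k * t ^ (CARD('n) - k)) * mixed_power k c p vs)"
    unfolding dhym_Im_def u_def[symmetric] * im_coeff_def Im_sum
    by (intro sum.cong refl) (unfold Im_mult, simp only: mult_ac)
  show "dhym_Re \<A> (fscale t \<omega>) \<Phi> c p vs = (\<Sum>k\<le>CARD('n).
     (re_coeff CARD('n) (phase_angle \<A> (fscale t \<omega>) \<Phi>) k * t ^ (CARD('n) - k)) * mixed_power k c p vs)"
    unfolding dhym_Re_def u_def[symmetric] * re_coeff_def Re_sum
    by (intro sum.cong refl) (unfold Re_mult, simp only: mult_ac)
qed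

lemma dhym_form_integral:
  assumes \<Phi>: "form_eq \<A> 2 \<Phi> (\<lambda>c p vs. \<i> * complex_of_real (F c p vs))"
  shows "form_integral \<A> (dhym_form (fscale t \<omega>) \<Phi>) = (\<Sum>k\<le>CARD('n).
    of_nat (CARD('n) choose k) * (- \<i>) ^ k * of_real (t ^ (CARD('n) - k) * form_integral \<A> (mixed_power k)))"
proof -
  have "form_integral \<A> (dhym_form (fscale t \<omega>) \<Phi>) =
     form_integral \<A> (\<lambda>c p vs. \<Sum>k\<le>CARD('n). (of_nat (CARD('n) choose k) * (- \<i>) ^ k *
        of_real (t ^ (CARD('n) - k))) * complex_of_real (mixed_power k c p vs))"
    using dhym_form_expansion[OF \<Phi>] by (intro form_integral_cong[OF compact_space atlas]) simp
  also have "\<dots> = (\<Sum>k\<le>CARD('n). (of_nat (CARD('n) choose k) * (- \<i>) ^ k *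
        of_real (t ^ (CARD('n) - k))) * of_real (form_integral \<A> (mixed_power k)))"
    using mixed_power_form by (intro form_integral_complex_combination[OF compact_space atlas]) auto
  finally show ?thesis by (simp add: mult.assoc)
qed

lemma phase_angle_works:
  assumes "form_integral \<A> (dhym_form \<sigma> \<Phi>) \<noteq> 0"
  shows "\<exists>r>0. form_integral \<A> (dhym_form \<sigma> \<Phi>) =
    complex_of_real r * exp (\<i> * complex_of_real (phase_angle \<A> \<sigma> \<Phi>))"
proof -
  define z where "z = form_integral \<A> (dhym_form \<sigma> \<Phi>)"
  have "z = of_real (cmod z) * exp (\<i> * of_real (Arg z))"
    using assms by (simp add: z_def Arg_eq)
  then have "\<exists>\<theta>. \<exists>r>0. z = of_real r * exp (\<i> * of_real \<theta>)"
    using assms unfolding z_def[symmetric] by (intro exI[of _ "Arg z"] exI[of _ "cmod z"]) simp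
  from someI_ex[OF this] show ?thesis unfolding phase_angle_def z_def by simp
qed

definition im_main :: "real \<Rightarrow> ('x, 'n, real) form" where
  "im_main t c p vs =
     (- (real CARD('n) * wedge_F \<omega> F c p vs) + slope \<A> \<omega> F * form_power \<omega> c p vs)
       * t powi (int CARD('n) - 1)"

definition re_main :: "real \<Rightarrow> ('x, 'n, real) form" where
  "re_main t c p vs =
     form_power \<omega> c p vs * t powi int CARD('n)
     - (real CARD('n) * (real CARD('n) - 1) / 2 * wedge_FF \<omega> F c p vs
        - slope \<A> \<omega> F * real CARD('n) * wedge_F \<omega> F c p vs
        + (slope \<A> \<omega> F)\<^sup>2 / 2 * form_power \<omega> c p vs) * t powi (int CARD('n) - 2)"

text \<open>The remainders are combinations of the fixed forms \<open>\<omega>\<^sup>n\<^sup>-\<^sup>k \<and> F\<^sup>k\<close>. Only their coefficients, which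
  contain the phase, depend on \<open>t\<close>, so smooth convergence reduces to estimates of real functions of \<open>t\<close>.\<close>

lemma dhym_expansion:
  assumes \<Phi>: "form_eq \<A> 2 \<Phi> (\<lambda>c p vs. \<i> * complex_of_real (F c p vs))"
  defines "n \<equiv> CARD('n)"
  obtains r1 r2 :: "real \<Rightarrow> nat \<Rightarrow> real" where
    "\<forall>k\<le>n. \<exists>C. \<forall>\<^sub>F t in at_top. \<bar>r1 t k\<bar> \<le> C * t powi (int n - 3)"
    "\<forall>k\<le>n. \<exists>C. \<forall>\<^sub>F t in at_top. \<bar>r2 t k\<bar> \<le> C * t powi (int n - 4)"
    "\<forall>\<^sub>F t in at_top. form_integral \<A> (dhym_form (fscale t \<omega>) \<Phi>) \<noteq> 0"
    "\<forall>t>0. \<forall>c\<in>\<A>. \<forall>p\<in>cdom c. \<forall>vs. dhym_Im \<A> (fscale t \<omega>) \<Phi> c p vs =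
       im_main t c p vs + (\<Sum>k\<le>n. r1 t k * mixed_power k c p vs)"
    "\<forall>t>0. \<forall>c\<in>\<A>. \<forall>p\<in>cdom c. \<forall>vs. dhym_Re \<A> (fscale t \<omega>) \<Phi> c p vs =
       re_main t c p vs + (\<Sum>k\<le>n. r2 t k * mixed_power k c p vs)"
proof -
  define s where "s = slope \<A> \<omega> F"
  define \<theta> where "\<theta> t = phase_angle \<A> (fscale t \<omega>) \<Phi>" for t
  define Z where "Z t = form_integral \<A> (dhym_form (fscale t \<omega>) \<Phi>)" for t
  define w where "w k = form_integral \<A> (mixed_power k)" for k
  have n: "n \<ge> 1" unfolding n_def by (rule dim_pos)
  have w0: "w 0 > 0" unfolding w_def mixed_power_0 by (rule volume_positive)
  have s: "s = real n * w 1 / w 0"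
    unfolding s_def w_def mixed_power_0 mixed_power_1 by (simp add: slope_def n_def)
  have Z: "Z t = (\<Sum>k\<le>n. of_nat (n choose k) * (- \<i>) ^ k * of_real (t ^ (n - k) * w k))" for t
    unfolding Z_def n_def w_def by (rule dhym_form_integral[OF \<Phi>])
  have \<theta>: "\<exists>r>0. Z t = of_real r * exp (\<i> * of_real (\<theta> t))" if "Z t \<noteq> 0" for t
    using phase_angle_works that unfolding Z_def \<theta>_def .
  note asym = phase_asymptotics[OF n w0 s Z \<theta>]
  note coeff = coefficient_asymptotics[OF asym(2,3), of n]
  define p1 where "p1 = im_main_coeff s n"
  define p2 where "p2 = re_main_coeff s n"
  define p0 where "p0 k = (if k = 0 then 1 else 0 :: real)" for k :: nat
  define r1 where "r1 t k = im_coeff n (\<theta> t) k * t ^ (n - k) - p1 k * t powi (int n - 1)" for t k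
  define r2 where "r2 t k = re_coeff n (\<theta> t) k * t ^ (n - k)
      - (p0 k * t powi int n + p2 k * t powi (int n - 2))" for t k
  have "(\<exists>C. \<forall>\<^sub>F t in at_top. \<bar>r1 t k\<bar> \<le> C * t powi (int n - 3)) \<and>
      (\<exists>C. \<forall>\<^sub>F t in at_top. \<bar>r2 t k\<bar> \<le> C * t powi (int n - 4))" if k: "k \<le> n" for k
  proof
    have "\<exists>C. \<forall>\<^sub>F t in at_top. \<bar>r1 t k\<bar> \<le> C * t powi (int n - int 3)"
    proof (rule bigo_inverse_power_powi[OF coeff(1)])
      fix t :: real assume t: "t > 0"
      show "r1 t k = t ^ n * (im_coeff n (\<theta> t) k * inverse t ^ k
          - im_main_coeff s n k * inverse t)"
        using powi_diff_inverse[OF t, of n 1]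
        unfolding r1_def power_diff_inverse[OF t k] p1_def[symmetric] by (simp add: algebra_simps)
    qed
    then show "\<exists>C. \<forall>\<^sub>F t in at_top. \<bar>r1 t k\<bar> \<le> C * t powi (int n - 3)" by simp
    have "\<exists>C. \<forall>\<^sub>F t in at_top. \<bar>r2 t k\<bar> \<le> C * t powi (int n - int 4)"
    proof (rule bigo_inverse_power_powi[OF coeff(2)])
      fix t :: real assume t: "t > 0"
      show "r2 t k = t ^ n * (re_coeff n (\<theta> t) k * inverse t ^ k - ((if k = 0 then 1 else 0)
          + re_main_coeff s n k * inverse t ^ 2))"
        using powi_diff_inverse[OF t, of n 2]
        unfolding r2_def power_diff_inverse[OF t k] p2_def[symmetric] p0_def[symmetric]
        by (simp add: algebra_simps)
    qed
    then show "\<exists>C. \<forall>\<^sub>F t in at_top. \<bar>r2 t k\<bar> \<le> C * t powi (int n - 4)" by simp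
  qed
  note bounds = this
  have expansions: "dhym_Im \<A> (fscale t \<omega>) \<Phi> c p vs =
       im_main t c p vs + (\<Sum>k\<le>n. r1 t k * mixed_power k c p vs)"
    "dhym_Re \<A> (fscale t \<omega>) \<Phi> c p vs =
       re_main t c p vs + (\<Sum>k\<le>n. r2 t k * mixed_power k c p vs)"
    if t: "t > 0" and c: "c \<in> \<A>" "p \<in> cdom c" for t c p vs
  proof -
    \<comment> \<open>In dimension one there is no summand \<open>k = 2\<close>, but then its coefficient vanishes.\<close>
    have pick: "(\<Sum>k\<le>n. (if k = m then a else 0) * mixed_power k c p vs) = a * mixed_power m c p vs"
      if "m \<le> n \<or> a = 0" for m a
      using that by (auto simp: if_distrib[of "\<lambda>x. x * _"] sum.delta cong: if_cong)
    have "(\<Sum>k\<le>n. p1 k * mixed_power k c p vs) = (\<Sum>k\<le>n. (if k = 0 then s else 0) * mixed_power k c p vs)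
        + (\<Sum>k\<le>n. (if k = 1 then - real n else 0) * mixed_power k c p vs)"
      unfolding sum.distrib[symmetric] by (intro sum.cong refl) (auto simp: p1_def im_main_coeff_def)
    also have "\<dots> = - (real n * wedge_F \<omega> F c p vs) + s * form_power \<omega> c p vs"
      using n by (simp add: pick mixed_power_0 mixed_power_1[simplified])
    finally have S1: "(\<Sum>k\<le>n. p1 k * mixed_power k c p vs) = \<dots>" .
    have "dhym_Im \<A> (fscale t \<omega>) \<Phi> c p vs =
        (\<Sum>k\<le>n. p1 k * mixed_power k c p vs) * t powi (int n - 1) + (\<Sum>k\<le>n. r1 t k * mixed_power k c p vs)"
      unfolding dhym_coefficients(1)[OF \<Phi> c] \<theta>_def[symmetric] n_def[symmetric] sum_distrib_right
        sum.distrib[symmetric]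
      by (intro sum.cong refl) (simp add: r1_def algebra_simps)
    then show "dhym_Im \<A> (fscale t \<omega>) \<Phi> c p vs =
       im_main t c p vs + (\<Sum>k\<le>n. r1 t k * mixed_power k c p vs)"
      unfolding im_main_def s_def[symmetric] n_def[symmetric] S1 .
    have "(\<Sum>k\<le>n. p2 k * mixed_power k c p vs) = (\<Sum>k\<le>n. (if k = 0 then - (s\<^sup>2 / 2) else 0) * mixed_power k c p vs)
        + (\<Sum>k\<le>n. (if k = 1 then s * real n else 0) * mixed_power k c p vs)
        + (\<Sum>k\<le>n. (if k = 2 then - (real n * (real n - 1) / 2) else 0) * mixed_power k c p vs)"
      unfolding sum.distrib[symmetric] by (intro sum.cong refl) (auto simp: p2_def re_main_coeff_def)
    also have "\<dots> = - (s\<^sup>2 / 2) * form_power \<omega> c p vs + s * real n * wedge_F \<omega> F c p vs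
        - (real n * (real n - 1) / 2) * wedge_FF \<omega> F c p vs"
    proof -
      have "2 \<le> n \<or> - (real n * (real n - 1) / 2) = 0" using n by (cases "n = 1") auto
      from pick[OF this] show ?thesis
        using n pick[of 0 "- (s\<^sup>2 / 2)"] pick[of 1 "s * real n"]
        unfolding mixed_power_0 mixed_power_1 mixed_power_2 by linarith
    qed
    finally have S2: "(\<Sum>k\<le>n. p2 k * mixed_power k c p vs) = \<dots>" .
    have S0: "(\<Sum>k\<le>n. p0 k * mixed_power k c p vs) = form_power \<omega> c p vs"
      using pick[of 0 1] by (simp add: p0_def mixed_power_0)
    have "dhym_Re \<A> (fscale t \<omega>) \<Phi> c p vs =
        (\<Sum>k\<le>n. p0 k * mixed_power k c p vs) * t powi int n
        + (\<Sum>k\<le>n. p2 k * mixed_power k c p vs) * t powi (int n - 2) + (\<Sum>k\<le>n. r2 t k * mixed_power k c p vs)"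
      unfolding dhym_coefficients(2)[OF \<Phi> c] \<theta>_def[symmetric] n_def[symmetric] sum_distrib_right
        sum.distrib[symmetric]
      by (intro sum.cong refl) (simp add: r2_def algebra_simps)
    then show "dhym_Re \<A> (fscale t \<omega>) \<Phi> c p vs =
       re_main t c p vs + (\<Sum>k\<le>n. r2 t k * mixed_power k c p vs)"
      unfolding S0 S2 re_main_def s_def[symmetric] n_def[symmetric] by (simp add: algebra_simps)
  qed
  show ?thesis
  proof (rule that)
    show "\<forall>k\<le>n. \<exists>C. \<forall>\<^sub>F t in at_top. \<bar>r1 t k\<bar> \<le> C * t powi (int n - 3)"
      "\<forall>k\<le>n. \<exists>C. \<forall>\<^sub>F t in at_top. \<bar>r2 t k\<bar> \<le> C * t powi (int n - 4)"
      using bounds by simp_all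
  next
    show "\<forall>\<^sub>F t in at_top. form_integral \<A> (dhym_form (fscale t \<omega>) \<Phi>) \<noteq> 0"
      using phase_asymptotics(1)[OF n w0 s Z \<theta>] unfolding Z_def .
  qed (use expansions in blast)+
qed

lemma moment_map_expansion:
  assumes \<Phi>: "form_eq \<A> 2 (curvature W A) (\<lambda>c p vs. \<i> * complex_of_real (F c p vs))"
  defines "n \<equiv> CARD('n)"
  obtains R1 R2 where "form_bigo \<A> (2 * n) (int n - 3) R1" "form_bigo \<A> (2 * n) (int n - 4) R2"
    "\<forall>\<^sub>F t in at_top. form_integral \<A> (dhym_form (fscale t \<omega>) (curvature W A)) \<noteq> 0 \<and>
      (\<forall>\<zeta> \<sigma>. moment_map \<A> W (fscale t \<omega>) \<sigma> A \<zeta> = gauge_pairing \<A> W A \<sigma>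
         (\<lambda>ch p vs. im_main t ch p vs + R1 t ch p vs)
         (\<lambda>ch p vs. re_main t ch p vs + R2 t ch p vs) \<zeta>)"
proof -
  obtain r1 r2 where r1: "\<forall>k\<le>n. \<exists>C. \<forall>\<^sub>F t in at_top. \<bar>r1 t k\<bar> \<le> C * t powi (int n - 3)"
    and r2: "\<forall>k\<le>n. \<exists>C. \<forall>\<^sub>F t in at_top. \<bar>r2 t k\<bar> \<le> C * t powi (int n - 4)"
    and nz: "\<forall>\<^sub>F t in at_top. form_integral \<A> (dhym_form (fscale t \<omega>) (curvature W A)) \<noteq> 0"
    and Im: "\<forall>t>0. \<forall>c\<in>\<A>. \<forall>p\<in>cdom c. \<forall>vs. dhym_Im \<A> (fscale t \<omega>) (curvature W A) c p vs =
       im_main t c p vs + (\<Sum>k\<le>n. r1 t k * mixed_power k c p vs)"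
    and Re: "\<forall>t>0. \<forall>c\<in>\<A>. \<forall>p\<in>cdom c. \<forall>vs. dhym_Re \<A> (fscale t \<omega>) (curvature W A) c p vs =
       re_main t c p vs + (\<Sum>k\<le>n. r2 t k * mixed_power k c p vs)"
    by (rule dhym_expansion[OF \<Phi>, folded n_def], rule that, assumption+)
  define R1 where "R1 t = (\<lambda>c p vs. \<Sum>k\<le>n. r1 t k * mixed_power k c p vs)" for t
  define R2 where "R2 t = (\<lambda>c p vs. \<Sum>k\<le>n. r2 t k * mixed_power k c p vs)" for t
  have form: "form_on \<A> UNIV (2 * n) (mixed_power k)" if "k \<in> {..n}" for k
    using that mixed_power_form by (simp add: n_def)
  have "form_bigo \<A> (2 * n) (int n - 3) R1" "form_bigo \<A> (2 * n) (int n - 4) R2"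
    unfolding R1_def R2_def using r1 r2 form by (intro form_bigo_combination[OF atlas]; simp)+
  moreover have "\<forall>\<^sub>F t in at_top. form_integral \<A> (dhym_form (fscale t \<omega>) (curvature W A)) \<noteq> 0 \<and>
      (\<forall>\<zeta> \<sigma>. moment_map \<A> W (fscale t \<omega>) \<sigma> A \<zeta> = gauge_pairing \<A> W A \<sigma>
         (\<lambda>ch p vs. im_main t ch p vs + R1 t ch p vs)
         (\<lambda>ch p vs. re_main t ch p vs + R2 t ch p vs) \<zeta>)"
    using nz eventually_gt_at_top[of 0]
  proof eventually_elim
    case (elim t)
    show ?case
      unfolding moment_map_def gauge_pairing_def R1_def R2_def
      by (intro conjI allI elim(1) arg_cong2[where f = "(+)"] arg_cong2[where f = "(*)"] refl
            form_integral_cong[OF compact_space atlas]) (simp_all only: Im[rule_format, OF elim(2)] Re[rule_format, OF elim(2)])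
  qed
  ultimately show ?thesis by (rule that)
qed

text \<open>The substitution \<open>\<alpha> = \<alpha>' t\<close> and \<open>f = - \<alpha>' t + f' / t\<close> cancels the leading term of the real part
  against the constant, so that its second term meets the scalar curvature \<open>s(t \<omega>) = s(\<omega>) / t\<close> at order
  \<open>t\<^sup>-\<^sup>1\<close>. The first equation then turns \<open>c n \<omega>\<^sup>n\<^sup>-\<^sup>1 \<and> F\<close> into \<open>c\<^sup>2 \<omega>\<^sup>n\<close>.\<close>

lemma coupled_equations_leading_part:
  assumes f: "smooth_fun_on \<A> UNIV f"
  defines "n \<equiv> CARD('n)" and "\<Phi> \<equiv> (\<lambda>c p vs. \<i> * complex_of_real (F c p vs))"
  shows "\<exists>L1 L2. leading_part \<A> (2 * n) (int n - 1) (\<lambda>t. dhym_Im \<A> (fscale t \<omega>) \<Phi>) L1 \<and>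
     leading_part \<A> 0 (- 1)
       (\<lambda>t. fn (coupled_residual \<A> (fscale t \<omega>) \<Phi> (\<alpha> * t) (\<lambda>p. - \<alpha> * t + f p / t))) (fn L2) \<and>
     (form_eq \<A> (2 * n) L1 (\<lambda>ch p vs. 0) \<and> (\<forall>p. L2 p = 0) \<longleftrightarrow> limit_system \<A> \<omega> F \<alpha> f)"
proof -
  define s where "s = slope \<A> \<omega> F"
  have \<Phi>: "form_eq \<A> 2 \<Phi> (\<lambda>c p vs. \<i> * complex_of_real (F c p vs))" by (simp add: form_eq_def \<Phi>_def)
  obtain r1 r2 where r1: "\<forall>k\<le>n. \<exists>C. \<forall>\<^sub>F t in at_top. \<bar>r1 t k\<bar> \<le> C * t powi (int n - 3)"
    and r2: "\<forall>k\<le>n. \<exists>C. \<forall>\<^sub>F t in at_top. \<bar>r2 t k\<bar> \<le> C * t powi (int n - 4)"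
    and Im: "\<forall>t>0. \<forall>c\<in>\<A>. \<forall>p\<in>cdom c. \<forall>vs. dhym_Im \<A> (fscale t \<omega>) \<Phi> c p vs =
       im_main t c p vs + (\<Sum>k\<le>n. r1 t k * mixed_power k c p vs)"
    and Re: "\<forall>t>0. \<forall>c\<in>\<A>. \<forall>p\<in>cdom c. \<forall>vs. dhym_Re \<A> (fscale t \<omega>) \<Phi> c p vs =
       re_main t c p vs + (\<Sum>k\<le>n. r2 t k * mixed_power k c p vs)"
    by (rule dhym_expansion[OF \<Phi>, folded n_def], rule that, assumption+)
  define \<rho> where "\<rho> k = form_ratio \<A> (mixed_power k) (form_power \<omega>)" for k
  define q1 where "q1 = form_ratio \<A> (wedge_F \<omega> F) (form_power \<omega>)"
  define q2 where "q2 = form_ratio \<A> (wedge_FF \<omega> F) (form_power \<omega>)"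
  define Q where "Q p = real n * (real n - 1) / 2 * q2 p - s * real n * q1 p + s\<^sup>2 / 2" for p
  define L1 where "L1 = (\<lambda>c p vs. - (real n * wedge_F \<omega> F c p vs) + s * form_power \<omega> c p vs)"
  \<comment> \<open>The coefficient of \<open>t\<^sup>-\<^sup>1\<close>: \<open>Q\<close> is minus that of \<open>t\<^sup>-\<^sup>2\<close> in the ratio of the real part to \<open>(t \<omega>)\<^sup>n\<close>.\<close>
  define L2 where "L2 p = scalar_curvature \<A> \<omega> p + \<alpha> * Q p - f p" for p
  have form: "form_on \<A> UNIV (2 * n) (mixed_power k)" if "k \<le> n" for k
    using that mixed_power_form by (simp add: n_def)
  have "leading_part \<A> (2 * n) (int n - 1) (\<lambda>t. dhym_Im \<A> (fscale t \<omega>) \<Phi>) L1"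
    unfolding leading_part_def
  proof (intro exI conjI)
    show "form_bigo \<A> (2 * n) (int n - 1 - 1) (\<lambda>t c p vs. \<Sum>k\<le>n. r1 t k * mixed_power k c p vs)"
      using form by (intro form_bigo_combination[OF atlas] powi_bound_weaken[OF r1[rule_format]]) auto
    show "\<forall>\<^sub>F t in at_top. form_eq \<A> (2 * n) (dhym_Im \<A> (fscale t \<omega>) \<Phi>)
       (\<lambda>c p vs. t powi (int n - 1) * L1 c p vs + (\<Sum>k\<le>n. r1 t k * mixed_power k c p vs))"
      using eventually_gt_at_top[of 0]
      by eventually_elim
        (simp add: form_eq_def Im im_main_def L1_def s_def[symmetric] n_def[symmetric] mult.commute)
  qed
  moreover have "leading_part \<A> 0 (- 1)
       (\<lambda>t. fn (coupled_residual \<A> (fscale t \<omega>) \<Phi> (\<alpha> * t) (\<lambda>p. - \<alpha> * t + f p / t))) (fn L2)"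
    unfolding leading_part_def
  proof (intro exI conjI)
    define r where "r t k = - \<alpha> * t * r2 t k / t ^ n" for t k
    have bound: "\<exists>C. \<forall>\<^sub>F t in at_top. \<bar>r t k\<bar> \<le> C * t powi (- 1 - 1)" if k: "k \<le> n" for k
    proof -
      obtain C where "\<forall>\<^sub>F t in at_top. \<bar>r2 t k\<bar> \<le> C * t powi (int n - 4)" using r2[rule_format, OF k] by blast
      then have "\<forall>\<^sub>F t in at_top. \<bar>r t k\<bar> \<le> (\<bar>\<alpha>\<bar> * C) * t powi (- 3)"
        using eventually_gt_at_top[of 0]
      proof eventually_elim
        case (elim t)
        have "\<bar>r t k\<bar> = \<bar>\<alpha>\<bar> * t / t ^ n * \<bar>r2 t k\<bar>" using elim(2) by (simp add: r_def abs_mult)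
        also have "\<dots> \<le> \<bar>\<alpha>\<bar> * t / t ^ n * (C * t powi (int n - 4))"
          using elim by (intro mult_left_mono) auto
        also have "t powi (int n - 4) = t ^ n * t powi (- 3) / t"
          using elim(2) by (simp add: power_int_diff power_int_minus field_simps power4_eq_xxxx power3_eq_cube)
        finally show ?case using elim(2) by (simp add: field_simps)
      qed
      then show ?thesis by (intro powi_bound_weaken[of _ "- 3" "- 1 - 1"]) auto
    qed
    show "form_bigo \<A> 0 (- 1 - 1) (\<lambda>t c p vs. \<Sum>k\<le>n. r t k * fn (\<rho> k) c p vs)"
    proof (intro form_bigo_combination[OF atlas])
      show "form_on \<A> UNIV 0 (fn (\<rho> k))" if "k \<in> {..n}" for k
        unfolding \<rho>_def using form that by (intro form_ratio_form) (simp add: n_def)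
    qed (use bound in auto)
    have residual: "coupled_residual \<A> (fscale t \<omega>) \<Phi> (\<alpha> * t) (\<lambda>p. - \<alpha> * t + f p / t) p =
        t powi (- 1) * L2 p + (\<Sum>k\<le>n. r t k * \<rho> k p)" if t: "t > 0" for t p
    proof -
      define c where "c = chart_at \<A> p"
      have c: "c \<in> \<A>" "p \<in> cdom c" using chart_at[OF atlas] by (auto simp: c_def)
      define v where "v = form_power \<omega> c p std_frame"
      have v: "v > 0" unfolding v_def by (rule form_power_positive[OF c])
      define \<Sigma> where "\<Sigma> = (\<Sum>k\<le>n. r2 t k * \<rho> k p)"
      have \<rho>v: "mixed_power k c p std_frame = \<rho> k p * v" "wedge_F \<omega> F c p std_frame = q1 p * v"
        "wedge_FF \<omega> F c p std_frame = q2 p * v" for k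
        using v unfolding \<rho>_def q1_def q2_def form_ratio_def c_def[symmetric] v_def[symmetric] by simp_all
      have "dhym_Re \<A> (fscale t \<omega>) \<Phi> c p std_frame =
          (t ^ n - Q p * t powi (int n - 2) + \<Sigma>) * v"
        unfolding Re[rule_format, OF t c] re_main_def n_def[symmetric] s_def[symmetric] \<rho>v
          v_def[symmetric] Q_def \<Sigma>_def
        by (simp add: algebra_simps sum_distrib_left sum_distrib_right power_int_of_nat)
      moreover have "form_power (fscale t \<omega>) c p std_frame = t ^ n * v"
        unfolding v_def n_def by (rule form_power_fscale) simp
      ultimately have "form_ratio \<A> (dhym_Re \<A> (fscale t \<omega>) \<Phi>) (form_power (fscale t \<omega>)) p =
          (t ^ n - Q p * (t ^ n * inverse t ^ 2) + \<Sigma>) / t ^ n"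
        using v powi_diff_inverse[OF t, of n 2] unfolding form_ratio_def c_def[symmetric] by simp
      also have "\<dots> = 1 - Q p * inverse t ^ 2 + \<Sigma> / t ^ n"
        using t by (simp add: field_simps)
      finally have ratio: "form_ratio \<A> (dhym_Re \<A> (fscale t \<omega>) \<Phi>) (form_power (fscale t \<omega>)) p =
          1 - Q p * inverse t ^ 2 + \<Sigma> / t ^ n" .
      have "(\<Sum>k\<le>n. r t k * \<rho> k p) = - \<alpha> * t * (\<Sigma> / t ^ n)"
        unfolding r_def \<Sigma>_def by (simp add: sum_distrib_left sum_divide_distrib mult.assoc)
      moreover have "scalar_curvature \<A> (fscale t \<omega>) p = scalar_curvature \<A> \<omega> p / t"
        using t by (intro scalar_curvature_fscale) simp
      moreover have "\<alpha> * t * (Q p * inverse t ^ 2) = \<alpha> * Q p / t"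
        using t by (simp add: field_simps power2_eq_square)
      ultimately show ?thesis
        unfolding coupled_residual_def ratio L2_def
        by (simp add: algebra_simps power_int_minus divide_inverse)
    qed
    show "\<forall>\<^sub>F t in at_top. form_eq \<A> 0
       (fn (coupled_residual \<A> (fscale t \<omega>) \<Phi> (\<alpha> * t) (\<lambda>p. - \<alpha> * t + f p / t)))
       (\<lambda>c p vs. t powi (- 1) * fn L2 c p vs + (\<Sum>k\<le>n. r t k * fn (\<rho> k) c p vs))"
      using eventually_gt_at_top[of 0]
    proof eventually_elim
      case (elim t)
      show ?case unfolding form_eq_def fn_def using residual[OF elim] by blast
    qed
  qed
  moreover have "form_eq \<A> (2 * n) L1 (\<lambda>ch p vs. 0) \<and> (\<forall>p. L2 p = 0) \<longleftrightarrow> limit_system \<A> \<omega> F \<alpha> f"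
  proof -
    define E where "E = form_eq \<A> (2 * n) (\<lambda>c p vs. real n * wedge_F \<omega> F c p vs) (\<lambda>c p vs. s * form_power \<omega> c p vs)"
    have "form_eq \<A> (2 * n) L1 (\<lambda>ch p vs. 0) \<longleftrightarrow> E"
    proof -
      have "- a + b = 0 \<longleftrightarrow> a = b" for a b :: real by linarith
      then show ?thesis unfolding E_def L1_def form_eq_def by (simp only:)
    qed
    moreover have "real n * q1 p = s" if E for p
    proof -
      have "real n * wedge_F \<omega> F (chart_at \<A> p) p std_frame = s * form_power \<omega> (chart_at \<A> p) p std_frame"
        using that chart_at[OF atlas] unfolding E_def form_eq_def n_def by simp
      then show ?thesis
        using form_power_positive[OF chart_at[OF atlas], of p] by (simp add: q1_def form_ratio_def field_simps)
    qed
    then have "L2 p = 0 \<longleftrightarrow> scalar_curvature \<A> \<omega> p +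
        \<alpha> * (real n * (real n - 1) / 2 * q2 p - s\<^sup>2 / 2) = f p" if E for p
    proof -
      have "s * real n * q1 p = s\<^sup>2" using \<open>E \<Longrightarrow> real n * q1 p = s\<close> that by (simp add: power2_eq_square mult.assoc)
      then show ?thesis unfolding L2_def Q_def by (simp add: algebra_simps)
    qed
    ultimately show ?thesis
      unfolding limit_system_def n_def[symmetric] s_def[symmetric] q2_def[symmetric] E_def[symmetric] by blast
  qed
  ultimately show ?thesis by blast
qed

end

theorem proposition7:
  fixes \<A> :: "('x::t2_space, 'n::finite) chart set"
    and \<omega> F :: "('x, 'n, real) form"
    and W :: "'i \<Rightarrow> 'x set"
    and g :: "'i \<Rightarrow> 'i \<Rightarrow> 'x \<Rightarrow> complex"
    and h :: "'i \<Rightarrow> 'x \<Rightarrow> real"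
    and A :: "'i \<Rightarrow> ('x, 'n, complex) form"
    and n :: nat and c :: real
  assumes "compact (UNIV :: 'x set)" and "connected (UNIV :: 'x set)"
    and "complex_atlas \<A>" and "n = CARD('n)"
    and "kaehler_form \<A> \<omega>"
    and "line_bundle \<A> W g" and "hermitian_metric \<A> W g h"
    and "unitary_connection \<A> W g h A"
    and "form_on \<A> UNIV 2 F" and "closed_form \<A> 2 F"
    and "form_eq \<A> 2 (curvature W A) (\<lambda>ch p vs. \<i> * complex_of_real (F ch p vs))"
    and "c = slope \<A> \<omega> F"
  shows
    "(\<exists>R1 R2. form_bigo \<A> (2 * n) (int n - 3) R1 \<and> form_bigo \<A> (2 * n) (int n - 4) R2 \<and>
       (\<forall>\<^sub>F t in at_top. form_integral \<A> (dhym_form (fscale t \<omega>) (curvature W A)) \<noteq> 0 \<and>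
         (\<forall>\<zeta>\<in>lie_ext_gauge \<A> W g h \<omega>. \<forall>\<sigma>\<in>{\<omega>, fscale t \<omega>}.
           moment_map \<A> W (fscale t \<omega>) \<sigma> A \<zeta> =
           gauge_pairing \<A> W A \<sigma>
             (\<lambda>ch p vs.
               (- (real n * wedge_F \<omega> F ch p vs) + c * form_power \<omega> ch p vs) * t powi (int n - 1)
               + R1 t ch p vs)
             (\<lambda>ch p vs.
               form_power \<omega> ch p vs * t powi int n
               - (real n * (real n - 1) / 2 * wedge_FF \<omega> F ch p vs
                  - c * real n * wedge_F \<omega> F ch p vs + c\<^sup>2 / 2 * form_power \<omega> ch p vs)
                 * t powi (int n - 2)
               + R2 t ch p vs) \<zeta>)))
     \<and> (\<forall>\<alpha>' f. smooth_fun_on \<A> UNIV f \<longrightarrow>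
         (\<exists>L1 L2.
           leading_part \<A> (2 * n) (int n - 1)
             (\<lambda>t. dhym_Im \<A> (fscale t \<omega>) (\<lambda>ch p vs. \<i> * complex_of_real (F ch p vs))) L1 \<and>
           leading_part \<A> 0 (- 1)
             (\<lambda>t. fn (coupled_residual \<A> (fscale t \<omega>) (\<lambda>ch p vs. \<i> * complex_of_real (F ch p vs))
                (\<alpha>' * t) (\<lambda>p. - \<alpha>' * t + f p / t))) (fn L2) \<and>
           (form_eq \<A> (2 * n) L1 (\<lambda>ch p vs. 0) \<and> (\<forall>p. L2 p = 0) \<longleftrightarrow> limit_system \<A> \<omega> F \<alpha>' f)))
     \<and> (\<forall>\<alpha>'>0. \<exists>\<kappa>>0. (n \<ge> 2 \<longrightarrow> \<kappa> = \<alpha>' * (real n * (real n - 1) / 2)) \<and>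
         ((\<exists>a. limit_system \<A> \<omega> F \<alpha>' (\<lambda>p. a)) \<longleftrightarrow> kaehler_yang_mills \<A> \<omega> F \<kappa>))"
proof -
  interpret kaehler_with_form \<A> \<omega> F
    using assms by unfold_locales
  have mm: "form_eq \<A> 2 (curvature W A) (\<lambda>ch p vs. \<i> * complex_of_real (F ch p vs))" by fact
  obtain R1 R2 where R: "form_bigo \<A> (2 * n) (int n - 3) R1" "form_bigo \<A> (2 * n) (int n - 4) R2"
    and ev: "\<forall>\<^sub>F t in at_top. form_integral \<A> (dhym_form (fscale t \<omega>) (curvature W A)) \<noteq> 0 \<and>
      (\<forall>\<zeta> \<sigma>. moment_map \<A> W (fscale t \<omega>) \<sigma> A \<zeta> = gauge_pairing \<A> W A \<sigma>
         (\<lambda>ch p vs. im_main t ch p vs + R1 t ch p vs)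
         (\<lambda>ch p vs. re_main t ch p vs + R2 t ch p vs) \<zeta>)"
    unfolding \<open>n = CARD('n)\<close> by (rule moment_map_expansion[OF mm])
  note ev' = ev[unfolded im_main_def re_main_def, folded \<open>n = CARD('n)\<close> \<open>c = slope \<A> \<omega> F\<close>]
  note leading = coupled_equations_leading_part[folded \<open>n = CARD('n)\<close>]
  note kym = limit_system_iff_kaehler_yang_mills[folded \<open>n = CARD('n)\<close>]
  show ?thesis
    by (intro conjI, rule exI[of _ R1], rule exI[of _ R2], intro conjI R, rule eventually_mono[OF ev'], blast)
       (intro allI impI leading, assumption, intro allI impI kym)
qed

end
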